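(* Let $R$ be a subring of $\mathbb{Q}$. A group $A$ is $R$-closed if and only if $A$ is local with respect to $\Omega^R$.
   Context: Let $D_R$ be the (multiplicatively closed) set of denominators of reduced fractional expressions of elements of $R$. For a group $G$, a system of equations over $G$ of the form $x_i^e=w_i(x_1,\ldots,x_n)$, $i=1,\ldots,n$, where $e$ is a nonzero integer and $w_i\in G*F$ with $F=F\langle x_1,\ldots,x_n\rangle$ the free group on the indeterminates, is called $R$-nullhomologous if $e\in D_R$ and each $w_i$ is sent to the trivial element by the canonical projection $G*F\to F\to F/[F,F]=H_1(F)$. A solution in $G$ is an $n$-tuple $(g_1,\ldots,g_n)$ of elements of $G$ with $g_i^e=w_i(g_1,\ldots,g_n)$ for all $i$. A group $A$ is $R$-closed if every $R$-nullhomologous system over $A$ has a unique solution in $A$. $\Omega^R$ is the class of group homomorphisms $\alpha\colon\pi\to G$ such that $\pi$ is finitely generated, $G$ is finitely presented, and $\alpha$ induces an isomorphism on $H_1(-;R)$ and a surjection on $H_2(-;R)$. A group $A$ is local with respect to $\Omega^R$ if for any $\alpha\colon\pi\to G$ in $\Omega^R$ and any homomorphism $\phi\colon\pi\to A$ there is a unique homomorphism $\varphi\colon G\to A$ with $\varphi\circ\alpha=\phi$. *)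

theory Defs
  imports
    "HOL-Algebra.Algebra"
    "HOL-Algebra.Algebraic_Closure_Type"
    "HOL-Library.Poly_Mapping"
    "HOL-Library.Infinite_Typeclass"
begin

section \<open>Free groups and free products\<close>

text \<open>
  The monoid presented by the set \<open>L\<close> of letters and the set \<open>S\<close> of relations \<open>l = r\<close> between
  words in \<open>L\<close>. Its elements are the congruence classes of words. Free groups and free products
  are presented in this way, with formal inverses among the letters in the former case.
\<close>

definition word_step :: "'l set \<Rightarrow> ('l list \<times> 'l list) set \<Rightarrow> ('l list \<times> 'l list) set" where
  "word_step L S = {(u @ l @ v, u @ r @ v) | u l r v. (l, r) \<in> S \<and> u \<in> lists L \<and> v \<in> lists L}"

definition word_cong :: "'l set \<Rightarrow> ('l list \<times> 'l list) set \<Rightarrow> ('l list \<times> 'l list) set" where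
  "word_cong L S = (word_step L S \<union> (word_step L S)\<inverse>)\<^sup>* \<inter> (lists L \<times> lists L)"

definition word_monoid :: "'l set \<Rightarrow> ('l list \<times> 'l list) set \<Rightarrow> 'l list set monoid" where
  "word_monoid L S =
    \<lparr>carrier = lists L // word_cong L S,
     monoid.mult = (\<lambda>U V. \<Union>u\<in>U. \<Union>v\<in>V. word_cong L S `` {u @ v}),
     one = word_cong L S `` {[]}\<rparr>"

text \<open>
  The homomorphism out of a presented monoid that extends \<open>f\<close> on letters. It is meaningful
  if \<open>f\<close> respects the relations; then all words in a class have the same value.
\<close>

definition word_lift :: "('c, 'm) monoid_scheme \<Rightarrow> ('l \<Rightarrow> 'c) \<Rightarrow> 'l list set \<Rightarrow> 'c" where
  "word_lift M f U = the_elem ((\<lambda>u. foldr (\<lambda>l y. f l \<otimes>\<^bsub>M\<^esub> y) u \<one>\<^bsub>M\<^esub>) ` U)"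

text \<open>The letter \<open>(x, True)\<close> stands for the generator \<open>x\<close>, and \<open>(x, False)\<close> for its inverse.\<close>

definition free_group :: "'x set \<Rightarrow> ('x \<times> bool) list set monoid" where
  "free_group I = word_monoid (I \<times> UNIV) {([(x, b), (x, \<not> b)], []) | x b. x \<in> I}"

definition free_group_lift ::
    "('c, 'm) monoid_scheme \<Rightarrow> ('x \<Rightarrow> 'c) \<Rightarrow> ('x \<times> bool) list set \<Rightarrow> 'c" where
  "free_group_lift M g = word_lift M (\<lambda>(x, b). if b then g x else inv\<^bsub>M\<^esub> (g x))"

definition free_product ::
    "('a, 'm) monoid_scheme \<Rightarrow> ('b, 'n) monoid_scheme \<Rightarrow> ('a + 'b) list set monoid" where
  "free_product G H = word_monoid (carrier G <+> carrier H)
    ({([Inl a, Inl b], [Inl (a \<otimes>\<^bsub>G\<^esub> b)]) | a b. a \<in> carrier G \<and> b \<in> carrier G} \<union>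
     {([Inr a, Inr b], [Inr (a \<otimes>\<^bsub>H\<^esub> b)]) | a b. a \<in> carrier H \<and> b \<in> carrier H} \<union>
     {([Inl \<one>\<^bsub>G\<^esub>], []), ([Inr \<one>\<^bsub>H\<^esub>], [])})"

definition free_product_lift ::
    "('c, 'm) monoid_scheme \<Rightarrow> ('a \<Rightarrow> 'c) \<Rightarrow> ('b \<Rightarrow> 'c) \<Rightarrow> ('a + 'b) list set \<Rightarrow> 'c" where
  "free_product_lift M f g = word_lift M (case_sum f g)"


section \<open>Finiteness conditions on groups\<close>

definition finitely_generated_group :: "('a, 'm) monoid_scheme \<Rightarrow> bool" where
  "finitely_generated_group G \<longleftrightarrow>
    group G \<and> (\<exists>S. finite S \<and> S \<subseteq> carrier G \<and> generate G S = carrier G)"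

definition normal_closure :: "('a, 'm) monoid_scheme \<Rightarrow> 'a set \<Rightarrow> 'a set" where
  "normal_closure G S = \<Inter> {N. N \<lhd> G \<and> S \<subseteq> N}"

definition finitely_presented_group :: "('a, 'm) monoid_scheme \<Rightarrow> bool" where
  "finitely_presented_group G \<longleftrightarrow>
    group G \<and>
    (\<exists>(n::nat) S. finite S \<and> S \<subseteq> carrier (free_group {..<n}) \<and>
      G \<cong> free_group {..<n} Mod normal_closure (free_group {..<n}) S)"


section \<open>Homology of groups with coefficients in a subring of the rationals\<close>

text \<open>
  \<open>H\<^sub>n(G; R)\<close> with trivial action on \<open>R\<close>, computed by the inhomogeneous (unnormalised) bar
  complex: \<open>C\<^sub>n(G; R)\<close> is the free \<open>R\<close>-module on the symbols \<open>[g\<^sub>1|\<dots>|g\<^sub>n]\<close>, which are represented by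
  lists.
\<close>

definition bar_chains :: "rat set \<Rightarrow> ('a, 'm) monoid_scheme \<Rightarrow> nat \<Rightarrow> ('a list \<Rightarrow>\<^sub>0 rat) set" where
  "bar_chains R G n =
    {c. Poly_Mapping.keys c \<subseteq> {s \<in> lists (carrier G). length s = n} \<and>
        range (Poly_Mapping.lookup c) \<subseteq> R}"

definition linear_extend :: "('s \<Rightarrow> ('t \<Rightarrow>\<^sub>0 rat)) \<Rightarrow> ('s \<Rightarrow>\<^sub>0 rat) \<Rightarrow> ('t \<Rightarrow>\<^sub>0 rat)" where
  "linear_extend f c =
    (\<Sum>s\<in>Poly_Mapping.keys c. Poly_Mapping.map ((*) (Poly_Mapping.lookup c s)) (f s))"

definition bar_boundary_basis :: "('a, 'm) monoid_scheme \<Rightarrow> 'a list \<Rightarrow> ('a list \<Rightarrow>\<^sub>0 rat)" where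
  "bar_boundary_basis G s =
    (if s = [] then 0
     else Poly_Mapping.single (tl s) 1
        + (\<Sum>i<length s - 1.
             Poly_Mapping.single (take i s @ [s ! i \<otimes>\<^bsub>G\<^esub> s ! Suc i] @ drop (i + 2) s) ((-1) ^ Suc i))
        + Poly_Mapping.single (butlast s) ((-1) ^ length s))"

definition bar_boundary :: "('a, 'm) monoid_scheme \<Rightarrow> ('a list \<Rightarrow>\<^sub>0 rat) \<Rightarrow> ('a list \<Rightarrow>\<^sub>0 rat)" where
  "bar_boundary G = linear_extend (bar_boundary_basis G)"

definition bar_cycle_group ::
    "rat set \<Rightarrow> ('a, 'm) monoid_scheme \<Rightarrow> nat \<Rightarrow> ('a list \<Rightarrow>\<^sub>0 rat) monoid" where
  "bar_cycle_group R G n =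
    \<lparr>carrier = {c \<in> bar_chains R G n. bar_boundary G c = 0}, monoid.mult = (+), one = 0\<rparr>"

definition bar_boundaries :: "rat set \<Rightarrow> ('a, 'm) monoid_scheme \<Rightarrow> nat \<Rightarrow> ('a list \<Rightarrow>\<^sub>0 rat) set" where
  "bar_boundaries R G n = bar_boundary G ` bar_chains R G (Suc n)"

definition group_homology ::
    "nat \<Rightarrow> ('a, 'm) monoid_scheme \<Rightarrow> rat set \<Rightarrow> ('a list \<Rightarrow>\<^sub>0 rat) set monoid" where
  "group_homology n G R = bar_cycle_group R G n Mod bar_boundaries R G n"

definition homology_map ::
    "nat \<Rightarrow> ('b, 'm) monoid_scheme \<Rightarrow> rat set \<Rightarrow> ('a \<Rightarrow> 'b) \<Rightarrow>
      ('a list \<Rightarrow>\<^sub>0 rat) set \<Rightarrow> ('b list \<Rightarrow>\<^sub>0 rat) set" where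
  "homology_map n H R \<alpha> Z =
    (\<Union>z\<in>Z. bar_boundaries R H n #>\<^bsub>bar_cycle_group R H n\<^esub>
             linear_extend (\<lambda>s. Poly_Mapping.single (map \<alpha> s) 1) z)"


section \<open>\<open>R\<close>-closed groups and \<open>\<Omega>\<^sup>R\<close>-local groups\<close>

text \<open>
  Denominators may be negative here. Replacing \<open>(e, w)\<close> by \<open>(- e, w\<inverse>)\<close> changes neither the
  solutions of a system nor whether it is nullhomologous.
\<close>

definition denominators :: "rat set \<Rightarrow> int set" where
  "denominators R = {q. q \<noteq> 0 \<and> (\<exists>p. coprime p q \<and> of_int p / of_int q \<in> R)}"

text \<open>The projection \<open>G * F \<rightarrow> F \<rightarrow> F / [F, F]\<close>.\<close>

definition proj_H1 ::
    "('a, 'm) monoid_scheme \<Rightarrow> ('b, 'n) monoid_scheme \<Rightarrow> ('a + 'b) list set \<Rightarrow> 'b set" where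
  "proj_H1 G F w =
    derived F (carrier F) #>\<^bsub>F\<^esub> free_product_lift F (\<lambda>_. \<one>\<^bsub>F\<^esub>) (\<lambda>x. x) w"

text \<open>The systems \<open>x\<^sub>i\<^sup>e = w\<^sub>i(x\<^sub>0, \<dots>, x\<^sub>n\<^sub>-\<^sub>1)\<close>; the indeterminates are the numbers \<open>0, \<dots>, n - 1\<close>.\<close>

definition nullhomologous_system ::
    "rat set \<Rightarrow> ('a, 'm) monoid_scheme \<Rightarrow> nat \<Rightarrow> int \<Rightarrow>
      (nat \<Rightarrow> ('a + (nat \<times> bool) list set) list set) \<Rightarrow> bool" where
  "nullhomologous_system R G n e w \<longleftrightarrow>
    e \<in> denominators R \<and>
    (\<forall>i<n. w i \<in> carrier (free_product G (free_group {..<n})) \<and>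
           proj_H1 G (free_group {..<n}) (w i)
             = \<one>\<^bsub>free_group {..<n} Mod derived (free_group {..<n}) (carrier (free_group {..<n}))\<^esub>)"

definition system_solution ::
    "('a, 'm) monoid_scheme \<Rightarrow> nat \<Rightarrow> int \<Rightarrow>
      (nat \<Rightarrow> ('a + (nat \<times> bool) list set) list set) \<Rightarrow> (nat \<Rightarrow> 'a) \<Rightarrow> bool" where
  "system_solution G n e w g \<longleftrightarrow>
    g \<in> {..<n} \<rightarrow>\<^sub>E carrier G \<and>
    (\<forall>i<n. g i [^]\<^bsub>G\<^esub> e = free_product_lift G (\<lambda>a. a) (free_group_lift G g) (w i))"

definition R_closed :: "rat set \<Rightarrow> ('a, 'm) monoid_scheme \<Rightarrow> bool" where
  "R_closed R A \<longleftrightarrow>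
    (\<forall>n e w. nullhomologous_system R A n e w \<longrightarrow> (\<exists>!g. system_solution A n e w g))"

definition in_Omega ::
    "rat set \<Rightarrow> ('p, 'm) monoid_scheme \<Rightarrow> ('g, 'n) monoid_scheme \<Rightarrow> ('p \<Rightarrow> 'g) \<Rightarrow> bool" where
  "in_Omega R P G \<alpha> \<longleftrightarrow>
    finitely_generated_group P \<and> finitely_presented_group G \<and> \<alpha> \<in> hom P G \<and>
    homology_map 1 G R \<alpha> \<in> iso (group_homology 1 P R) (group_homology 1 G R) \<and>
    homology_map 2 G R \<alpha> \<in> epi (group_homology 2 P R) (group_homology 2 G R)"

text \<open>
  A formula cannot quantify over types, so the types \<open>'p\<close> and \<open>'g\<close> in which the source and the
  target of the maps in \<open>\<Omega>\<^sup>R\<close> live are parameters. Finitely generated groups are countable, so each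
  of them has an isomorphic copy on a subset of any given infinite type.
\<close>

definition Omega_local ::
    "'p itself \<Rightarrow> 'g itself \<Rightarrow> rat set \<Rightarrow> ('a, 'm) monoid_scheme \<Rightarrow> bool" where
  "Omega_local TP TG R A \<longleftrightarrow>
    (\<forall>(P :: 'p monoid) (G :: 'g monoid) \<alpha> \<phi>.
      in_Omega R P G \<alpha> \<and> \<phi> \<in> hom P A \<longrightarrow>
      (\<exists>!\<psi>. \<psi> \<in> hom G A \<inter> extensional (carrier G) \<and> (\<forall>x\<in>carrier P. \<psi> (\<alpha> x) = \<phi> x)))"

end

theory Submission
  imports Defs
begin

text \<open>
  Let \<open>\<alpha> : P \<rightarrow> G\<close> be in \<open>\<Omega>\<^sup>R\<close> and \<open>\<phi> : P \<rightarrow> A\<close> with \<open>A\<close> closed. Since \<open>H\<^sub>1(\<alpha>; R)\<close> is onto, generators of \<open>G\<close>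
  solve a nullhomologous system over \<open>P\<close>; its solution in \<open>A\<close> is the only candidate for the extension of
  \<open>\<phi>\<close>. The candidate is defined on a group \<open>E\<close> generated by \<open>P\<close> and the generators, whose map onto \<open>G\<close> has a
  kernel \<open>K\<close> that is the normal closure of a finite set. By Stallings' argument the hypotheses on \<open>H\<^sub>1\<close> and
  \<open>H\<^sub>2\<close> imply that \<open>K / [E, K]\<close> vanishes after tensoring with \<open>R\<close>, so the normal generators of \<open>K\<close> solve a
  nullhomologous system that is also solved by \<open>1\<close>, and \<open>K\<close> dies in \<open>A\<close>.

  Conversely, let \<open>a\<^sub>j\<close> be the finitely many coefficients of a nullhomologous system \<open>x\<^sub>i\<^sup>e = w\<^sub>i\<close>, and
  consider the evident map from the free group \<open>P = \<langle>y\<^sub>j\<rangle>\<close> to \<open>G = \<langle>y\<^sub>j, x\<^sub>i | x\<^sub>i\<^sup>e = w\<^sub>i\<rangle>\<close>. Extensions of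
  \<open>y\<^sub>j \<mapsto> a\<^sub>j\<close> to \<open>G\<close> are the same as solutions. The map is in \<open>\<Omega>\<^sup>R\<close> because \<open>e\<close> is invertible in \<open>R\<close>;
  moreover \<open>H\<^sub>2(G; R) = 0\<close>, since central extensions of \<open>G\<close> by \<open>R\<close>-modules split.
\<close>

section \<open>Presented monoids\<close>

text \<open>The arguments behind both directions are usually phrased with exact sequences of
  homology with coefficients in \<open>R\<close>; here they are unwound into explicit computations
  with bar chains. The obstacle is that \<open>R\<close> does not act on a closed group
  \<open>A\<close>, which need not be abelian. Every statement about \<open>R\<close>-coefficients
  therefore has to come back as one about group elements: a power with exponent in
  \<open>denominators R\<close> lies in a commutator subgroup. Such powers arise by multiplying a
  relation between chains by a common denominator and evaluating the integral chains in an abelian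
  group. Finite presentation of \<open>G\<close> is what makes the normal generators of K finitely
  many, as a system has finitely many unknowns. In the converse direction the groups consist of
  classes of words, whereas \<open>Omega_local\<close> speaks about two given types; countability
  provides copies there. Auxiliary groups such as E may live on any type, since the homological
  lemmas are polymorphic.\<close>

definition word_value :: "('c, 'm) monoid_scheme \<Rightarrow> ('l \<Rightarrow> 'c) \<Rightarrow> 'l list \<Rightarrow> 'c" where
  "word_value M f u = foldr (\<lambda>l y. f l \<otimes>\<^bsub>M\<^esub> y) u \<one>\<^bsub>M\<^esub>"

lemma word_value_Nil [simp]: "word_value M f [] = \<one>\<^bsub>M\<^esub>"
  by (simp add: word_value_def)

lemma word_value_Cons [simp]: "word_value M f (l # u) = f l \<otimes>\<^bsub>M\<^esub> word_value M f u"
  by (simp add: word_value_def)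

lemma word_value_closed:
  assumes "monoid M" "f \<in> L \<rightarrow> carrier M" "u \<in> lists L"
  shows "word_value M f u \<in> carrier M"
proof -
  interpret monoid M by fact
  show ?thesis using assms(3,2) by (induction u) auto
qed

lemma word_value_append:
  assumes "monoid M" "f \<in> L \<rightarrow> carrier M" "u \<in> lists L" "v \<in> lists L"
  shows "word_value M f (u @ v) = word_value M f u \<otimes>\<^bsub>M\<^esub> word_value M f v"
proof -
  interpret monoid M by fact
  show ?thesis
    using assms(3)
  proof (induction u)
    case Nil
    then show ?case using word_value_closed[OF assms(1,2,4)] by simp
  next
    case (Cons l u)
    have c: "f l \<in> carrier M" "word_value M f u \<in> carrier M" "word_value M f v \<in> carrier M"
      using assms Cons.hyps word_value_closed[OF assms(1,2)] by auto
    then show ?case by (simp add: Cons.IH m_assoc)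
  qed
qed

lemma word_stepE:
  assumes "(x, y) \<in> word_step L S"
  obtains u l r v where "x = u @ l @ v" "y = u @ r @ v" "(l, r) \<in> S" "u \<in> lists L" "v \<in> lists L"
  using assms unfolding word_step_def by blast

locale word_presentation =
  fixes L :: "'l set" and S :: "('l list \<times> 'l list) set"
  assumes relations_in_words: "S \<subseteq> lists L \<times> lists L"
begin

abbreviation word_class :: "'l list \<Rightarrow> 'l list set" where
  "word_class u \<equiv> word_cong L S `` {u}"

lemma word_step_in_words: "(x, y) \<in> word_step L S \<Longrightarrow> x \<in> lists L \<and> y \<in> lists L"
proof -
  assume "(x, y) \<in> word_step L S"
  then obtain u l r v where *: "x = u @ l @ v" "y = u @ r @ v" "(l, r) \<in> S" "u \<in> lists L" "v \<in> lists L"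
    unfolding word_step_def by blast
  moreover have "l \<in> lists L" "r \<in> lists L" using *(3) relations_in_words by blast+
  ultimately show ?thesis by simp
qed

lemma equiv_word_cong: "equiv (lists L) (word_cong L S)"
proof (rule equivI)
  show "word_cong L S \<subseteq> lists L \<times> lists L"
    by (auto simp: word_cong_def)
  show "refl_on (lists L) (word_cong L S)"
    by (auto simp: refl_on_def word_cong_def)
  show "sym (word_cong L S)"
  proof (rule symI)
    fix x y assume "(x, y) \<in> word_cong L S"
    then show "(y, x) \<in> word_cong L S"
      using symD[OF sym_rtrancl[OF sym_Un_converse[of "word_step L S"]], of x y]
      by (simp add: word_cong_def)
  qed
  show "trans (word_cong L S)"
    unfolding word_cong_def by (auto simp: trans_def)
qed

lemma word_step_context:
  assumes "(x, y) \<in> word_step L S" "a \<in> lists L" "b \<in> lists L"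
  shows "(a @ x @ b, a @ y @ b) \<in> word_step L S"
proof -
  obtain u l r v where *: "x = u @ l @ v" "y = u @ r @ v" "(l, r) \<in> S" "u \<in> lists L" "v \<in> lists L"
    using assms(1) unfolding word_step_def by blast
  then have "a @ x @ b = (a @ u) @ l @ (v @ b)" "a @ y @ b = (a @ u) @ r @ (v @ b)"
    "a @ u \<in> lists L" "v @ b \<in> lists L" using assms by auto
  with *(3) show ?thesis unfolding word_step_def by blast
qed

lemma word_cong_context:
  assumes "(x, y) \<in> word_cong L S" "a \<in> lists L" "b \<in> lists L"
  shows "(a @ x @ b, a @ y @ b) \<in> word_cong L S"
proof -
  have "(x, y) \<in> (word_step L S \<union> (word_step L S)\<inverse>)\<^sup>*" and w: "x \<in> lists L" "y \<in> lists L"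
    using assms(1) by (auto simp: word_cong_def)
  from this(1) have "(a @ x @ b, a @ y @ b) \<in> (word_step L S \<union> (word_step L S)\<inverse>)\<^sup>*"
  proof (induction rule: rtrancl_induct)
    case (step y z)
    then have "(a @ y @ b, a @ z @ b) \<in> word_step L S \<union> (word_step L S)\<inverse>"
      using word_step_context assms(2,3) by blast
    with step.IH show ?case by (rule rtrancl_into_rtrancl)
  qed auto
  with w assms show ?thesis by (auto simp: word_cong_def)
qed

lemma word_cong_append:
  assumes "(x, x') \<in> word_cong L S" "(y, y') \<in> word_cong L S"
  shows "(x @ y, x' @ y') \<in> word_cong L S"
proof -
  have w: "x' \<in> lists L" "y \<in> lists L"
    using assms by (auto simp: word_cong_def)
  have "(x @ y, x' @ y) \<in> word_cong L S"
    using word_cong_context[OF assms(1), of "[]" y] w by simp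
  moreover have "(x' @ y, x' @ y') \<in> word_cong L S"
    using word_cong_context[OF assms(2), of x' "[]"] w by simp
  ultimately show ?thesis
    using equiv_word_cong by (meson equiv_def transE)
qed

lemma word_cong_relation:
  assumes "(l, r) \<in> S"
  shows "(l, r) \<in> word_cong L S"
proof -
  have "l = [] @ l @ []" "r = [] @ r @ []" "[] \<in> lists L" by simp_all
  with assms have "(l, r) \<in> word_step L S"
    unfolding word_step_def by blast
  then show ?thesis
    using word_step_in_words by (simp add: word_cong_def r_into_rtrancl)
qed

lemma word_class_eq: "(x, y) \<in> word_cong L S \<Longrightarrow> word_class x = word_class y"
  by (rule equiv_class_eq[OF equiv_word_cong])

lemma mem_word_class_self: "x \<in> lists L \<Longrightarrow> x \<in> word_class x"
  by (rule equiv_class_self[OF equiv_word_cong])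

lemma carrier_word_monoid: "carrier (word_monoid L S) = word_class ` lists L"
  by (auto simp: word_monoid_def quotient_def)

lemma word_class_closed: "u \<in> lists L \<Longrightarrow> word_class u \<in> carrier (word_monoid L S)"
  unfolding carrier_word_monoid by (rule imageI)

lemma one_word_monoid: "\<one>\<^bsub>word_monoid L S\<^esub> = word_class []"
  by (simp add: word_monoid_def)

lemma word_class_mult:
  assumes "x \<in> lists L" "y \<in> lists L"
  shows "word_class x \<otimes>\<^bsub>word_monoid L S\<^esub> word_class y = word_class (x @ y)"
proof -
  have "word_class (u @ v) = word_class (x @ y)" if "u \<in> word_class x" "v \<in> word_class y" for u v
    using word_cong_append[of x u y v] that word_class_eq[of "x @ y" "u @ v"] by blast
  then have "(\<Union>u\<in>word_class x. \<Union>v\<in>word_class y. word_class (u @ v)) =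
      (\<Union>u\<in>word_class x. \<Union>v\<in>word_class y. word_class (x @ y))"
    by (intro SUP_cong refl)
  also have "\<dots> = word_class (x @ y)"
    using mem_word_class_self[OF assms(1)] mem_word_class_self[OF assms(2)] by (intro equalityI UN_least) blast+
  finally show ?thesis by (simp only: word_monoid_def monoid.simps partial_object.simps)
qed

lemma monoid_word_monoid: "monoid (word_monoid L S)"
proof -
  have 2: "\<exists>u \<in> lists L. x = word_class u" if "x \<in> carrier (word_monoid L S)" for x
    using that unfolding carrier_word_monoid by blast
  have 3: "[] \<in> lists L" by simp
  have 4: "u @ v \<in> lists L" if "u \<in> lists L" "v \<in> lists L" for u v
    using that by simp
  show ?thesis
  proof (rule monoidI)
    show "\<one>\<^bsub>word_monoid L S\<^esub> \<in> carrier (word_monoid L S)"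
      unfolding one_word_monoid by (rule word_class_closed[OF 3])
  next
    fix x y assume "x \<in> carrier (word_monoid L S)" "y \<in> carrier (word_monoid L S)"
    then obtain u v where "u \<in> lists L" "v \<in> lists L" "x = word_class u" "y = word_class v"
      using 2 by metis
    then show "x \<otimes>\<^bsub>word_monoid L S\<^esub> y \<in> carrier (word_monoid L S)"
      using word_class_closed[OF 4] word_class_mult by metis
  next
    fix x y z
    assume "x \<in> carrier (word_monoid L S)" "y \<in> carrier (word_monoid L S)" "z \<in> carrier (word_monoid L S)"
    then obtain u v w where "u \<in> lists L" "v \<in> lists L" "w \<in> lists L"
      "x = word_class u" "y = word_class v" "z = word_class w"
      using 2 by metis
    then show "x \<otimes>\<^bsub>word_monoid L S\<^esub> y \<otimes>\<^bsub>word_monoid L S\<^esub> z =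
        x \<otimes>\<^bsub>word_monoid L S\<^esub> (y \<otimes>\<^bsub>word_monoid L S\<^esub> z)"
      using 4 word_class_mult append_assoc by metis
  next
    fix x assume "x \<in> carrier (word_monoid L S)"
    then obtain u where u: "u \<in> lists L" "x = word_class u"
      using 2 by metis
    show "\<one>\<^bsub>word_monoid L S\<^esub> \<otimes>\<^bsub>word_monoid L S\<^esub> x = x"
      unfolding one_word_monoid u(2) word_class_mult[OF 3 u(1)] by simp
    show "x \<otimes>\<^bsub>word_monoid L S\<^esub> \<one>\<^bsub>word_monoid L S\<^esub> = x"
      unfolding one_word_monoid u(2) word_class_mult[OF u(1) 3] by simp
  qed
qed

text \<open>Left inverses of the letters suffice: if \<open>v\<close> is a left inverse of the word
  \<open>u\<close> and \<open>m\<close> one of the letter \<open>l\<close>, then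
  \<open>v @ m\<close> is one of \<open>l # u\<close>, because \<open>m @ [l]\<close> cancels
  inside.\<close>

lemma group_word_monoid:
  assumes inverse: "\<And>l. l \<in> L \<Longrightarrow> \<exists>m \<in> lists L. (m @ [l], []) \<in> word_cong L S"
  shows "group (word_monoid L S)"
proof -
  interpret monoid "word_monoid L S" by (rule monoid_word_monoid)
  have ex: "\<exists>v \<in> lists L. (v @ u, []) \<in> word_cong L S" if "u \<in> lists L" for u
    using that
  proof (induction u)
    case Nil
    have "([], []) \<in> word_cong L S" by (auto simp: word_cong_def)
    then show ?case by auto
  next
    case (Cons l u)
    obtain m where m: "m \<in> lists L" "(m @ [l], []) \<in> word_cong L S"
      using inverse Cons.hyps by blast
    obtain v where v: "v \<in> lists L" "(v @ u, []) \<in> word_cong L S"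
      using Cons.IH by blast
    have "(v @ (m @ [l]) @ u, v @ [] @ u) \<in> word_cong L S"
      by (rule word_cong_context[OF m(2) v(1)]) (use Cons.hyps in auto)
    then have "((v @ m) @ l # u, []) \<in> word_cong L S"
      using v(2) equiv_word_cong by (auto simp: equiv_def elim: transE)
    then show ?case using v m by (metis append_in_lists_conv)
  qed
  show ?thesis
  proof (rule groupI)
    fix x assume "x \<in> carrier (word_monoid L S)"
    then obtain u where u: "u \<in> lists L" "x = word_class u" by (auto simp: carrier_word_monoid)
    obtain v where v: "v \<in> lists L" "(v @ u, []) \<in> word_cong L S" using ex u by blast
    have "word_class v \<otimes>\<^bsub>word_monoid L S\<^esub> x = \<one>\<^bsub>word_monoid L S\<^esub>"
      using u v by (simp add: word_class_mult one_word_monoid word_class_eq)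
    then show "\<exists>y\<in>carrier (word_monoid L S). y \<otimes>\<^bsub>word_monoid L S\<^esub> x = \<one>\<^bsub>word_monoid L S\<^esub>"
      using v by (auto simp: carrier_word_monoid)
  qed (auto simp: m_assoc)
qed

lemma word_monoid_induct [consumes 1, case_names one letter]:
  assumes "x \<in> carrier (word_monoid L S)"
    and "Q \<one>\<^bsub>word_monoid L S\<^esub>"
    and "\<And>l y. l \<in> L \<Longrightarrow> y \<in> carrier (word_monoid L S) \<Longrightarrow> Q y \<Longrightarrow>
           Q (word_class [l] \<otimes>\<^bsub>word_monoid L S\<^esub> y)"
  shows "Q x"
proof -
  have "Q (word_class u)" if "u \<in> lists L" for u
    using that
  proof (induction u)
    case Nil
    then show ?case using assms(2) by (simp add: one_word_monoid)
  next
    case (Cons l u)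
    then have "Q (word_class [l] \<otimes>\<^bsub>word_monoid L S\<^esub> word_class u)"
      by (intro assms(3)) (auto simp: carrier_word_monoid)
    then show ?case using Cons.hyps by (simp add: word_class_mult)
  qed
  then show ?thesis using assms(1) by (auto simp: carrier_word_monoid)
qed

lemma word_value_cong:
  assumes M: "monoid M" and f: "f \<in> L \<rightarrow> carrier M"
    and respects: "\<And>l r. (l, r) \<in> S \<Longrightarrow> word_value M f l = word_value M f r"
    and cong: "(x, y) \<in> word_cong L S"
  shows "word_value M f x = word_value M f y"
proof -
  have value_step: "word_value M f x = word_value M f y" if "(x, y) \<in> word_step L S" for x y
  proof -
    from that obtain u l r v
      where *: "x = u @ l @ v" "y = u @ r @ v" "(l, r) \<in> S" "u \<in> lists L" "v \<in> lists L"
      by (rule word_stepE)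
    have w: "l \<in> lists L" "r \<in> lists L" using subsetD[OF relations_in_words *(3)] by simp_all
    have w2: "l @ v \<in> lists L" "r @ v \<in> lists L"
      using w *(5) by (simp_all only: append_in_lists_conv)
    show ?thesis
      unfolding *(1,2) word_value_append[OF M f *(4) w2(1)] word_value_append[OF M f *(4) w2(2)]
        word_value_append[OF M f w(1) *(5)] word_value_append[OF M f w(2) *(5)] respects[OF *(3)] ..
  qed
  have "(x, y) \<in> (word_step L S \<union> (word_step L S)\<inverse>)\<^sup>*"
    using cong unfolding word_cong_def by blast
  then show ?thesis
  proof (induction rule: rtrancl_induct)
    case (step y z)
    then have "word_value M f y = word_value M f z"
      using value_step[of y z] value_step[of z y] by auto
    with step.IH show ?case by simp
  qed (rule refl)
qed

text \<open>\<open>word_lift\<close> takes the only element of the set of values of a class. That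
  set is a singleton because congruent words have equal values by \<open>word_value_cong\<close>,
  and a class contains its representative.\<close>

lemma
  assumes M: "monoid M" and f: "f \<in> L \<rightarrow> carrier M"
    and respects: "\<And>l r. (l, r) \<in> S \<Longrightarrow> word_value M f l = word_value M f r"
  shows word_lift_hom: "word_lift M f \<in> hom (word_monoid L S) M"
    and word_lift_letter: "l \<in> L \<Longrightarrow> word_lift M f (word_class [l]) = f l"
proof -
  interpret M: monoid M by (rule M)
  have lift: "word_lift M f (word_class u) = word_value M f u" if "u \<in> lists L" for u
  proof -
    have "word_value M f v = word_value M f u" if "v \<in> word_class u" for v
      using that word_value_cong[OF M f respects, of u v] by simp
    then have "word_value M f ` word_class u = {word_value M f u}"
      using mem_word_class_self[OF that] by blast
    then show ?thesis by (simp add: word_lift_def flip: word_value_def)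
  qed
  have rep: "\<exists>u \<in> lists L. x = word_class u" if "x \<in> carrier (word_monoid L S)" for x
    using that unfolding carrier_word_monoid by blast
  show "word_lift M f \<in> hom (word_monoid L S) M"
  proof (rule homI)
    fix x assume "x \<in> carrier (word_monoid L S)"
    then show "word_lift M f x \<in> carrier M"
      using rep lift word_value_closed[OF M f] by metis
  next
    fix x y assume "x \<in> carrier (word_monoid L S)" "y \<in> carrier (word_monoid L S)"
    then obtain u v where *: "u \<in> lists L" "v \<in> lists L" "x = word_class u" "y = word_class v"
      using rep by metis
    then have "u @ v \<in> lists L" by simp
    with * show "word_lift M f (x \<otimes>\<^bsub>word_monoid L S\<^esub> y) = word_lift M f x \<otimes>\<^bsub>M\<^esub> word_lift M f y"
      by (simp only: word_class_mult lift word_value_append[OF M f])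
  qed
  show "word_lift M f (word_class [l]) = f l" if "l \<in> L"
    using M.r_one[OF funcset_mem[OF f that]] that by (subst lift) simp_all
qed

end

section \<open>Free groups and free products\<close>

lemma hom_eq_on_generate:
  assumes "group G" "group M" "f \<in> hom G M" "h \<in> hom G M" "S \<subseteq> carrier G"
    and eq: "\<And>s. s \<in> S \<Longrightarrow> f s = h s" and "x \<in> generate G S"
  shows "f x = h x"
proof -
  interpret G: group G by fact
  interpret f: group_hom G M f using assms by (simp add: group_hom_def group_hom_axioms_def)
  interpret h: group_hom G M h using assms by (simp add: group_hom_def group_hom_axioms_def)
  show ?thesis
    using assms(7)
  proof (induction rule: generate.induct)
    case (inv s)
    then show ?case using eq assms(5) by (metis f.hom_inv h.hom_inv subsetD)
  next
    case (eng x y)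
    then show ?case using G.generate_in_carrier[OF assms(5)] by simp
  qed (use eq in auto)
qed

definition free_gen :: "'x set \<Rightarrow> 'x \<Rightarrow> ('x \<times> bool) list set" where
  "free_gen I x = word_cong (I \<times> UNIV) {([(x, b), (x, \<not> b)], []) | x b. x \<in> I} `` {[(x, True)]}"

lemma word_presentation_free_group:
  "word_presentation (I \<times> (UNIV :: bool set)) {([(x, b), (x, \<not> b)], []) | x b. x \<in> I}"
  by unfold_locales auto

lemma group_free_group: "group (free_group I)"
proof -
  interpret W: word_presentation "I \<times> (UNIV :: bool set)" "{([(x, b), (x, \<not> b)], []) | x b. x \<in> I}"
    by (rule word_presentation_free_group)
  show ?thesis
    unfolding free_group_def
  proof (rule W.group_word_monoid)
    fix l assume "l \<in> I \<times> (UNIV :: bool set)"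
    then obtain x b where l: "l = (x, b)" "x \<in> I" by auto
    have "([(x, \<not> b), (x, \<not> \<not> b)], []) \<in> {([(x, b), (x, \<not> b)], []) | x b. x \<in> I}"
      using l(2) by blast
    then show "\<exists>m\<in>lists (I \<times> UNIV). (m @ [l], []) \<in> word_cong (I \<times> UNIV) {([(x, b), (x, \<not> b)], []) |x b. x \<in> I}"
      using W.word_cong_relation l by (intro bexI[of _ "[(x, \<not> b)]"]) auto
  qed
qed

lemma free_gen_closed: "x \<in> I \<Longrightarrow> free_gen I x \<in> carrier (free_group I)"
  unfolding free_group_def free_gen_def
  by (rule word_presentation.word_class_closed[OF word_presentation_free_group]) auto

lemma free_gen_subset: "free_gen I ` I \<subseteq> carrier (free_group I)"
  by (rule image_subsetI) (rule free_gen_closed)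

lemma
  assumes "group M" and g: "g \<in> I \<rightarrow> carrier M"
  shows free_group_lift_hom: "free_group_lift M g \<in> hom (free_group I) M"
    and free_group_lift_gen: "x \<in> I \<Longrightarrow> free_group_lift M g (free_gen I x) = g x"
proof -
  interpret M: group M by fact
  interpret W: word_presentation "I \<times> (UNIV :: bool set)" "{([(x, b), (x, \<not> b)], []) | x b. x \<in> I}"
    by (rule word_presentation_free_group)
  let ?f = "\<lambda>(x, b). if b then g x else inv\<^bsub>M\<^esub> (g x)"
  have f: "?f \<in> I \<times> UNIV \<rightarrow> carrier M"
    using funcset_mem[OF g] by auto
  have r: "word_value M ?f l = word_value M ?f r"
    if "(l, r) \<in> {([(x, b), (x, \<not> b)], []) | x b. x \<in> I}" for l r
    using that funcset_mem[OF g] by auto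
  show "free_group_lift M g \<in> hom (free_group I) M"
    unfolding free_group_lift_def free_group_def
    by (rule W.word_lift_hom[OF M.is_monoid f r])
  show "free_group_lift M g (free_gen I x) = g x" if "x \<in> I"
    unfolding free_group_lift_def free_gen_def
    using W.word_lift_letter[OF M.is_monoid f r, of "(x, True)"] that by simp
qed

text \<open>The letters \<open>(x, False)\<close> do not come from generators, but the defining
  relations make their classes the inverses of the \<open>free_gen I x\<close>; the rest is an
  induction over words.\<close>

lemma free_group_generated: "carrier (free_group I) = generate (free_group I) (free_gen I ` I)"
proof
  interpret F: group "free_group I" by (rule group_free_group)
  interpret W: word_presentation "I \<times> (UNIV :: bool set)" "{([(x, b), (x, \<not> b)], []) | x b. x \<in> I}"
    by (rule word_presentation_free_group)
  let ?gen = "generate (free_group I) (free_gen I ` I)"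
  have sub: "free_gen I ` I \<subseteq> carrier (free_group I)"
    by (rule free_gen_subset)
  show "?gen \<subseteq> carrier (free_group I)"
    by (rule F.generate_incl[OF sub])
  have letter_mem: "W.word_class [l] \<in> ?gen" if "l \<in> I \<times> UNIV" for l
  proof -
    obtain x b where l: "l = (x, b)" "x \<in> I" using \<open>l \<in> I \<times> UNIV\<close> by auto
    show ?thesis
    proof (cases b)
      case True
      then show ?thesis
        using l generate.incl[of "free_gen I x" "free_gen I ` I" "free_group I"] by (simp add: free_gen_def)
    next
      case False
      have r: "([(x, True), (x, False)], []) \<in> {([(x, b), (x, \<not> b)], []) | x b. x \<in> I}"
        using l(2) by (intro CollectI exI[of _ x] exI[of _ True]) simp
      have w: "[(x, True)] \<in> lists (I \<times> UNIV)" "[(x, False)] \<in> lists (I \<times> UNIV)"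
        using l(2) by auto
      have c: "W.word_class [(x, False)] \<in> carrier (free_group I)"
        unfolding free_group_def by (rule W.word_class_closed[OF w(2)])
      have h: "free_gen I x \<otimes>\<^bsub>free_group I\<^esub> W.word_class [(x, False)] = \<one>\<^bsub>free_group I\<^esub>"
        unfolding free_gen_def free_group_def W.word_class_mult[OF w] W.one_word_monoid
        using W.word_class_eq[OF W.word_cong_relation[OF r]] by simp
      have gen: "free_gen I x \<in> carrier (free_group I)"
        by (rule free_gen_closed[OF l(2)])
      have "inv\<^bsub>free_group I\<^esub> free_gen I x = W.word_class [l]"
        using F.inv_equality[OF F.inv_comm[OF h gen c] gen c] l(1) False by simp
      moreover have "inv\<^bsub>free_group I\<^esub> free_gen I x \<in> ?gen"
        by (rule generate.inv) (rule imageI[OF l(2)])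
      ultimately show ?thesis by (simp only:)
    qed
  qed
  show "carrier (free_group I) \<subseteq> ?gen"
  proof
    fix w assume "w \<in> carrier (free_group I)"
    then show "w \<in> ?gen"
      unfolding free_group_def
    proof (induction rule: W.word_monoid_induct)
      case one
      show ?case by (rule generate.one)
    next
      case (letter l y)
      then show ?case
        using generate.eng[OF letter_mem[OF letter(1)] letter(3)[folded free_group_def]]
        unfolding free_group_def by simp
    qed
  qed
qed

lemma free_group_hom_unique:
  assumes "group M" "f \<in> hom (free_group I) M" "h \<in> hom (free_group I) M"
    and "\<And>x. x \<in> I \<Longrightarrow> f (free_gen I x) = h (free_gen I x)" "u \<in> carrier (free_group I)"
  shows "f u = h u"
proof -
  have "free_gen I ` I \<subseteq> carrier (free_group I)"
    by (rule free_gen_subset)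
  moreover have "u \<in> generate (free_group I) (free_gen I ` I)"
    using assms(5) unfolding free_group_generated .
  ultimately show ?thesis
    using hom_eq_on_generate[OF group_free_group assms(1,2,3) _ _, of "free_gen I ` I" u] assms(4) by force
qed

text \<open>Countability is what allows free groups and their quotients to be copied into an
  arbitrary infinite type.\<close>

lemma countable_carrier_free_group:
  fixes I :: "'x::countable set"
  shows "countable (carrier (free_group I))"
  unfolding free_group_def word_presentation.carrier_word_monoid[OF word_presentation_free_group]
  by (rule countable_image[OF countable_subset[OF subset_UNIV]]) simp


section \<open>Free products of two groups and their universal property\<close>

abbreviation free_product_relations ::
    "('a, 'm) monoid_scheme \<Rightarrow> ('b, 'n) monoid_scheme \<Rightarrow> (('a + 'b) list \<times> ('a + 'b) list) set" where
  "free_product_relations G H \<equiv>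
     {([Inl a, Inl b], [Inl (a \<otimes>\<^bsub>G\<^esub> b)]) | a b. a \<in> carrier G \<and> b \<in> carrier G} \<union>
     {([Inr a, Inr b], [Inr (a \<otimes>\<^bsub>H\<^esub> b)]) | a b. a \<in> carrier H \<and> b \<in> carrier H} \<union>
     {([Inl \<one>\<^bsub>G\<^esub>], []), ([Inr \<one>\<^bsub>H\<^esub>], [])}"

definition free_inl ::
    "('a, 'm) monoid_scheme \<Rightarrow> ('b, 'n) monoid_scheme \<Rightarrow> 'a \<Rightarrow> ('a + 'b) list set" where
  "free_inl G H a = word_cong (carrier G <+> carrier H) (free_product_relations G H) `` {[Inl a]}"

definition free_inr ::
    "('a, 'm) monoid_scheme \<Rightarrow> ('b, 'n) monoid_scheme \<Rightarrow> 'b \<Rightarrow> ('a + 'b) list set" where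
  "free_inr G H b = word_cong (carrier G <+> carrier H) (free_product_relations G H) `` {[Inr b]}"

locale group_pair = G: group G + H: group H
  for G :: "('a, 'm) monoid_scheme" and H :: "('b, 'n) monoid_scheme"
begin

sublocale W: word_presentation "carrier G <+> carrier H" "free_product_relations G H"
proof unfold_locales
  show "free_product_relations G H \<subseteq> lists (carrier G <+> carrier H) \<times> lists (carrier G <+> carrier H)"
    by auto
qed

lemma relation_Inl: "a \<in> carrier G \<Longrightarrow> b \<in> carrier G \<Longrightarrow>
    ([Inl a, Inl b], [Inl (a \<otimes>\<^bsub>G\<^esub> b)]) \<in> word_cong (carrier G <+> carrier H) (free_product_relations G H)"
  by (rule W.word_cong_relation) blast

lemma relation_Inr: "a \<in> carrier H \<Longrightarrow> b \<in> carrier H \<Longrightarrow>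
    ([Inr a, Inr b], [Inr (a \<otimes>\<^bsub>H\<^esub> b)]) \<in> word_cong (carrier G <+> carrier H) (free_product_relations G H)"
  by (rule W.word_cong_relation) blast

lemma relation_one:
  "([Inl \<one>\<^bsub>G\<^esub>], []) \<in> word_cong (carrier G <+> carrier H) (free_product_relations G H)"
  "([Inr \<one>\<^bsub>H\<^esub>], []) \<in> word_cong (carrier G <+> carrier H) (free_product_relations G H)"
  by (rule W.word_cong_relation, blast)+

lemma group_free_product: "group (free_product G H)"
  unfolding free_product_def
proof (rule W.group_word_monoid)
  have trans: "trans (word_cong (carrier G <+> carrier H) (free_product_relations G H))"
    using W.equiv_word_cong by (simp add: equiv_def)
  fix l assume "l \<in> carrier G <+> carrier H"
  then show "\<exists>m\<in>lists (carrier G <+> carrier H).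
      (m @ [l], []) \<in> word_cong (carrier G <+> carrier H) (free_product_relations G H)"
  proof
    fix a assume a: "l = Inl a" "a \<in> carrier G"
    have "([Inl (inv\<^bsub>G\<^esub> a), Inl a], []) \<in> word_cong (carrier G <+> carrier H) (free_product_relations G H)"
      using transD[OF trans relation_Inl[OF G.inv_closed[OF a(2)] a(2)]] relation_one(1)
      by (simp only: G.l_inv[OF a(2)])
    moreover have "[Inl (inv\<^bsub>G\<^esub> a)] \<in> lists (carrier G <+> carrier H)"
      using a(2) by auto
    ultimately show ?thesis
      unfolding a(1) by (intro bexI[of _ "[Inl (inv\<^bsub>G\<^esub> a)]"]) simp_all
  next
    fix a assume a: "l = Inr a" "a \<in> carrier H"
    have "([Inr (inv\<^bsub>H\<^esub> a), Inr a], []) \<in> word_cong (carrier G <+> carrier H) (free_product_relations G H)"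
      using transD[OF trans relation_Inr[OF H.inv_closed[OF a(2)] a(2)]] relation_one(2)
      by (simp only: H.l_inv[OF a(2)])
    moreover have "[Inr (inv\<^bsub>H\<^esub> a)] \<in> lists (carrier G <+> carrier H)"
      using a(2) by auto
    ultimately show ?thesis
      unfolding a(1) by (intro bexI[of _ "[Inr (inv\<^bsub>H\<^esub> a)]"]) simp_all
  qed
qed

lemma free_inl_hom: "free_inl G H \<in> hom G (free_product G H)"
proof (rule homI)
  show "free_inl G H a \<in> carrier (free_product G H)" if "a \<in> carrier G" for a
    using that unfolding free_inl_def free_product_def by (intro W.word_class_closed) auto
  show "free_inl G H (a \<otimes>\<^bsub>G\<^esub> b) = free_inl G H a \<otimes>\<^bsub>free_product G H\<^esub> free_inl G H b"
    if "a \<in> carrier G" "b \<in> carrier G" for a b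
    using that W.word_class_eq[OF relation_Inl[OF that]] unfolding free_inl_def free_product_def
    by (subst W.word_class_mult) auto
qed

lemma free_inr_hom: "free_inr G H \<in> hom H (free_product G H)"
proof (rule homI)
  show "free_inr G H a \<in> carrier (free_product G H)" if "a \<in> carrier H" for a
    using that unfolding free_inr_def free_product_def by (intro W.word_class_closed) auto
  show "free_inr G H (a \<otimes>\<^bsub>H\<^esub> b) = free_inr G H a \<otimes>\<^bsub>free_product G H\<^esub> free_inr G H b"
    if "a \<in> carrier H" "b \<in> carrier H" for a b
    using that W.word_class_eq[OF relation_Inr[OF that]] unfolding free_inr_def free_product_def
    by (subst W.word_class_mult) auto
qed

lemma
  assumes "group M" "f \<in> hom G M" "h \<in> hom H M"
  shows free_product_lift_hom: "free_product_lift M f h \<in> hom (free_product G H) M"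
    and free_product_lift_inl: "a \<in> carrier G \<Longrightarrow> free_product_lift M f h (free_inl G H a) = f a"
    and free_product_lift_inr: "b \<in> carrier H \<Longrightarrow> free_product_lift M f h (free_inr G H b) = h b"
proof -
  interpret M: group M by fact
  interpret f: group_hom G M f using assms by (simp add: group_hom_def group_hom_axioms_def G.is_group)
  interpret h: group_hom H M h using assms by (simp add: group_hom_def group_hom_axioms_def H.is_group)
  have c: "case_sum f h \<in> carrier G <+> carrier H \<rightarrow> carrier M"
    by auto
  have r: "word_value M (case_sum f h) l = word_value M (case_sum f h) r"
    if "(l, r) \<in> free_product_relations G H" for l r
    using that by (auto simp: M.m_assoc)
  show "free_product_lift M f h \<in> hom (free_product G H) M"
    unfolding free_product_lift_def free_product_def by (rule W.word_lift_hom[OF M.is_monoid c r])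
  show "free_product_lift M f h (free_inl G H a) = f a" if "a \<in> carrier G"
    unfolding free_product_lift_def free_inl_def
    using W.word_lift_letter[OF M.is_monoid c r, of "Inl a"] that by auto
  show "free_product_lift M f h (free_inr G H b) = h b" if "b \<in> carrier H"
    unfolding free_product_lift_def free_inr_def
    using W.word_lift_letter[OF M.is_monoid c r, of "Inr b"] that by auto
qed

lemma free_product_generated:
  "carrier (free_product G H) =
    generate (free_product G H) (free_inl G H ` carrier G \<union> free_inr G H ` carrier H)"
    (is "_ = generate _ ?S")
proof
  interpret W': group "free_product G H" by (rule group_free_product)
  have "?S \<subseteq> carrier (free_product G H)"
    by (intro Un_least image_subsetI hom_in_carrier[OF free_inl_hom] hom_in_carrier[OF free_inr_hom])
  then show "generate (free_product G H) ?S \<subseteq> carrier (free_product G H)"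
    by (rule W'.generate_incl)
  have letter_mem: "W.word_class [l] \<in> ?S" if "l \<in> carrier G <+> carrier H" for l
    using that
  proof (rule PlusE)
    fix a assume a: "a \<in> carrier G" "l = Inl a"
    have "W.word_class [l] = free_inl G H a" by (simp only: free_inl_def a(2))
    then show ?thesis using a(1) by (simp only: UnI1 imageI)
  next
    fix a assume a: "a \<in> carrier H" "l = Inr a"
    have "W.word_class [l] = free_inr G H a" by (simp only: free_inr_def a(2))
    then show ?thesis using a(1) by (simp only: UnI2 imageI)
  qed
  show "carrier (free_product G H) \<subseteq> generate (free_product G H) ?S"
  proof
    fix w assume "w \<in> carrier (free_product G H)"
    then show "w \<in> generate (free_product G H) ?S"
      unfolding free_product_def
    proof (induction rule: W.word_monoid_induct)
      case one
      show ?case by (rule generate.one)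
    next
      case (letter l y)
      then show ?case
        using generate.eng[OF generate.incl[OF letter_mem[OF letter(1)]] letter(3)[folded free_product_def]]
        unfolding free_product_def by simp
    qed
  qed
qed

end

section \<open>Chains with rational coefficients\<close>

abbreviation scale :: "rat \<Rightarrow> ('s \<Rightarrow>\<^sub>0 rat) \<Rightarrow> ('s \<Rightarrow>\<^sub>0 rat)" where
  "scale r \<equiv> Poly_Mapping.map ((*) r)"

abbreviation basis :: "'s \<Rightarrow> ('s \<Rightarrow>\<^sub>0 rat)" where
  "basis s \<equiv> Poly_Mapping.single s 1"

lemma lookup_scale [simp]: "Poly_Mapping.lookup (scale r c) s = r * Poly_Mapping.lookup c s"
  by (simp add: Poly_Mapping.map.rep_eq when_def)

lemma scale_simps [simp]:
  "scale r 0 = 0" "scale 0 c = 0" "scale 1 c = c" "scale r (scale q c) = scale (r * q) c"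
  by (simp_all add: poly_mapping_eq_iff fun_eq_iff)

lemma scale_single [simp]: "scale r (Poly_Mapping.single s q) = Poly_Mapping.single s (r * q)"
  by (simp add: poly_mapping_eq_iff fun_eq_iff lookup_single when_def)

lemma scale_distrib:
  "scale r (c + d) = scale r c + scale r d"
  "scale r (c - d) = scale r c - scale r d"
  "scale r (- c) = - scale r c"
  "scale (r + q) c = scale r c + scale q c"
  by (simp_all add: poly_mapping_eq_iff fun_eq_iff lookup_add lookup_minus algebra_simps)

lemma scale_uminus_one: "scale (- 1) c = - c"
  by (simp add: poly_mapping_eq_iff fun_eq_iff)

lemma keys_scale: "Poly_Mapping.keys (scale r c) \<subseteq> Poly_Mapping.keys c"
  by (auto simp: in_keys_iff)

text \<open>\<open>linear_extend\<close> sums over the support, which changes under addition and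
  scaling. Over a common finite superset the range of summation is fixed, so linearity can be
  checked coefficientwise.\<close>

lemma lookup_linear_extend:
  assumes "finite A" "Poly_Mapping.keys c \<subseteq> A"
  shows "Poly_Mapping.lookup (linear_extend f c) t =
    (\<Sum>s\<in>A. Poly_Mapping.lookup c s * Poly_Mapping.lookup (f s) t)"
proof -
  have "(\<Sum>s\<in>Poly_Mapping.keys c. Poly_Mapping.lookup c s * Poly_Mapping.lookup (f s) t) =
      (\<Sum>s\<in>A. Poly_Mapping.lookup c s * Poly_Mapping.lookup (f s) t)"
    using assms by (intro sum.mono_neutral_left) (auto simp: in_keys_iff)
  then show ?thesis
    by (simp add: linear_extend_def lookup_sum)
qed

lemma linear_extend_zero [simp]: "linear_extend f 0 = 0"
  by (simp add: linear_extend_def)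

lemma linear_extend_add: "linear_extend f (c + d) = linear_extend f c + linear_extend f d"
proof (rule poly_mapping_eqI)
  fix t
  let ?A = "Poly_Mapping.keys c \<union> Poly_Mapping.keys d"
  have "Poly_Mapping.keys (c + d) \<subseteq> ?A" by (rule keys_add)
  then show "Poly_Mapping.lookup (linear_extend f (c + d)) t =
      Poly_Mapping.lookup (linear_extend f c + linear_extend f d) t"
    by (simp add: lookup_linear_extend[where A = ?A] lookup_add algebra_simps sum.distrib)
qed

lemma linear_extend_scale: "linear_extend f (scale r c) = scale r (linear_extend f c)"
  by (rule poly_mapping_eqI)
    (simp add: lookup_linear_extend[where A = "Poly_Mapping.keys c"] keys_scale sum_distrib_left mult.assoc)

lemma linear_extend_uminus: "linear_extend f (- c) = - linear_extend f c"
  using linear_extend_scale[of f "- 1" c] by (simp add: scale_uminus_one)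

lemma linear_extend_diff: "linear_extend f (c - d) = linear_extend f c - linear_extend f d"
  using linear_extend_add[of f c "- d"] by (simp add: linear_extend_uminus)

lemma linear_extend_single [simp]: "linear_extend f (Poly_Mapping.single s r) = scale r (f s)"
  by (cases "r = 0") (simp_all add: linear_extend_def)

lemma linear_extend_sum: "linear_extend f (\<Sum>i\<in>I. c i) = (\<Sum>i\<in>I. linear_extend f (c i))"
  by (induction I rule: infinite_finite_induct) (simp_all add: linear_extend_add)

lemmas linear_extend_simps = linear_extend_add linear_extend_diff linear_extend_uminus linear_extend_scale

lemma sum_single_lookup:
  "(\<Sum>s\<in>Poly_Mapping.keys c. Poly_Mapping.single s (Poly_Mapping.lookup c s)) = (c :: 's \<Rightarrow>\<^sub>0 rat)"
  by (rule poly_mapping_eqI) (auto simp: lookup_sum lookup_single when_def in_keys_iff)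

lemma linear_extend_basis [simp]: "linear_extend basis c = c"
  using sum_single_lookup[of c] by (simp add: linear_extend_def)

lemma linear_extend_comp:
  "linear_extend f (linear_extend g c) = linear_extend (\<lambda>s. linear_extend f (g s)) c"
  unfolding linear_extend_def[of g c] linear_extend_sum linear_extend_scale
  by (simp add: linear_extend_def[of _ c])

lemma linear_extend_cong:
  "(\<And>s. s \<in> Poly_Mapping.keys c \<Longrightarrow> f s = g s) \<Longrightarrow> linear_extend f c = linear_extend g c"
  by (simp add: linear_extend_def)

lemma linear_extend_add_fun:
  "linear_extend (\<lambda>s. f s + g s) c = linear_extend f c + linear_extend g c"
  by (simp add: linear_extend_def scale_distrib sum.distrib)

lemma linear_extend_uminus_fun:
  "linear_extend (\<lambda>s. - f s) c = - linear_extend f c"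
  by (simp add: linear_extend_def scale_distrib sum_negf)

section \<open>Subrings of the rationals and their denominators\<close>

locale rat_subring =
  fixes R :: "rat set"
  assumes one_mem: "1 \<in> R"
    and add_mem: "\<And>a b. a \<in> R \<Longrightarrow> b \<in> R \<Longrightarrow> a + b \<in> R"
    and uminus_mem: "\<And>a. a \<in> R \<Longrightarrow> - a \<in> R"
    and mult_mem: "\<And>a b. a \<in> R \<Longrightarrow> b \<in> R \<Longrightarrow> a * b \<in> R"
begin

lemma zero_mem: "0 \<in> R"
  using add_mem[OF one_mem uminus_mem[OF one_mem]] by simp

lemma of_nat_mem: "of_nat n \<in> R"
  by (induction n) (simp_all add: zero_mem add_mem one_mem)

lemma of_int_mem: "of_int k \<in> R"
  by (cases k) (auto simp: of_nat_mem uminus_mem simp del: of_nat_Suc)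

lemma power_mem: "a \<in> R \<Longrightarrow> a ^ n \<in> R"
  by (induction n) (simp_all add: one_mem mult_mem)

text \<open>Bezout: if a p + b e = 1, then 1/e = a (p/e) + b, which lies in \<open>R\<close> as soon
  as p/e does. This is what allows chains to be divided by \<open>e\<close> later on.\<close>

lemma denominators_iff: "e \<in> denominators R \<longleftrightarrow> e \<noteq> 0 \<and> 1 / of_int e \<in> R"
proof
  assume "e \<in> denominators R"
  then obtain p where e: "e \<noteq> 0" "coprime p e" "of_int p / of_int e \<in> R"
    by (auto simp: denominators_def)
  then obtain a b where "a * p + b * e = 1"
    using bezout_int[of p e] by auto
  then have ab: "of_int a * of_int p + of_int b * of_int e = (1 :: rat)"
    by (metis of_int_1 of_int_add of_int_mult)
  have "of_int a * (of_int p / of_int e) + of_int b =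
      (of_int a * of_int p + of_int b * of_int e) / (of_int e :: rat)"
    using e(1) by (simp add: add_divide_distrib)
  also have "\<dots> = 1 / of_int e"
    by (simp only: ab)
  finally have "1 / of_int e \<in> R"
    using add_mem[OF mult_mem[OF of_int_mem e(3)] of_int_mem, of a b] by simp
  then show "e \<noteq> 0 \<and> 1 / of_int e \<in> R"
    using e(1) by simp
next
  assume "e \<noteq> 0 \<and> 1 / of_int e \<in> R"
  then show "e \<in> denominators R"
    unfolding denominators_def by (auto intro!: exI[of _ 1])
qed

lemma one_denominator: "1 \<in> denominators R"
  by (simp add: denominators_iff one_mem)

lemma mult_denominators: "d \<in> denominators R \<Longrightarrow> e \<in> denominators R \<Longrightarrow> d * e \<in> denominators R"
  using mult_mem[of "1 / of_int d" "1 / of_int e"] by (auto simp: denominators_iff)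

lemma denominator_of_mem:
  assumes "r \<in> R"
  obtains e where "e \<in> denominators R" "of_int e * r \<in> \<int>"
proof -
  obtain p q where r: "r = of_int p / of_int q" "q > 0" "coprime p q"
    by (metis Fract_of_int_quotient quotient_of_unique quotient_of_div quotient_of_coprime quotient_of_denom_pos surj_pair)
  then have "q \<in> denominators R" using assms unfolding denominators_def by auto
  moreover have "of_int q * r \<in> \<int>" using r by simp
  ultimately show ?thesis using that by blast
qed

text \<open>The product of the individual denominators works, since \<open>Pr\<close> survives
  multiplication. The predicate is arbitrary because it will be integrality of a coefficient,
  membership of a power in a subgroup, and agreement of a power with an element of \<open>P\<close>
  modulo commutators.\<close>

lemma common_denominator:
  fixes Pr :: "int \<Rightarrow> 'x \<Rightarrow> bool"
  assumes "finite T" "\<And>x. x \<in> T \<Longrightarrow> \<exists>e \<in> denominators R. Pr e x"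
    and mult: "\<And>d e x. x \<in> T \<Longrightarrow> Pr e x \<Longrightarrow> d \<in> denominators R \<Longrightarrow> Pr (e * d) x"
  obtains e where "e \<in> denominators R" "\<And>x. x \<in> T \<Longrightarrow> Pr e x"
proof -
  have "\<exists>e \<in> denominators R. \<forall>x\<in>Y. Pr e x" if "finite Y" "Y \<subseteq> T" for Y
    using that
  proof (induction Y)
    case empty
    then show ?case using one_denominator by auto
  next
    case (insert x Y)
    then obtain e where e: "e \<in> denominators R" "\<forall>x\<in>Y. Pr e x" by auto
    obtain d where d: "d \<in> denominators R" "Pr d x" using assms(2) insert.prems by auto
    have "Pr (e * d) y" if "y \<in> insert x Y" for y
      using that mult e d insert.prems by (metis insertE insert_subset mult.commute subsetD)
    then show ?case using mult_denominators[OF e(1) d(1)] by blast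
  qed
  from this[OF assms(1) subset_refl] obtain e where e: "e \<in> denominators R" "\<forall>x\<in>T. Pr e x" ..
  show ?thesis by (rule that[OF e(1)]) (rule bspec[OF e(2)])
qed

end

lemma rat_subring_Ints: "rat_subring \<int>"
  by unfold_locales auto

lemma rat_subringI:
  assumes "subring R (ring_of_type_algebra :: rat ring)"
  shows "rat_subring R"
proof -
  let ?Q = "ring_of_type_algebra :: rat ring"
  have ops: "x \<oplus>\<^bsub>?Q\<^esub> y = x + y" "x \<otimes>\<^bsub>?Q\<^esub> y = x * y" "\<one>\<^bsub>?Q\<^esub> = 1" for x y
    by (simp_all add: ring_of_type_algebra_def)
  interpret Q: ring ?Q
    by (rule ring_from_type_algebra)
  show ?thesis
  proof
    show "1 \<in> R" using subringE(3)[OF assms] ops by simp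
    show "a + b \<in> R" if "a \<in> R" "b \<in> R" for a b
      using subringE(7)[OF assms that] ops by simp
    show "a * b \<in> R" if "a \<in> R" "b \<in> R" for a b
      using subringE(6)[OF assms that] ops by simp
    show "- a \<in> R" if "a \<in> R" for a
    proof -
      have "\<ominus>\<^bsub>?Q\<^esub> a = - a"
        by (rule Q.minus_equality) (simp_all add: ring_of_type_algebra_def)
      then show ?thesis using subringE(5)[OF assms that] by simp
    qed
  qed
qed

section \<open>The bar complex\<close>

lemma bar_boundary_linear:
  "bar_boundary G (c + d) = bar_boundary G c + bar_boundary G d"
  "bar_boundary G (c - d) = bar_boundary G c - bar_boundary G d"
  "bar_boundary G (- c) = - bar_boundary G c"
  "bar_boundary G (scale r c) = scale r (bar_boundary G c)"
  "bar_boundary G 0 = 0"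
  by (simp_all add: bar_boundary_def linear_extend_simps)

lemma bar_boundary_single:
  "bar_boundary G (Poly_Mapping.single s r) = scale r (bar_boundary_basis G s)"
  by (simp add: bar_boundary_def)

lemma bar_boundary_basis_simps:
  "bar_boundary_basis G [a] = 0"
  "bar_boundary_basis G [a, b] = basis [b] - basis [a \<otimes>\<^bsub>G\<^esub> b] + basis [a]"
  "bar_boundary_basis G [a, b, c] =
    basis [b, c] - basis [a \<otimes>\<^bsub>G\<^esub> b, c] + basis [a, b \<otimes>\<^bsub>G\<^esub> c] - basis [a, b]"
  by (simp_all add: bar_boundary_basis_def single_uminus single_diff lessThan_Suc eval_nat_numeral
      flip: single_add)

abbreviation push :: "('a \<Rightarrow> 'b) \<Rightarrow> ('a list \<Rightarrow>\<^sub>0 rat) \<Rightarrow> ('b list \<Rightarrow>\<^sub>0 rat)" where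
  "push f \<equiv> linear_extend (\<lambda>s. Poly_Mapping.single (map f s) 1)"

lemma push_push: "push f (push g c) = push (f \<circ> g) c"
  by (simp add: linear_extend_comp)

context rat_subring
begin

lemma bar_chainsD:
  assumes "c \<in> bar_chains R G n"
  shows "s \<in> Poly_Mapping.keys c \<Longrightarrow> s \<in> lists (carrier G)"
    and "s \<in> Poly_Mapping.keys c \<Longrightarrow> length s = n"
    and "Poly_Mapping.lookup c s \<in> R"
  using assms unfolding bar_chains_def by (auto simp del: in_lists_conv_set)

lemma bar_chainsI:
  assumes "\<And>s. s \<in> Poly_Mapping.keys c \<Longrightarrow> s \<in> lists (carrier G) \<and> length s = n"
    and "\<And>s. Poly_Mapping.lookup c s \<in> R"
  shows "c \<in> bar_chains R G n"
  using assms unfolding bar_chains_def by (auto simp del: in_lists_conv_set)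

lemma zero_bar_chains: "0 \<in> bar_chains R G n"
  by (rule bar_chainsI) (simp_all add: zero_mem)

lemma add_bar_chains:
  "c \<in> bar_chains R G n \<Longrightarrow> d \<in> bar_chains R G n \<Longrightarrow> c + d \<in> bar_chains R G n"
  using keys_add[of c d] by (intro bar_chainsI) (auto simp: lookup_add add_mem bar_chainsD(3) dest: bar_chainsD(1,2))

lemma scale_bar_chains: "r \<in> R \<Longrightarrow> c \<in> bar_chains R G n \<Longrightarrow> scale r c \<in> bar_chains R G n"
  using keys_scale[of r c] by (intro bar_chainsI) (auto simp: mult_mem bar_chainsD(3) dest: bar_chainsD(1,2))

lemma uminus_bar_chains: "c \<in> bar_chains R G n \<Longrightarrow> - c \<in> bar_chains R G n"
  using scale_bar_chains[OF uminus_mem[OF one_mem], of c] by (simp add: scale_uminus_one)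

lemma diff_bar_chains:
  "c \<in> bar_chains R G n \<Longrightarrow> d \<in> bar_chains R G n \<Longrightarrow> c - d \<in> bar_chains R G n"
  using add_bar_chains[OF _ uminus_bar_chains, of c G n d] by simp

lemma single_bar_chains:
  "s \<in> lists (carrier G) \<Longrightarrow> length s = n \<Longrightarrow> r \<in> R \<Longrightarrow> Poly_Mapping.single s r \<in> bar_chains R G n"
  by (intro bar_chainsI) (auto simp: lookup_single when_def zero_mem split: if_splits)

lemma basis_bar_chains:
  "s \<in> lists (carrier G) \<Longrightarrow> length s = n \<Longrightarrow> basis s \<in> bar_chains R G n"
  by (intro single_bar_chains one_mem)

lemma sum_bar_chains: "(\<And>i. i \<in> I \<Longrightarrow> c i \<in> bar_chains R G n) \<Longrightarrow> (\<Sum>i\<in>I. c i) \<in> bar_chains R G n"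
  by (induction I rule: infinite_finite_induct) (simp_all add: zero_bar_chains add_bar_chains)

lemma linear_extend_bar_chains:
  assumes "c \<in> bar_chains R G n"
    and "\<And>s. s \<in> lists (carrier G) \<Longrightarrow> length s = n \<Longrightarrow> f s \<in> bar_chains R H m"
  shows "linear_extend f c \<in> bar_chains R H m"
  unfolding linear_extend_def
  by (intro sum_bar_chains scale_bar_chains bar_chainsD(3)[OF assms(1)] assms(2)
      bar_chainsD(1)[OF assms(1)] bar_chainsD(2)[OF assms(1)])

text \<open>Reduces a claim about all chains to one about simplices; \<open>V\<close> will be a set
  of boundaries or \<open>H1_image\<close>.\<close>

lemma linear_extend_mem_submodule:
  assumes "c \<in> bar_chains R G n" and "0 \<in> V"
    and "\<And>x y. x \<in> V \<Longrightarrow> y \<in> V \<Longrightarrow> x + y \<in> V" and "\<And>r x. r \<in> R \<Longrightarrow> x \<in> V \<Longrightarrow> scale r x \<in> V"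
    and "\<And>s. s \<in> lists (carrier G) \<Longrightarrow> length s = n \<Longrightarrow> f s \<in> V"
  shows "linear_extend f c \<in> V"
proof -
  have "(\<Sum>s\<in>I. scale (Poly_Mapping.lookup c s) (f s)) \<in> V" if "I \<subseteq> Poly_Mapping.keys c" for I
    using that
  proof (induction I rule: infinite_finite_induct)
    case (insert s I)
    then have "scale (Poly_Mapping.lookup c s) (f s) \<in> V"
      by (intro assms(4,5) bar_chainsD[OF assms(1)]) auto
    then show ?case using insert assms(3) by simp
  qed (simp_all add: assms(2))
  then show ?thesis by (simp add: linear_extend_def)
qed

lemma linear_extend_chains_cong:
  assumes "c \<in> bar_chains R G n"
    and "\<And>s. s \<in> lists (carrier G) \<Longrightarrow> length s = n \<Longrightarrow> f s = g s"
  shows "linear_extend f c = linear_extend g c"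
  using bar_chainsD(1,2)[OF assms(1)] assms(2) by (intro linear_extend_cong) blast

lemma push_bar_chains:
  assumes "c \<in> bar_chains R G n" "\<And>x. x \<in> carrier G \<Longrightarrow> f x \<in> carrier H"
  shows "push f c \<in> bar_chains R H n"
  using assms(1)
proof (rule linear_extend_bar_chains)
  fix s assume "s \<in> lists (carrier G)" "length s = n"
  then show "basis (map f s) \<in> bar_chains R H n"
    using assms(2) by (intro basis_bar_chains) auto
qed

lemma push_cong:
  assumes "c \<in> bar_chains R G n" "\<And>x. x \<in> carrier G \<Longrightarrow> f x = g x"
  shows "push f c = push g c"
  using assms(1)
proof (rule linear_extend_chains_cong)
  fix s assume "s \<in> lists (carrier G)" "length s = n"
  then have "map f s = map g s" using assms(2) by auto
  then show "basis (map f s) = basis (map g s)" by (simp only:)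
qed

lemma bar_boundary_basis_chains:
  assumes "monoid G" "s \<in> lists (carrier G)" "length s = Suc n"
  shows "bar_boundary_basis G s \<in> bar_chains R G n"
proof -
  interpret monoid G by fact
  have nonempty: "s \<noteq> []" using assms(3) by auto
  have nth: "s ! i \<in> carrier G" if "i < Suc n" for i
    using assms that by auto
  have sub: "set (take i s) \<subseteq> carrier G" "set (drop i s) \<subseteq> carrier G" "set (tl s) \<subseteq> carrier G"
    "set (butlast s) \<subseteq> carrier G" for i
    using assms(2) set_take_subset[of i s] set_drop_subset[of i s] in_set_butlastD[of _ s] list.set_sel(2)[of s]
      assms(3) by (auto simp: in_lists_conv_set) (cases s; auto)+
  have power: "(- 1) ^ k \<in> R" for k
    by (intro power_mem uminus_mem one_mem)
  show ?thesis
    unfolding bar_boundary_basis_def if_not_P[OF nonempty]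
    by (intro add_bar_chains sum_bar_chains single_bar_chains power one_mem)
      (use assms(3) sub(3,4) subsetD[OF sub(1)] subsetD[OF sub(2)] nth in \<open>auto simp: in_lists_conv_set\<close>)
qed

lemma bar_boundary_chains:
  "monoid G \<Longrightarrow> c \<in> bar_chains R G (Suc n) \<Longrightarrow> bar_boundary G c \<in> bar_chains R G n"
  unfolding bar_boundary_def by (intro linear_extend_bar_chains bar_boundary_basis_chains)

lemma push_bar_boundary_basis:
  assumes "s \<in> lists (carrier P)" "f \<in> hom P G"
  shows "push f (bar_boundary_basis P s) = bar_boundary_basis G (map f s)"
proof -
  have "f (s ! i \<otimes>\<^bsub>P\<^esub> s ! Suc i) = f (s ! i) \<otimes>\<^bsub>G\<^esub> f (s ! Suc i)" if "i < length s - 1" for i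
    using that assms by (intro hom_mult[OF assms(2)]) (auto simp: in_lists_conv_set)
  then show ?thesis
    unfolding bar_boundary_basis_def
    by (simp add: linear_extend_add linear_extend_sum map_tl map_butlast take_map drop_map)
qed

lemma push_bar_boundary:
  assumes "c \<in> bar_chains R P n" "f \<in> hom P G"
  shows "push f (bar_boundary P c) = bar_boundary G (push f c)"
  unfolding bar_boundary_def linear_extend_comp using assms(1)
  by (rule linear_extend_chains_cong) (simp add: push_bar_boundary_basis[OF _ assms(2)])

lemma bar_boundary_chains_1: "c \<in> bar_chains R G 1 \<Longrightarrow> bar_boundary G c = 0"
proof -
  assume "c \<in> bar_chains R G 1"
  then have "bar_boundary G c = linear_extend (\<lambda>_. 0) c"
    unfolding bar_boundary_def
    by (rule linear_extend_chains_cong) (auto simp: bar_boundary_basis_simps length_Suc_conv)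
  then show ?thesis by (simp add: linear_extend_def)
qed

text \<open>Only homology in degrees 1 and 2 occurs, and every 1-chain is a cycle; so this is the
  one degree in which the vanishing of the square of the boundary takes a computation.\<close>

lemma bar_boundary_boundary_3:
  assumes "monoid G" "c \<in> bar_chains R G 3"
  shows "bar_boundary G (bar_boundary G c) = 0"
proof -
  interpret monoid G by fact
  have "bar_boundary G (bar_boundary G c) = linear_extend (\<lambda>_. 0) c"
    unfolding bar_boundary_def linear_extend_comp using assms(2)
  proof (rule linear_extend_chains_cong)
    fix s assume s: "s \<in> lists (carrier G)" "length s = 3"
    then obtain x y z where "s = [x, y, z]"
      by (auto simp: length_Suc_conv eval_nat_numeral)
    with s(1) show "linear_extend (bar_boundary_basis G) (bar_boundary_basis G s) = 0"
      by (simp add: bar_boundary_basis_simps linear_extend_simps m_assoc)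
  qed
  then show ?thesis by (simp add: linear_extend_def)
qed

lemma bar_boundariesI: "c \<in> bar_chains R G (Suc n) \<Longrightarrow> bar_boundary G c \<in> bar_boundaries R G n"
  unfolding bar_boundaries_def by (rule imageI)

lemma bar_boundariesE:
  assumes "b \<in> bar_boundaries R G n"
  obtains c where "c \<in> bar_chains R G (Suc n)" "b = bar_boundary G c"
  using assms unfolding bar_boundaries_def by (elim imageE)

lemma
  shows zero_bar_boundaries: "0 \<in> bar_boundaries R G n"
    and add_bar_boundaries: "b \<in> bar_boundaries R G n \<Longrightarrow> d \<in> bar_boundaries R G n \<Longrightarrow> b + d \<in> bar_boundaries R G n"
    and scale_bar_boundaries: "r \<in> R \<Longrightarrow> b \<in> bar_boundaries R G n \<Longrightarrow> scale r b \<in> bar_boundaries R G n"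
proof -
  show "0 \<in> bar_boundaries R G n"
    using bar_boundariesI[OF zero_bar_chains, of G n] by (simp add: bar_boundary_linear)
  show "b + d \<in> bar_boundaries R G n" if bd: "b \<in> bar_boundaries R G n" "d \<in> bar_boundaries R G n"
  proof -
    obtain b' d' where "b' \<in> bar_chains R G (Suc n)" "d' \<in> bar_chains R G (Suc n)"
      "b = bar_boundary G b'" "d = bar_boundary G d'"
      using bd by (elim bar_boundariesE)
    then show ?thesis using bar_boundariesI[OF add_bar_chains, of b' G n d'] by (simp add: bar_boundary_linear)
  qed
  show "scale r b \<in> bar_boundaries R G n" if r: "r \<in> R" and "b \<in> bar_boundaries R G n"
  proof -
    obtain b' where "b' \<in> bar_chains R G (Suc n)" "b = bar_boundary G b'"
      using \<open>b \<in> bar_boundaries R G n\<close> by (elim bar_boundariesE)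
    then show ?thesis using bar_boundariesI[OF scale_bar_chains[OF r], of b' G n] by (simp add: bar_boundary_linear)
  qed
qed

lemma uminus_bar_boundaries: "b \<in> bar_boundaries R G n \<Longrightarrow> - b \<in> bar_boundaries R G n"
  using scale_bar_boundaries[OF uminus_mem[OF one_mem], of b] by (simp add: scale_uminus_one)

lemma diff_bar_boundaries:
  "b \<in> bar_boundaries R G n \<Longrightarrow> d \<in> bar_boundaries R G n \<Longrightarrow> b - d \<in> bar_boundaries R G n"
  using add_bar_boundaries[OF _ uminus_bar_boundaries, of b G n d] by simp

lemma push_bar_boundaries:
  assumes "b \<in> bar_boundaries R P n" "f \<in> hom P G"
  shows "push f b \<in> bar_boundaries R G n"
proof -
  obtain c where "c \<in> bar_chains R P (Suc n)" "b = bar_boundary P c"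
    using assms(1) by (elim bar_boundariesE)
  then show ?thesis
    using bar_boundariesI[OF push_bar_chains[of c P "Suc n" f G]] hom_in_carrier[OF assms(2)]
      push_bar_boundary[OF _ assms(2)] by simp
qed

end

section \<open>Homology in low degrees\<close>

definition additive_group :: "'a::ab_group_add set \<Rightarrow> 'a monoid" where
  "additive_group A = \<lparr>carrier = A, monoid.mult = (+), one = 0\<rparr>"

definition additive_subset :: "'a::ab_group_add set \<Rightarrow> bool" where
  "additive_subset A \<longleftrightarrow> 0 \<in> A \<and> (\<forall>x\<in>A. \<forall>y\<in>A. x + y \<in> A) \<and> (\<forall>x\<in>A. - x \<in> A)"

lemma additive_group_simps [simp]:
  "carrier (additive_group A) = A" "x \<otimes>\<^bsub>additive_group A\<^esub> y = x + y" "\<one>\<^bsub>additive_group A\<^esub> = 0"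
  by (simp_all add: additive_group_def)

text \<open>One setting for the three kinds of quotients that occur: cycles modulo boundaries, all
  chains modulo boundaries, and 1-chains modulo \<open>H1_image\<close>.\<close>

locale additive_quotient =
  fixes A V :: "'a::ab_group_add set"
  assumes A: "additive_subset A" and V: "additive_subset V" and VA: "V \<subseteq> A"
begin

lemma comm_group_additive: "comm_group (additive_group A)"
proof (rule comm_groupI)
  fix x assume "x \<in> carrier (additive_group A)"
  then show "\<exists>y\<in>carrier (additive_group A). y \<otimes>\<^bsub>additive_group A\<^esub> x = \<one>\<^bsub>additive_group A\<^esub>"
    using A by (intro bexI[of _ "- x"]) (auto simp: additive_subset_def)
qed (use A in \<open>auto simp: additive_subset_def algebra_simps\<close>)

sublocale add: comm_group "additive_group A"
  by (rule comm_group_additive)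

lemma inv_additive: "x \<in> A \<Longrightarrow> inv\<^bsub>additive_group A\<^esub> x = - x"
  using A by (intro add.inv_equality) (auto simp: additive_subset_def)

lemma normal_additive: "V \<lhd> additive_group A"
proof (rule add.subgroup_imp_normal)
  show "subgroup V (additive_group A)"
    using V VA by (intro add.subgroupI) (auto simp: inv_additive additive_subset_def)
qed

sublocale V: normal V "additive_group A"
  by (rule normal_additive)

abbreviation coset :: "'a \<Rightarrow> 'a set" where
  "coset x \<equiv> V #>\<^bsub>additive_group A\<^esub> x"

lemma coset_eq: "coset x = (\<lambda>b. b + x) ` V"
  by (auto simp: r_coset_def)

lemma coset_eq_iff: "coset x = coset y \<longleftrightarrow> x - y \<in> V"
proof
  assume "coset x = coset y"
  moreover have "x \<in> coset x" using V by (auto simp: coset_eq additive_subset_def intro: image_eqI[of _ _ 0])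
  ultimately have "x \<in> coset y" by simp
  then show "x - y \<in> V" by (auto simp: coset_eq)
next
  assume *: "x - y \<in> V"
  have "coset x \<subseteq> coset y" if "x - y \<in> V" for x y
  proof
    fix z assume "z \<in> coset x"
    then obtain b where "b \<in> V" "z = b + x" by (auto simp: coset_eq)
    then have "b + (x - y) \<in> V" "z = (b + (x - y)) + y"
      using V that by (auto simp: additive_subset_def)
    then show "z \<in> coset y" unfolding coset_eq by blast
  qed
  moreover have "y - x \<in> V"
    using V * by (metis additive_subset_def minus_diff_eq)
  ultimately show "coset x = coset y" using * by blast
qed

lemma mem_coset_iff: "z \<in> coset y \<longleftrightarrow> z - y \<in> V"
  by (auto simp: coset_eq image_iff intro: bexI[of _ "z - y"])

lemma carrier_quotient: "carrier (additive_group A Mod V) = coset ` A"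
  by (simp add: carrier_FactGroup)

lemma coset_closed: "x \<in> A \<Longrightarrow> coset x \<in> carrier (additive_group A Mod V)"
  unfolding carrier_quotient by (rule imageI)

lemma comm_group_quotient: "comm_group (additive_group A Mod V)"
  by (rule add.abelian_FactGroup[OF V.is_subgroup])

lemma coset_mult:
  "x \<in> A \<Longrightarrow> y \<in> A \<Longrightarrow> coset x \<otimes>\<^bsub>additive_group A Mod V\<^esub> coset y = coset (x + y)"
  using V.rcos_sum[of x y] by simp

lemma one_quotient: "\<one>\<^bsub>additive_group A Mod V\<^esub> = coset 0"
  by (simp add: coset_eq)

lemma coset_int_pow:
  fixes k :: int
  assumes "x \<in> A"
  shows "coset x [^]\<^bsub>additive_group A Mod V\<^esub> k = coset (x [^]\<^bsub>additive_group A\<^esub> k)"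
  using V.FactGroup_int_pow[of x k] assms by simp

end

context rat_subring
begin

lemma additive_bar_chains: "additive_subset (bar_chains R G n)"
  unfolding additive_subset_def by (intro conjI ballI zero_bar_chains add_bar_chains uminus_bar_chains)

lemma additive_bar_boundaries: "additive_subset (bar_boundaries R G n)"
  unfolding additive_subset_def
  by (intro conjI ballI zero_bar_boundaries add_bar_boundaries uminus_bar_boundaries)

lemma additive_bar_cycles: "additive_subset {c \<in> bar_chains R G n. bar_boundary G c = 0}"
  unfolding additive_subset_def
  by (auto simp: bar_boundary_linear zero_bar_chains add_bar_chains uminus_bar_chains)

lemma bar_boundaries_subset: "monoid G \<Longrightarrow> bar_boundaries R G n \<subseteq> bar_chains R G n"
  using bar_boundary_chains by (auto elim!: bar_boundariesE)

lemma bar_boundaries_cycles: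
  assumes "monoid G" "n = 1 \<or> n = 2" "b \<in> bar_boundaries R G n"
  shows "b \<in> bar_chains R G n" "bar_boundary G b = 0"
proof -
  obtain c where c: "c \<in> bar_chains R G (Suc n)" "b = bar_boundary G c"
    using assms(3) by (elim bar_boundariesE)
  show b: "b \<in> bar_chains R G n" using c bar_boundary_chains[OF assms(1)] by simp
  show "bar_boundary G b = 0"
    using assms(2) b c bar_boundary_chains_1 bar_boundary_boundary_3[OF assms(1)]
    by (auto simp: numeral_3_eq_3 numeral_2_eq_2)
qed

lemma
  assumes "monoid P" "monoid G" and n: "n = 1 \<or> n = 2" and \<alpha>: "\<alpha> \<in> hom P G"
  shows homology_map_hom: "homology_map n G R \<alpha> \<in> hom (group_homology n P R) (group_homology n G R)"
    and homology_map_surj_iff: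
      "homology_map n G R \<alpha> ` carrier (group_homology n P R) = carrier (group_homology n G R) \<longleftrightarrow>
        (\<forall>z \<in> bar_chains R G n. bar_boundary G z = 0 \<longrightarrow>
          (\<exists>y \<in> bar_chains R P n. bar_boundary P y = 0 \<and> z - push \<alpha> y \<in> bar_boundaries R G n))"
    and homology_map_inj_iff:
      "inj_on (homology_map n G R \<alpha>) (carrier (group_homology n P R)) \<longleftrightarrow>
        (\<forall>z \<in> bar_chains R P n. bar_boundary P z = 0 \<longrightarrow> push \<alpha> z \<in> bar_boundaries R G n \<longrightarrow>
          z \<in> bar_boundaries R P n)"
proof -
  define ZP where "ZP = {c \<in> bar_chains R P n. bar_boundary P c = 0}"
  define ZG where "ZG = {c \<in> bar_chains R G n. bar_boundary G c = 0}"
  have cP: "bar_cycle_group R P n = additive_group ZP" and cG: "bar_cycle_group R G n = additive_group ZG"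
    by (simp_all add: bar_cycle_group_def additive_group_def ZP_def ZG_def)
  interpret P: additive_quotient ZP "bar_boundaries R P n"
    using bar_boundaries_cycles[OF assms(1) n] additive_bar_cycles additive_bar_boundaries
    by unfold_locales (auto simp: ZP_def)
  interpret G: additive_quotient ZG "bar_boundaries R G n"
    using bar_boundaries_cycles[OF assms(2) n] additive_bar_cycles additive_bar_boundaries
    by unfold_locales (auto simp: ZG_def)
  have push: "push \<alpha> z \<in> ZG" if "z \<in> ZP" for z
    using that push_bar_boundary[OF _ \<alpha>, of z n] push_bar_chains[of z P n \<alpha> G] hom_in_carrier[OF \<alpha>]
    by (simp add: ZP_def ZG_def)
  \<comment> \<open>Representatives of one class differ by a boundary, and
    \<open>push \<alpha>\<close> preserves boundaries, so the union in \<open>homology_map\<close>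
    runs over equal cosets.\<close>
  have map: "homology_map n G R \<alpha> (P.coset z) = G.coset (push \<alpha> z)" for z
  proof -
    have "G.coset (push \<alpha> y) = G.coset (push \<alpha> z)" if "y \<in> P.coset z" for y
      using that push_bar_boundaries[OF _ \<alpha>, of "y - z" n]
      by (simp add: P.mem_coset_iff G.coset_eq_iff linear_extend_diff)
    moreover have "z \<in> P.coset z"
      by (simp add: P.mem_coset_iff zero_bar_boundaries)
    ultimately show ?thesis
      unfolding homology_map_def cG by (metis (no_types, lifting) SUP_eq_const empty_iff)
  qed
  note defs = group_homology_def cP cG P.carrier_quotient G.carrier_quotient
  show "homology_map n G R \<alpha> \<in> hom (group_homology n P R) (group_homology n G R)"
  proof (rule homI)
    fix x assume "x \<in> carrier (group_homology n P R)"
    then show "homology_map n G R \<alpha> x \<in> carrier (group_homology n G R)"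
      using push by (auto simp: defs map)
  next
    fix x y assume "x \<in> carrier (group_homology n P R)" "y \<in> carrier (group_homology n P R)"
    then obtain z w where zw: "z \<in> ZP" "w \<in> ZP" "x = P.coset z" "y = P.coset w"
      by (auto simp: defs)
    then show "homology_map n G R \<alpha> (x \<otimes>\<^bsub>group_homology n P R\<^esub> y) =
        homology_map n G R \<alpha> x \<otimes>\<^bsub>group_homology n G R\<^esub> homology_map n G R \<alpha> y"
      by (simp only: group_homology_def cP cG P.coset_mult G.coset_mult map push linear_extend_add)
  qed
  have "homology_map n G R \<alpha> ` P.coset ` ZP = G.coset ` ZG \<longleftrightarrow>
      (\<forall>z\<in>ZG. \<exists>y\<in>ZP. z - push \<alpha> y \<in> bar_boundaries R G n)"
  proof -
    have sub: "homology_map n G R \<alpha> ` P.coset ` ZP \<subseteq> G.coset ` ZG"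
      using push by (auto simp: map)
    have mem: "G.coset z \<in> homology_map n G R \<alpha> ` P.coset ` ZP \<longleftrightarrow>
        (\<exists>y\<in>ZP. z - push \<alpha> y \<in> bar_boundaries R G n)" for z
      unfolding image_iff bex_simps map G.coset_eq_iff by (simp add: image_iff map G.coset_eq_iff)
    show ?thesis
      unfolding set_eq_subset image_subset_iff[of G.coset] Ball_def mem using sub by simp
  qed
  then show "homology_map n G R \<alpha> ` carrier (group_homology n P R) = carrier (group_homology n G R) \<longleftrightarrow>
      (\<forall>z \<in> bar_chains R G n. bar_boundary G z = 0 \<longrightarrow>
        (\<exists>y \<in> bar_chains R P n. bar_boundary P y = 0 \<and> z - push \<alpha> y \<in> bar_boundaries R G n))"
    unfolding defs by (auto simp: ZP_def ZG_def)
  have "inj_on (homology_map n G R \<alpha>) (P.coset ` ZP) \<longleftrightarrow>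
      (\<forall>z\<in>ZP. push \<alpha> z \<in> bar_boundaries R G n \<longrightarrow> z \<in> bar_boundaries R P n)"
  proof
    assume inj: "inj_on (homology_map n G R \<alpha>) (P.coset ` ZP)"
    show "\<forall>z\<in>ZP. push \<alpha> z \<in> bar_boundaries R G n \<longrightarrow> z \<in> bar_boundaries R P n"
    proof (intro ballI impI)
      fix z assume z: "z \<in> ZP" "push \<alpha> z \<in> bar_boundaries R G n"
      have "0 \<in> ZP" by (simp add: ZP_def zero_bar_chains bar_boundary_linear)
      moreover have "homology_map n G R \<alpha> (P.coset z) = homology_map n G R \<alpha> (P.coset 0)"
        using z(2) by (simp add: map G.coset_eq_iff)
      ultimately have "P.coset z = P.coset 0"
        using inj_onD[OF inj] z(1) by blast
      then show "z \<in> bar_boundaries R P n" by (simp add: P.coset_eq_iff)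
    qed
  next
    assume *: "\<forall>z\<in>ZP. push \<alpha> z \<in> bar_boundaries R G n \<longrightarrow> z \<in> bar_boundaries R P n"
    show "inj_on (homology_map n G R \<alpha>) (P.coset ` ZP)"
    proof (rule inj_onI)
      fix x y assume xy: "x \<in> P.coset ` ZP" "y \<in> P.coset ` ZP" "homology_map n G R \<alpha> x = homology_map n G R \<alpha> y"
      then obtain z w where zw: "z \<in> ZP" "w \<in> ZP" "x = P.coset z" "y = P.coset w" by blast
      then have "push \<alpha> (z - w) \<in> bar_boundaries R G n"
        using xy(3) by (simp add: map G.coset_eq_iff linear_extend_diff)
      moreover have "z - w \<in> ZP"
        using zw by (simp add: ZP_def diff_bar_chains bar_boundary_linear)
      ultimately show "x = y" using * zw by (simp add: P.coset_eq_iff)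
    qed
  qed
  then show "inj_on (homology_map n G R \<alpha>) (carrier (group_homology n P R)) \<longleftrightarrow>
      (\<forall>z \<in> bar_chains R P n. bar_boundary P z = 0 \<longrightarrow> push \<alpha> z \<in> bar_boundaries R G n \<longrightarrow>
        z \<in> bar_boundaries R P n)"
    unfolding defs by (auto simp: ZP_def)
qed

text \<open>No cycle condition appears here or in \<open>H1_inj\<close>, since every 1-chain is a
  cycle.\<close>

definition H1_surj :: "('p, 'm) monoid_scheme \<Rightarrow> ('g, 'n) monoid_scheme \<Rightarrow> ('p \<Rightarrow> 'g) \<Rightarrow> bool" where
  "H1_surj P G \<alpha> \<longleftrightarrow>
    (\<forall>z \<in> bar_chains R G 1. \<exists>y \<in> bar_chains R P 1. z - push \<alpha> y \<in> bar_boundaries R G 1)"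

definition H1_inj :: "('p, 'm) monoid_scheme \<Rightarrow> ('g, 'n) monoid_scheme \<Rightarrow> ('p \<Rightarrow> 'g) \<Rightarrow> bool" where
  "H1_inj P G \<alpha> \<longleftrightarrow>
    (\<forall>z \<in> bar_chains R P 1. push \<alpha> z \<in> bar_boundaries R G 1 \<longrightarrow> z \<in> bar_boundaries R P 1)"

definition H2_surj :: "('p, 'm) monoid_scheme \<Rightarrow> ('g, 'n) monoid_scheme \<Rightarrow> ('p \<Rightarrow> 'g) \<Rightarrow> bool" where
  "H2_surj P G \<alpha> \<longleftrightarrow>
    (\<forall>z \<in> bar_chains R G 2. bar_boundary G z = 0 \<longrightarrow>
      (\<exists>y \<in> bar_chains R P 2. bar_boundary P y = 0 \<and> z - push \<alpha> y \<in> bar_boundaries R G 2))"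

lemma in_Omega_iff:
  "in_Omega R P G \<alpha> \<longleftrightarrow> finitely_generated_group P \<and> finitely_presented_group G \<and> \<alpha> \<in> hom P G \<and>
    H1_surj P G \<alpha> \<and> H1_inj P G \<alpha> \<and> H2_surj P G \<alpha>"
proof (cases "finitely_generated_group P \<and> finitely_presented_group G \<and> \<alpha> \<in> hom P G")
  case True
  then have P: "monoid P" and G: "monoid G" and \<alpha>: "\<alpha> \<in> hom P G"
    by (auto simp: finitely_generated_group_def finitely_presented_group_def group.is_monoid)
  have n: "(1::nat) = 1 \<or> (1::nat) = 2" "(2::nat) = 1 \<or> (2::nat) = 2" by simp_all
  have 1: "homology_map 1 G R \<alpha> \<in> iso (group_homology 1 P R) (group_homology 1 G R) \<longleftrightarrow>
      H1_inj P G \<alpha> \<and> H1_surj P G \<alpha>"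
    unfolding iso_def bij_betw_def mem_Collect_eq homology_map_surj_iff[OF P G n(1) \<alpha>]
      homology_map_inj_iff[OF P G n(1) \<alpha>] H1_surj_def H1_inj_def
    using homology_map_hom[OF P G n(1) \<alpha>]
    by (simp only: bar_boundary_chains_1 cong: conj_cong ball_cong bex_cong) simp
  have 2: "homology_map 2 G R \<alpha> \<in> epi (group_homology 2 P R) (group_homology 2 G R) \<longleftrightarrow> H2_surj P G \<alpha>"
    unfolding epi_def mem_Collect_eq homology_map_surj_iff[OF P G n(2) \<alpha>] H2_surj_def
    using homology_map_hom[OF P G n(2) \<alpha>] by simp
  show ?thesis
    unfolding in_Omega_def 1 2 by (rule iffI) (elim conjE, intro conjI, assumption+)+
next
  case False
  then show ?thesis unfolding in_Omega_def by argo
qed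

lemma basis_mult_boundary:
  assumes "x \<in> carrier G" "y \<in> carrier G"
  shows "basis [x] + basis [y] - basis [x \<otimes>\<^bsub>G\<^esub> y] \<in> bar_boundaries R G 1"
proof -
  have "bar_boundary G (basis [x, y]) \<in> bar_boundaries R G 1"
    using assms by (intro bar_boundariesI basis_bar_chains) auto
  then show ?thesis
    by (simp add: bar_boundary_single bar_boundary_basis_simps algebra_simps)
qed

lemma additive_quotient_chains: "monoid G \<Longrightarrow> additive_quotient (bar_chains R G n) (bar_boundaries R G n)"
  by (intro additive_quotient.intro additive_bar_chains additive_bar_boundaries bar_boundaries_subset)

text \<open>The boundary of [x|y] is [y] - [xy] + [x], so [xy] = [x] + [y] modulo boundaries. As all
  1-chains are cycles, the target is H_1(G; R) and this is the canonical map to it.\<close>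

lemma abelianization_hom:
  assumes "monoid G"
  shows "(\<lambda>x. bar_boundaries R G 1 #>\<^bsub>additive_group (bar_chains R G 1)\<^esub> basis [x])
    \<in> hom G (additive_group (bar_chains R G 1) Mod bar_boundaries R G 1)"
proof -
  interpret monoid G by fact
  interpret C: additive_quotient "bar_chains R G 1" "bar_boundaries R G 1"
    by (rule additive_quotient_chains[OF assms])
  have b: "basis [x] \<in> bar_chains R G 1" if "x \<in> carrier G" for x
    using that by (intro basis_bar_chains) auto
  show ?thesis
  proof (rule homI)
    fix x y assume xy: "x \<in> carrier G" "y \<in> carrier G"
    have "C.coset (basis [x \<otimes>\<^bsub>G\<^esub> y]) = C.coset (basis [x] + basis [y])"
      using uminus_bar_boundaries[OF basis_mult_boundary[OF xy]] unfolding C.coset_eq_iff by (simp only: minus_diff_eq)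
    then show "C.coset (basis [x \<otimes>\<^bsub>G\<^esub> y]) =
        C.coset (basis [x]) \<otimes>\<^bsub>additive_group (bar_chains R G 1) Mod bar_boundaries R G 1\<^esub> C.coset (basis [y])"
      using b xy by (simp only: C.coset_mult)
  qed (rule C.coset_closed[OF b])
qed

end

section \<open>Derived subgroups under homomorphisms\<close>

lemma hom_derived:
  assumes "group G" "group H" "f \<in> hom G H" "x \<in> derived G (carrier G)"
  shows "f x \<in> derived H (carrier H)"
proof -
  interpret G: group G by fact
  interpret H: group H by fact
  interpret f: group_hom G H f using assms by (simp add: group_hom_def group_hom_axioms_def)
  have sub: "derived_set G (carrier G) \<subseteq> carrier G" by (rule G.derived_set_in_carrier) simp
  show ?thesis
    using assms(4) unfolding derived_def
  proof (induction rule: generate.induct)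
    case one
    then show ?case using generate.one by simp
  next
    case (incl h)
    then show ?case by (auto intro!: generate.incl) (metis f.hom_closed f.hom_inv f.hom_mult G.inv_closed G.m_closed)
  next
    case (inv h)
    then have "h \<in> carrier G" using sub by blast
    moreover have "f h \<in> derived_set H (carrier H)"
      using inv by auto (metis f.hom_closed f.hom_inv f.hom_mult G.inv_closed G.m_closed)
    ultimately show ?case using generate.inv[of "f h" "derived_set H (carrier H)" H] by (simp only: f.hom_inv)
  next
    case (eng a b)
    then show ?case using generate.eng G.generate_in_carrier[OF sub] by simp
  qed
qed

lemma hom_comm_derived:
  assumes "group G" "comm_group M" "f \<in> hom G M" "x \<in> derived G (carrier G)"
  shows "f x = \<one>\<^bsub>M\<^esub>"
  using hom_derived[OF assms(1) comm_group.axioms(2)[OF assms(2)] assms(3,4)]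
    comm_group.derived_eq_singleton[OF assms(2) subset_refl] by simp

text \<open>Commutators are lifted entry by entry. Later this turns an element of [G, G] into a word
  in [F, F], which is what a nullhomologous right-hand side requires.\<close>

lemma surj_hom_derived:
  assumes "group G" "group H" "f \<in> hom G H" "f ` carrier G = carrier H" "y \<in> derived H (carrier H)"
  obtains x where "x \<in> derived G (carrier G)" "f x = y"
proof -
  interpret G: group G by fact
  interpret H: group H by fact
  interpret f: group_hom G H f using assms by (simp add: group_hom_def group_hom_axioms_def)
  have sub: "derived_set G (carrier G) \<subseteq> carrier G" by (rule G.derived_set_in_carrier) simp
  have *: "\<exists>x \<in> derived_set G (carrier G). f x = h" if "h \<in> derived_set H (carrier H)" for h
  proof -
    from that obtain a b where ab: "a \<in> carrier H" "b \<in> carrier H"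
      "h = a \<otimes>\<^bsub>H\<^esub> b \<otimes>\<^bsub>H\<^esub> inv\<^bsub>H\<^esub> a \<otimes>\<^bsub>H\<^esub> inv\<^bsub>H\<^esub> b"
      unfolding UN_iff singleton_iff by blast
    have "a \<in> f ` carrier G" "b \<in> f ` carrier G" using ab assms(4) by simp_all
    then obtain c d where cd: "c \<in> carrier G" "d \<in> carrier G" "a = f c" "b = f d"
      by (elim imageE)
    then show ?thesis
      using ab by (intro bexI[of _ "c \<otimes>\<^bsub>G\<^esub> d \<otimes>\<^bsub>G\<^esub> inv\<^bsub>G\<^esub> c \<otimes>\<^bsub>G\<^esub> inv\<^bsub>G\<^esub> d"]) auto
  qed
  have "\<exists>x \<in> derived G (carrier G). f x = y"
    using assms(5) unfolding derived_def
  proof (induction rule: generate.induct)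
    case one
    show ?case by (intro bexI[of _ "\<one>\<^bsub>G\<^esub>"] f.hom_one generate.one)
  next
    case (incl h)
    from *[OF this] obtain x where "x \<in> derived_set G (carrier G)" "f x = h" ..
    then show ?case using generate.incl by (intro bexI[of _ x])
  next
    case (inv h)
    from *[OF this] obtain x where x: "x \<in> derived_set G (carrier G)" "f x = h" ..
    then show ?case
      using f.hom_inv[OF subsetD[OF sub x(1)]] generate.inv[OF x(1)] by (intro bexI[of _ "inv\<^bsub>G\<^esub> x"]) simp_all
  next
    case (eng a b)
    obtain c d where c: "c \<in> generate G (derived_set G (carrier G))" "f c = a"
      and d: "d \<in> generate G (derived_set G (carrier G))" "f d = b"
      using eng.IH by (elim bexE)
    then show ?case
      using f.hom_mult[OF G.generate_in_carrier[OF sub c(1)] G.generate_in_carrier[OF sub d(1)]] generate.eng[OF c(1) d(1)]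
      by (intro bexI[of _ "c \<otimes>\<^bsub>G\<^esub> d"]) simp_all
  qed
  then show ?thesis by (elim bexE) (rule that)
qed

section \<open>Evaluation of integral chains in abelian groups\<close>

text \<open>
  The floor only serves to turn coefficients into integer exponents: the value is meaningful for
  integral chains only.
\<close>

definition chain_eval :: "('b, 'm) monoid_scheme \<Rightarrow> ('s \<Rightarrow> 'b) \<Rightarrow> ('s \<Rightarrow>\<^sub>0 rat) \<Rightarrow> 'b" where
  "chain_eval M f c = finprod M (\<lambda>s. f s [^]\<^bsub>M\<^esub> \<lfloor>Poly_Mapping.lookup c s\<rfloor>) (Poly_Mapping.keys c)"

abbreviation simplices :: "('a, 'm) monoid_scheme \<Rightarrow> nat \<Rightarrow> 'a list set" where
  "simplices G n \<equiv> {s \<in> lists (carrier G). length s = n}"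

context comm_group
begin

lemma chain_eval_superset:
  assumes "finite T" "Poly_Mapping.keys c \<subseteq> T" "f \<in> T \<rightarrow> carrier G"
  shows "chain_eval G f c = finprod G (\<lambda>s. f s [^] \<lfloor>Poly_Mapping.lookup c s\<rfloor>) T"
  unfolding chain_eval_def
proof (rule finprod_mono_neutral_cong_left[OF assms(1,2)])
  show "f i [^] \<lfloor>Poly_Mapping.lookup c i\<rfloor> = \<one>" if "i \<in> T - Poly_Mapping.keys c" for i
    using that assms(3) by (simp add: in_keys_iff)
  show "(\<lambda>s. f s [^] \<lfloor>Poly_Mapping.lookup c s\<rfloor>) \<in> T \<rightarrow> carrier G"
    using funcset_mem[OF assms(3)] by (intro funcsetI int_pow_closed)
qed simp

lemma chain_eval_closed:
  assumes "f \<in> simplices H n \<rightarrow> carrier G" "c \<in> bar_chains R H n"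
  shows "chain_eval G f c \<in> carrier G"
  unfolding chain_eval_def
proof (intro finprod_closed funcsetI int_pow_closed)
  show "f s \<in> carrier G" if "s \<in> Poly_Mapping.keys c" for s
    using assms that unfolding bar_chains_def by blast
qed

lemma chain_eval_zero: "chain_eval G f 0 = \<one>"
  by (simp add: chain_eval_def)

lemma chain_eval_cong:
  assumes "f \<in> simplices H n \<rightarrow> carrier G" "c \<in> bar_chains R H n"
    and "\<And>s. s \<in> simplices H n \<Longrightarrow> f s = h s"
  shows "chain_eval G f c = chain_eval G h c"
proof -
  have "Poly_Mapping.keys c \<subseteq> simplices H n"
    using assms(2) unfolding bar_chains_def by blast
  then have "f s \<in> carrier G \<and> f s = h s" if "s \<in> Poly_Mapping.keys c" for s
    using that assms(1,3) by blast
  then show ?thesis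
    unfolding chain_eval_def by (intro finprod_cong' refl funcsetI) (metis int_pow_closed)+
qed

lemma chain_eval_add:
  assumes f: "f \<in> simplices H n \<rightarrow> carrier G" and c: "c \<in> bar_chains \<int> H n" and d: "d \<in> bar_chains \<int> H n"
  shows "chain_eval G f (c + d) = chain_eval G f c \<otimes> chain_eval G f d"
proof -
  let ?T = "Poly_Mapping.keys c \<union> Poly_Mapping.keys d"
  have T: "?T \<subseteq> simplices H n"
    using c d unfolding bar_chains_def by blast
  then have fT: "f \<in> ?T \<rightarrow> carrier G" using f by blast
  have floor: "\<lfloor>Poly_Mapping.lookup (c + d) s\<rfloor> = \<lfloor>Poly_Mapping.lookup c s\<rfloor> + \<lfloor>Poly_Mapping.lookup d s\<rfloor>" for s
    using rat_subring.bar_chainsD(3)[OF rat_subring_Ints c, of s]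
      rat_subring.bar_chainsD(3)[OF rat_subring_Ints d, of s]
    by (auto simp: lookup_add elim!: Ints_cases simp flip: of_int_add)
  have "chain_eval G f (c + d) = finprod G (\<lambda>s. f s [^] \<lfloor>Poly_Mapping.lookup (c + d) s\<rfloor>) ?T"
    using keys_add[of c d] fT by (intro chain_eval_superset) auto
  also have "\<dots> = finprod G (\<lambda>s. f s [^] \<lfloor>Poly_Mapping.lookup c s\<rfloor> \<otimes> f s [^] \<lfloor>Poly_Mapping.lookup d s\<rfloor>) ?T"
    using funcset_mem[OF fT] unfolding floor by (intro finprod_cong') (auto simp: int_pow_mult)
  also have "\<dots> = finprod G (\<lambda>s. f s [^] \<lfloor>Poly_Mapping.lookup c s\<rfloor>) ?T \<otimes>
      finprod G (\<lambda>s. f s [^] \<lfloor>Poly_Mapping.lookup d s\<rfloor>) ?T"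
    using funcset_mem[OF fT] by (intro finprod_multf funcsetI int_pow_closed)
  also have "\<dots> = chain_eval G f c \<otimes> chain_eval G f d"
    using fT by (subst (1 2) chain_eval_superset[where T = ?T]) auto
  finally show ?thesis .
qed

lemma chain_eval_single: "f s \<in> carrier G \<Longrightarrow> chain_eval G f (Poly_Mapping.single s (of_int k)) = f s [^] k"
  by (subst chain_eval_superset[where T = "{s}"]) auto

lemma finprod_int_pow:
  fixes k :: int
  assumes "finite T" "f \<in> T \<rightarrow> carrier G"
  shows "finprod G (\<lambda>s. f s [^] k) T = finprod G f T [^] k"
  using assms
  by (induction T rule: finite_induct) (auto simp: int_pow_distrib Pi_iff)

lemma chain_eval_scale:
  assumes f: "f \<in> simplices H n \<rightarrow> carrier G" and c: "c \<in> bar_chains \<int> H n"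
  shows "chain_eval G f (scale (of_int k) c) = chain_eval G f c [^] k"
proof -
  have fT: "f s \<in> carrier G" if "s \<in> Poly_Mapping.keys c" for s
    using f c that unfolding bar_chains_def by blast
  have floor: "\<lfloor>Poly_Mapping.lookup (scale (of_int k) c) s\<rfloor> = \<lfloor>Poly_Mapping.lookup c s\<rfloor> * k" for s
    using rat_subring.bar_chainsD(3)[OF rat_subring_Ints c, of s]
    by (auto simp: mult.commute elim!: Ints_cases simp flip: of_int_mult)
  have "chain_eval G f (scale (of_int k) c) =
      finprod G (\<lambda>s. f s [^] \<lfloor>Poly_Mapping.lookup (scale (of_int k) c) s\<rfloor>) (Poly_Mapping.keys c)"
    using keys_scale[of "of_int k" c] fT by (intro chain_eval_superset) auto
  also have "\<dots> = finprod G (\<lambda>s. (f s [^] \<lfloor>Poly_Mapping.lookup c s\<rfloor>) [^] k) (Poly_Mapping.keys c)"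
    unfolding floor using fT by (intro finprod_cong') (auto simp: int_pow_pow)
  also have "\<dots> = chain_eval G f c [^] k"
    unfolding chain_eval_def using fT by (intro finprod_int_pow) auto
  finally show ?thesis .
qed

lemma chain_eval_diff:
  assumes f: "f \<in> simplices H n \<rightarrow> carrier G" and c: "c \<in> bar_chains \<int> H n" and d: "d \<in> bar_chains \<int> H n"
  shows "chain_eval G f (c - d) = chain_eval G f c \<otimes> inv chain_eval G f d"
proof -
  interpret Z: rat_subring \<int> by (rule rat_subring_Ints)
  have "chain_eval G f (c - d) = chain_eval G f (c + scale (of_int (- 1)) d)"
    by (simp add: scale_uminus_one)
  also have "\<dots> = chain_eval G f c \<otimes> chain_eval G f (scale (of_int (- 1)) d)"
    by (intro chain_eval_add[OF f c] Z.scale_bar_chains d) simp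
  finally show ?thesis
    unfolding chain_eval_scale[OF f d] using chain_eval_closed[OF f d] by (simp add: int_pow_neg)
qed

lemma chain_eval_basis:
  "f \<in> simplices H n \<rightarrow> carrier G \<Longrightarrow> s \<in> simplices H n \<Longrightarrow> chain_eval G f (basis s) = f s"
  using chain_eval_single[of f s 1] by (simp add: Pi_iff)

text \<open>With \<open>g\<close> the boundary of simplices, this reduces the triviality of an
  evaluation on boundaries to an identity on single simplices.\<close>

lemma chain_eval_linear_extend:
  assumes f: "f \<in> simplices H m \<rightarrow> carrier G" and c: "c \<in> bar_chains \<int> K n"
    and g: "\<And>s. s \<in> simplices K n \<Longrightarrow> g s \<in> bar_chains \<int> H m"
  shows "chain_eval G f (linear_extend g c) = chain_eval G (\<lambda>s. chain_eval G f (g s)) c"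
proof -
  interpret Z: rat_subring \<int> by (rule rat_subring_Ints)
  have gk: "g s \<in> bar_chains \<int> H m" if "s \<in> Poly_Mapping.keys c" for s
    using g c that unfolding bar_chains_def by blast
  have sc: "scale (Poly_Mapping.lookup c s) (g s) \<in> bar_chains \<int> H m" if "s \<in> Poly_Mapping.keys c" for s
    by (rule Z.scale_bar_chains[OF Z.bar_chainsD(3)[OF c] gk[OF that]])
  have "chain_eval G f (\<Sum>s\<in>I. scale (Poly_Mapping.lookup c s) (g s)) =
      finprod G (\<lambda>s. chain_eval G f (scale (Poly_Mapping.lookup c s) (g s))) I"
    if "finite I" "I \<subseteq> Poly_Mapping.keys c" for I
    using that
  proof (induction I rule: finite_induct)
    case empty
    then show ?case by (simp add: chain_eval_zero)
  next
    case (insert s I)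
    have "(\<Sum>s\<in>I. scale (Poly_Mapping.lookup c s) (g s)) \<in> bar_chains \<int> H m"
      using insert.prems by (intro Z.sum_bar_chains sc) auto
    moreover have "(\<lambda>s. chain_eval G f (scale (Poly_Mapping.lookup c s) (g s))) \<in> insert s I \<rightarrow> carrier G"
      using insert.prems by (intro funcsetI chain_eval_closed[OF f sc]) auto
    ultimately show ?case
      using insert sc[of s] by (simp add: chain_eval_add[OF f])
  qed
  then have "chain_eval G f (linear_extend g c) =
      finprod G (\<lambda>s. chain_eval G f (scale (Poly_Mapping.lookup c s) (g s))) (Poly_Mapping.keys c)"
    by (simp add: linear_extend_def)
  also have "\<dots> = chain_eval G (\<lambda>s. chain_eval G f (g s)) c"
    unfolding chain_eval_def[of G "\<lambda>s. chain_eval G f (g s)"]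
  proof (rule finprod_cong')
    show "chain_eval G f (scale (Poly_Mapping.lookup c s) (g s)) =
        chain_eval G f (g s) [^] \<lfloor>Poly_Mapping.lookup c s\<rfloor>" if "s \<in> Poly_Mapping.keys c" for s
    proof -
      have "Poly_Mapping.lookup c s = of_int \<lfloor>Poly_Mapping.lookup c s\<rfloor>"
        using Z.bar_chainsD(3)[OF c, of s] by (auto elim!: Ints_cases)
      then show ?thesis using chain_eval_scale[OF f gk[OF that]] by metis
    qed
    show "(\<lambda>s. chain_eval G f (g s) [^] \<lfloor>Poly_Mapping.lookup c s\<rfloor>) \<in> Poly_Mapping.keys c \<rightarrow> carrier G"
      by (intro funcsetI int_pow_closed chain_eval_closed[OF f gk])
  qed simp
  finally show ?thesis .
qed

lemma chain_eval_push:
  assumes "f \<in> simplices H n \<rightarrow> carrier G" "c \<in> bar_chains \<int> K n"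
    and h: "\<And>x. x \<in> carrier K \<Longrightarrow> h x \<in> carrier H"
  shows "chain_eval G f (push h c) = chain_eval G (\<lambda>s. f (map h s)) c"
proof -
  interpret Z: rat_subring \<int> by (rule rat_subring_Ints)
  have m: "map h s \<in> simplices H n" if "s \<in> simplices K n" for s
    using that h by (auto simp: in_lists_conv_set)
  have e: "chain_eval G f (basis (map h s)) = f (map h s)" if "s \<in> simplices K n" for s
    using chain_eval_single[of f "map h s" 1] funcset_mem[OF assms(1) m[OF that]] by simp
  have "chain_eval G f (push h c) = chain_eval G (\<lambda>s. chain_eval G f (basis (map h s))) c"
    using m by (intro chain_eval_linear_extend[OF assms(1,2)] Z.basis_bar_chains) auto
  also have "\<dots> = chain_eval G (\<lambda>s. f (map h s)) c"
    using m e funcset_mem[OF assms(1)] by (intro chain_eval_cong[OF _ assms(2)] funcsetI) auto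
  finally show ?thesis .
qed

lemma chain_eval_one: "chain_eval G (\<lambda>_. \<one>) c = \<one>"
  by (simp add: chain_eval_def)

end

text \<open>A chain has finitely many nonzero coefficients, hence a common denominator. The multiple
  can be evaluated in an abelian group, where only integers act.\<close>

lemma (in rat_subring) clear_denominators:
  assumes "c \<in> bar_chains R G n"
  obtains e where "e \<in> denominators R" "scale (of_int e) c \<in> bar_chains \<int> G n"
proof -
  obtain e where e: "e \<in> denominators R" "\<And>s. s \<in> Poly_Mapping.keys c \<Longrightarrow> of_int e * Poly_Mapping.lookup c s \<in> \<int>"
  proof (rule common_denominator[of "Poly_Mapping.keys c" "\<lambda>e s. of_int e * Poly_Mapping.lookup c s \<in> \<int>"])
    show "\<exists>e\<in>denominators R. of_int e * Poly_Mapping.lookup c s \<in> \<int>" for s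
      using denominator_of_mem[OF bar_chainsD(3)[OF assms]] by blast
    show "of_int (e * d) * Poly_Mapping.lookup c s \<in> \<int>" if "of_int e * Poly_Mapping.lookup c s \<in> \<int>" for d e s
      using Ints_mult[OF Ints_of_int[of d] that] by (simp add: ac_simps)
  qed auto
  have "of_int e * Poly_Mapping.lookup c s \<in> \<int>" for s
    using e(2)[of s] by (cases "s \<in> Poly_Mapping.keys c") (auto simp: in_keys_iff)
  then have "scale (of_int e) c \<in> bar_chains \<int> G n"
    using keys_scale[of "of_int e" c]
    by (intro rat_subring.bar_chainsI[OF rat_subring_Ints]) (auto dest: bar_chainsD(1,2)[OF assms])
  with e(1) show ?thesis by (rule that)
qed

section \<open>Central extensions\<close>

context rat_subring
begin

text \<open>
  The surjectivity on \<open>H\<^sub>1\<close> and the injectivity of \<open>H\<^sub>1(P) \<rightarrow> H\<^sub>1(G)\<close> make \<open>[k]\<close> the boundary of a chain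
  \<open>c\<close>, and then \<open>\<beta>\<^sub>* c - [1|1]\<close> is a cycle of \<open>G\<close>, hence homologous to the image of a cycle of
  \<open>P\<close>. Evaluate a common multiple of this relation with the factor set \<open>f\<close> of a section \<open>s\<close> of \<open>\<beta>\<close>.
  On chains that come from \<open>Q\<close> the factor set is the coboundary of \<open>t x = x (s (\<beta> x))\<^sup>-\<^sup>1\<close>, so cycles
  from \<open>P\<close> evaluate to \<open>1\<close> and the multiple of \<open>c\<close> evaluates to a power of \<open>k\<close>.
\<close>

lemma central_kernel_torsion:
  fixes P :: "('p, 'm) monoid_scheme" and G :: "('g, 'n) monoid_scheme" and Q :: "('q, 'l) monoid_scheme"
  assumes "group P" "group G" "group Q"
    and i: "i \<in> hom P Q" and \<beta>: "\<beta> \<in> hom Q G" and surj: "\<beta> ` carrier Q = carrier G"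
    and central: "\<And>k x. k \<in> carrier Q \<Longrightarrow> \<beta> k = \<one>\<^bsub>G\<^esub> \<Longrightarrow> x \<in> carrier Q \<Longrightarrow> k \<otimes>\<^bsub>Q\<^esub> x = x \<otimes>\<^bsub>Q\<^esub> k"
    and H: "H1_surj P Q i" "H1_inj P G (\<beta> \<circ> i)" "H2_surj P G (\<beta> \<circ> i)"
    and k: "k \<in> carrier Q" "\<beta> k = \<one>\<^bsub>G\<^esub>"
  shows "\<exists>e \<in> denominators R. k [^]\<^bsub>Q\<^esub> e = \<one>\<^bsub>Q\<^esub>"
proof -
  interpret P: group P by fact
  interpret G: group G by fact
  interpret Q: group Q by fact
  interpret \<beta>: group_hom Q G \<beta> using \<beta> by unfold_locales
  interpret Z: rat_subring \<int> by (rule rat_subring_Ints)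
  have \<alpha>: "\<beta> \<circ> i \<in> hom P G" using hom_compose[OF i \<beta>] .

  have bk: "basis [k] \<in> bar_chains R Q 1" using k(1) by (intro basis_bar_chains) auto
  obtain y where y: "y \<in> bar_chains R P 1" "basis [k] - push i y \<in> bar_boundaries R Q 1"
    using H(1) bk unfolding H1_surj_def by blast
  \<comment> \<open>The boundary of [1|1] is [1].\<close>
  have one: "basis [\<one>\<^bsub>G\<^esub>] \<in> bar_boundaries R G 1"
    using basis_mult_boundary[of "\<one>\<^bsub>G\<^esub>" G "\<one>\<^bsub>G\<^esub>"] by simp
  have "push \<beta> (basis [k] - push i y) \<in> bar_boundaries R G 1"
    by (rule push_bar_boundaries[OF y(2) \<beta>])
  then have "basis [\<one>\<^bsub>G\<^esub>] - push (\<beta> \<circ> i) y \<in> bar_boundaries R G 1"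
    using k(2) by (simp only: linear_extend_diff push_push linear_extend_single scale_simps list.map)
  from diff_bar_boundaries[OF one this] have "push (\<beta> \<circ> i) y \<in> bar_boundaries R G 1" by simp
  then have "y \<in> bar_boundaries R P 1"
    using H(2) y(1) unfolding H1_inj_def by blast
  from add_bar_boundaries[OF y(2) push_bar_boundaries[OF this i]]
  have "basis [k] \<in> bar_boundaries R Q 1" by simp
  then obtain c where c: "c \<in> bar_chains R Q (Suc 1)" "basis [k] = bar_boundary Q c"
    by (elim bar_boundariesE)
  then have c2: "c \<in> bar_chains R Q 2" by (simp add: numeral_2_eq_2)

  \<comment> \<open>Since \<open>\<beta>\<close> maps \<open>k\<close> to 1, the boundary of
    \<open>push \<beta> c\<close> is [1]; subtracting [1|1] makes it a cycle.\<close>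
  define z where "z = push \<beta> c - basis [\<one>\<^bsub>G\<^esub>, \<one>\<^bsub>G\<^esub>]"
  have z: "z \<in> bar_chains R G 2"
    unfolding z_def using c2 by (intro diff_bar_chains push_bar_chains basis_bar_chains) auto
  have "bar_boundary G z = push \<beta> (basis [k]) - basis [\<one>\<^bsub>G\<^esub>]"
    unfolding z_def using push_bar_boundary[OF c2 \<beta>] c(2)
    by (simp add: bar_boundary_linear bar_boundary_single bar_boundary_basis_simps)
  then have "bar_boundary G z = 0" using k(2) by simp
  with H(3) z obtain y2 where y2: "y2 \<in> bar_chains R P 2" "bar_boundary P y2 = 0"
    "z - push (\<beta> \<circ> i) y2 \<in> bar_boundaries R G 2"
    unfolding H2_surj_def by blast
  then obtain d where d: "d \<in> bar_chains R G (Suc 2)" "z - push (\<beta> \<circ> i) y2 = bar_boundary G d"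
    by (elim bar_boundariesE)
  then have d3: "d \<in> bar_chains R G 3" by (simp add: eval_nat_numeral)

  \<comment> \<open>One exponent must clear the denominators of \<open>c\<close>, \<open>y2\<close>
    and \<open>d\<close> at once, since the relation between them is evaluated as a whole.\<close>
  obtain e1 where e1: "e1 \<in> denominators R" "scale (of_int e1) c \<in> bar_chains \<int> Q 2"
    by (rule clear_denominators[OF c2])
  obtain e2 where e2: "e2 \<in> denominators R" "scale (of_int e2) y2 \<in> bar_chains \<int> P 2"
    by (rule clear_denominators[OF y2(1)])
  obtain e3 where e3: "e3 \<in> denominators R" "scale (of_int e3) d \<in> bar_chains \<int> G 3"
    by (rule clear_denominators[OF d3])
  define e where "e = e1 * e2 * e3"
  have e: "e \<in> denominators R"
    unfolding e_def by (intro mult_denominators e1 e2 e3)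
  have c': "scale (of_int e) c \<in> bar_chains \<int> Q 2"
    using Z.scale_bar_chains[OF Ints_of_int e1(2), of "e2 * e3"] by (simp add: e_def ac_simps)
  have y': "scale (of_int e) y2 \<in> bar_chains \<int> P 2"
    using Z.scale_bar_chains[OF Ints_of_int e2(2), of "e1 * e3"] by (simp add: e_def ac_simps)
  have d': "scale (of_int e) d \<in> bar_chains \<int> G 3"
    using Z.scale_bar_chains[OF Ints_of_int e3(2), of "e1 * e2"] by (simp add: e_def ac_simps)
  have "scale (of_int e) (push \<beta> c - basis [\<one>\<^bsub>G\<^esub>, \<one>\<^bsub>G\<^esub>] - push (\<beta> \<circ> i) y2) = scale (of_int e) (bar_boundary G d)"
    using d(2) by (simp add: z_def)
  then have eq: "push \<beta> (scale (of_int e) c) =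
      bar_boundary G (scale (of_int e) d) + Poly_Mapping.single [\<one>\<^bsub>G\<^esub>, \<one>\<^bsub>G\<^esub>] (of_int e) +
      push \<beta> (push i (scale (of_int e) y2))"
    by (simp add: push_push scale_distrib bar_boundary_linear linear_extend_scale algebra_simps)

  \<comment> \<open>The evaluation of chains takes place in an abelian group, for which the central
    kernel serves.\<close>
  define K where "K = {x \<in> carrier Q. \<beta> x = \<one>\<^bsub>G\<^esub>}"
  define M where "M = Q\<lparr>carrier := K\<rparr>"
  have K: "subgroup K Q"
    unfolding K_def by (intro Q.subgroupI) auto
  have M_simps [simp]: "carrier M = K" "x \<otimes>\<^bsub>M\<^esub> y = x \<otimes>\<^bsub>Q\<^esub> y" "\<one>\<^bsub>M\<^esub> = \<one>\<^bsub>Q\<^esub>" for x y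
    by (simp_all add: M_def)
  have "group M" unfolding M_def by (rule Q.subgroup_imp_group[OF K])
  then interpret M: comm_group M
    by (rule group.group_comm_groupI) (auto simp: K_def central)
  have inv_M: "inv\<^bsub>M\<^esub> x = inv\<^bsub>Q\<^esub> x" if "x \<in> K" for x
    unfolding M_def using Q.m_inv_consistent[OF K that] .
  have pow_M: "x [^]\<^bsub>M\<^esub> n = x [^]\<^bsub>Q\<^esub> n" if "x \<in> K" for x and n :: int
    unfolding M_def using Q.int_pow_consistent[OF K that] by simp

  \<comment> \<open>The section is normalised at 1. This gives \<open>t k = k\<close>, and it makes
    the factor set 1 at (1, 1), so that the correction by [1|1] contributes nothing.\<close>
  define s where "s = (\<lambda>g. if g = \<one>\<^bsub>G\<^esub> then \<one>\<^bsub>Q\<^esub> else inv_into (carrier Q) \<beta> g)"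
  have s: "s g \<in> carrier Q" "\<beta> (s g) = g" if "g \<in> carrier G" for g
    using that surj inv_into_into[of g \<beta> "carrier Q"] f_inv_into_f[of g \<beta> "carrier Q"] by (auto simp: s_def)
  define f where "f = (\<lambda>g h. s g \<otimes>\<^bsub>Q\<^esub> s h \<otimes>\<^bsub>Q\<^esub> inv\<^bsub>Q\<^esub> s (g \<otimes>\<^bsub>G\<^esub> h))"
  define t where "t = (\<lambda>x. x \<otimes>\<^bsub>Q\<^esub> inv\<^bsub>Q\<^esub> s (\<beta> x))"
  have f_eq: "f g h = s g \<otimes>\<^bsub>Q\<^esub> s h \<otimes>\<^bsub>Q\<^esub> inv\<^bsub>Q\<^esub> s (g \<otimes>\<^bsub>G\<^esub> h)" for g h
    by (simp add: f_def)
  have t_eq: "t x = x \<otimes>\<^bsub>Q\<^esub> inv\<^bsub>Q\<^esub> s (\<beta> x)" for x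
    by (simp add: t_def)
  have fK: "f g h \<in> K" if "g \<in> carrier G" "h \<in> carrier G" for g h
    using that s by (simp add: f_def K_def)
  have tK: "t x \<in> K" if "x \<in> carrier Q" for x
    using that s by (simp add: t_def K_def)
  have fM: "f g h \<in> carrier M" if "g \<in> carrier G" "h \<in> carrier G" for g h
    using fK that by simp
  have tM: "t x \<in> carrier M" if "x \<in> carrier Q" for x
    using tK that by simp
  have KQ: "x \<in> carrier Q" "\<And>y. y \<in> carrier Q \<Longrightarrow> x \<otimes>\<^bsub>Q\<^esub> y = y \<otimes>\<^bsub>Q\<^esub> x" if "x \<in> K" for x
    using that central by (auto simp: K_def)
  \<comment> \<open>Both sides equal s(g) s(h) s(l) s(g h l)^-1, once the central element
    \<open>f h l\<close> has been moved past \<open>s g\<close>.\<close>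
  have cocycle: "f h l \<otimes>\<^bsub>Q\<^esub> f g (h \<otimes>\<^bsub>G\<^esub> l) = f g h \<otimes>\<^bsub>Q\<^esub> f (g \<otimes>\<^bsub>G\<^esub> h) l"
    if g: "g \<in> carrier G" "h \<in> carrier G" "l \<in> carrier G" for g h l
  proof -
    have "f h l \<otimes>\<^bsub>Q\<^esub> f g (h \<otimes>\<^bsub>G\<^esub> l) =
        (f h l \<otimes>\<^bsub>Q\<^esub> s g) \<otimes>\<^bsub>Q\<^esub> (s (h \<otimes>\<^bsub>G\<^esub> l) \<otimes>\<^bsub>Q\<^esub> inv\<^bsub>Q\<^esub> s (g \<otimes>\<^bsub>G\<^esub> (h \<otimes>\<^bsub>G\<^esub> l)))"
      unfolding f_eq[of g "h \<otimes>\<^bsub>G\<^esub> l"] using KQ(1)[OF fK[OF g(2,3)]] s g by (simp add: Q.m_assoc)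
    also have "f h l \<otimes>\<^bsub>Q\<^esub> s g = s g \<otimes>\<^bsub>Q\<^esub> f h l"
      by (rule KQ(2)[OF fK[OF g(2,3)] s(1)[OF g(1)]])
    also have "s g \<otimes>\<^bsub>Q\<^esub> f h l \<otimes>\<^bsub>Q\<^esub> (s (h \<otimes>\<^bsub>G\<^esub> l) \<otimes>\<^bsub>Q\<^esub> inv\<^bsub>Q\<^esub> s (g \<otimes>\<^bsub>G\<^esub> (h \<otimes>\<^bsub>G\<^esub> l))) =
        s g \<otimes>\<^bsub>Q\<^esub> s h \<otimes>\<^bsub>Q\<^esub> s l \<otimes>\<^bsub>Q\<^esub> inv\<^bsub>Q\<^esub> s (g \<otimes>\<^bsub>G\<^esub> (h \<otimes>\<^bsub>G\<^esub> l))"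
      using s g by (simp add: f_eq Q.m_assoc Q.inv_solve_left' flip: Q.m_assoc[of "inv\<^bsub>Q\<^esub> s (h \<otimes>\<^bsub>G\<^esub> l)"])
    also have "\<dots> = f g h \<otimes>\<^bsub>Q\<^esub> f (g \<otimes>\<^bsub>G\<^esub> h) l"
      using s g by (simp add: f_eq Q.m_assoc G.m_assoc flip: Q.m_assoc[of "inv\<^bsub>Q\<^esub> s (g \<otimes>\<^bsub>G\<^esub> h)"])
    finally show ?thesis .
  qed
  \<comment> \<open>Write x = t(x) s(\<beta> x), and likewise y. As \<open>t y\<close> is central,
    the two values of the section become adjacent and produce the factor set.\<close>
  have t_mult: "t (x \<otimes>\<^bsub>Q\<^esub> y) = t x \<otimes>\<^bsub>Q\<^esub> t y \<otimes>\<^bsub>Q\<^esub> f (\<beta> x) (\<beta> y)" if x: "x \<in> carrier Q" "y \<in> carrier Q" for x y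
  proof -
    have c: "s (\<beta> x) \<in> carrier Q" "s (\<beta> y) \<in> carrier Q" "t x \<in> carrier Q" "t y \<in> carrier Q"
      "s (\<beta> x \<otimes>\<^bsub>G\<^esub> \<beta> y) \<in> carrier Q"
      using x s KQ(1)[OF tK] by auto
    have "x = t x \<otimes>\<^bsub>Q\<^esub> s (\<beta> x)" "y = t y \<otimes>\<^bsub>Q\<^esub> s (\<beta> y)"
      using x c by (simp_all add: t_eq Q.m_assoc)
    then have "x \<otimes>\<^bsub>Q\<^esub> y = t x \<otimes>\<^bsub>Q\<^esub> s (\<beta> x) \<otimes>\<^bsub>Q\<^esub> (t y \<otimes>\<^bsub>Q\<^esub> s (\<beta> y))"
      by metis
    also have "\<dots> = t x \<otimes>\<^bsub>Q\<^esub> (s (\<beta> x) \<otimes>\<^bsub>Q\<^esub> t y) \<otimes>\<^bsub>Q\<^esub> s (\<beta> y)"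
      using c by (simp add: Q.m_assoc)
    also have "s (\<beta> x) \<otimes>\<^bsub>Q\<^esub> t y = t y \<otimes>\<^bsub>Q\<^esub> s (\<beta> x)"
      using KQ(2)[OF tK[OF x(2)] c(1)] by simp
    finally have xy: "x \<otimes>\<^bsub>Q\<^esub> y = t x \<otimes>\<^bsub>Q\<^esub> t y \<otimes>\<^bsub>Q\<^esub> (s (\<beta> x) \<otimes>\<^bsub>Q\<^esub> s (\<beta> y))"
      using c by (simp add: Q.m_assoc)
    have "t (x \<otimes>\<^bsub>Q\<^esub> y) = x \<otimes>\<^bsub>Q\<^esub> y \<otimes>\<^bsub>Q\<^esub> inv\<^bsub>Q\<^esub> s (\<beta> x \<otimes>\<^bsub>G\<^esub> \<beta> y)"
      using x by (simp add: t_eq[of "x \<otimes>\<^bsub>Q\<^esub> y"])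
    also have "\<dots> = t x \<otimes>\<^bsub>Q\<^esub> t y \<otimes>\<^bsub>Q\<^esub> f (\<beta> x) (\<beta> y)"
      unfolding xy f_eq using c by (simp add: Q.m_assoc)
    finally show ?thesis .
  qed

  define f' where "f' = (\<lambda>w. f (w ! 0) (w ! 1))"
  define t' where "t' = (\<lambda>w. t (w ! 0))"
  have f'_closed: "f' \<in> simplices G 2 \<rightarrow> carrier M"
    using fK by (auto simp: f'_def)
  have t'_closed: "t' \<in> simplices Q 1 \<rightarrow> carrier M"
    using tK by (auto simp: t'_def)
  \<comment> \<open>The cocycle identity says that the factor set has value 1 on the boundary of
    each 3-simplex.\<close>
  have boundary: "chain_eval M f' (bar_boundary G (scale (of_int e) d)) = \<one>\<^bsub>M\<^esub>"
  proof -
    have b3: "bar_boundary_basis G w \<in> bar_chains \<int> G 2" if "w \<in> simplices G 3" for w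
      using that by (intro Z.bar_boundary_basis_chains G.is_monoid) auto
    have "chain_eval M f' (bar_boundary G (scale (of_int e) d)) =
        chain_eval M (\<lambda>w. chain_eval M f' (bar_boundary_basis G w)) (scale (of_int e) d)"
      unfolding bar_boundary_def
      by (rule M.chain_eval_linear_extend[OF f'_closed d' b3])
    also have "\<dots> = chain_eval M (\<lambda>_. \<one>\<^bsub>M\<^esub>) (scale (of_int e) d)"
    proof (rule M.chain_eval_cong[OF _ d'])
      show "(\<lambda>w. chain_eval M f' (bar_boundary_basis G w)) \<in> simplices G 3 \<rightarrow> carrier M"
        by (rule funcsetI) (rule M.chain_eval_closed[OF f'_closed b3])
      fix w assume "w \<in> simplices G 3"
      then obtain g h l where w: "w = [g, h, l]" and ghl: "g \<in> carrier G" "h \<in> carrier G" "l \<in> carrier G"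
        by (auto simp: length_Suc_conv eval_nat_numeral)
      have b: "basis [a, b] \<in> bar_chains \<int> G 2" "[a, b] \<in> simplices G 2" if "a \<in> carrier G" "b \<in> carrier G" for a b
        using that by (auto intro!: Z.basis_bar_chains)
      have "chain_eval M f' (bar_boundary_basis G w) =
          f h l \<otimes>\<^bsub>M\<^esub> inv\<^bsub>M\<^esub> f (g \<otimes>\<^bsub>G\<^esub> h) l \<otimes>\<^bsub>M\<^esub> f g (h \<otimes>\<^bsub>G\<^esub> l) \<otimes>\<^bsub>M\<^esub> inv\<^bsub>M\<^esub> f g h"
        unfolding w bar_boundary_basis_simps using ghl
        by (simp only: M.chain_eval_diff[OF f'_closed] M.chain_eval_add[OF f'_closed] Z.diff_bar_chains
            Z.add_bar_chains b G.m_closed M.chain_eval_basis[OF f'_closed])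
          (simp add: f'_def)
      also have "\<dots> = (f h l \<otimes>\<^bsub>M\<^esub> f g (h \<otimes>\<^bsub>G\<^esub> l)) \<otimes>\<^bsub>M\<^esub> inv\<^bsub>M\<^esub> (f g h \<otimes>\<^bsub>M\<^esub> f (g \<otimes>\<^bsub>G\<^esub> h) l)"
        using fM ghl by (simp add: M.inv_mult M.m_ac del: M_simps)
      also have "\<dots> = \<one>\<^bsub>M\<^esub>"
        using cocycle[OF ghl] M.r_inv[OF M.m_closed[OF fM[OF ghl(1,2)] fM[OF G.m_closed[OF ghl(1,2)] ghl(3)]]]
        by (simp only: M_simps(2))
      finally show "chain_eval M f' (bar_boundary_basis G w) = \<one>\<^bsub>M\<^esub>" .
    qed
    finally show ?thesis by (simp only: M.chain_eval_one)
  qed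
  \<comment> \<open>On simplices this is \<open>t_mult\<close> solved for the factor set: f(\<beta>
    x, \<beta> y) = t(xy) t(x)^-1 t(y)^-1, which is \<open>t\<close> evaluated on the negative of
    the boundary of [x|y].\<close>
  have transfer: "chain_eval M f' (push \<beta> c) = chain_eval M t' (- bar_boundary Q c)" if c: "c \<in> bar_chains \<int> Q 2" for c
  proof -
    have b: "basis [x] \<in> bar_chains \<int> Q 1" "[x] \<in> simplices Q 1" if "x \<in> carrier Q" for x
      using that by (auto intro!: Z.basis_bar_chains)
    have bb: "- bar_boundary_basis Q w \<in> bar_chains \<int> Q 1" if "w \<in> simplices Q 2" for w
      using that by (intro Z.uminus_bar_chains Z.bar_boundary_basis_chains Q.is_monoid) auto
    have "chain_eval M f' (push \<beta> c) = chain_eval M (\<lambda>w. f' (map \<beta> w)) c"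
      by (rule M.chain_eval_push[OF f'_closed c]) simp
    also have "\<dots> = chain_eval M (\<lambda>w. chain_eval M t' (- bar_boundary_basis Q w)) c"
    proof (rule M.chain_eval_cong[OF _ c])
      show "(\<lambda>w. f' (map \<beta> w)) \<in> simplices Q 2 \<rightarrow> carrier M"
        using fK by (auto simp: f'_def)
      fix w assume "w \<in> simplices Q 2"
      then obtain x y where w: "w = [x, y]" and xy: "x \<in> carrier Q" "y \<in> carrier Q"
        by (auto simp: length_Suc_conv eval_nat_numeral)
      have "- bar_boundary_basis Q w = basis [x \<otimes>\<^bsub>Q\<^esub> y] - basis [x] - basis [y]"
        unfolding w bar_boundary_basis_simps by simp
      then have "chain_eval M t' (- bar_boundary_basis Q w) =
          t (x \<otimes>\<^bsub>Q\<^esub> y) \<otimes>\<^bsub>M\<^esub> inv\<^bsub>M\<^esub> t x \<otimes>\<^bsub>M\<^esub> inv\<^bsub>M\<^esub> t y"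
        using xy by (simp only: M.chain_eval_diff[OF t'_closed] Z.diff_bar_chains
            b Q.m_closed M.chain_eval_basis[OF t'_closed]) (simp add: t'_def)
      also have "t (x \<otimes>\<^bsub>Q\<^esub> y) = f (\<beta> x) (\<beta> y) \<otimes>\<^bsub>M\<^esub> t y \<otimes>\<^bsub>M\<^esub> t x"
        unfolding t_mult[OF xy] using M.m_comm[OF tM[OF xy(1)] tM[OF xy(2)]]
          M.m_comm[OF M.m_closed[OF tM[OF xy(1)] tM[OF xy(2)]] fM[of "\<beta> x" "\<beta> y"]]
          M.m_assoc[OF fM[of "\<beta> x" "\<beta> y"] tM[OF xy(2)] tM[OF xy(1)]] xy
        by (simp only: M_simps(2) \<beta>.hom_closed)
      also have "\<dots> \<otimes>\<^bsub>M\<^esub> inv\<^bsub>M\<^esub> t x \<otimes>\<^bsub>M\<^esub> inv\<^bsub>M\<^esub> t y = f (\<beta> x) (\<beta> y)"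
        using tM fM xy by (simp add: M.m_assoc del: M_simps)
      finally show "f' (map \<beta> w) = chain_eval M t' (- bar_boundary_basis Q w)"
        by (simp add: w f'_def)
    qed
    also have "\<dots> = chain_eval M t' (linear_extend (\<lambda>w. - bar_boundary_basis Q w) c)"
      by (rule M.chain_eval_linear_extend[OF t'_closed c bb, symmetric])
    also have "linear_extend (\<lambda>w. - bar_boundary_basis Q w) c = - bar_boundary Q c"
      by (simp add: linear_extend_uminus_fun bar_boundary_def)
    finally show ?thesis .
  qed
  have kK: "k \<in> K" using k by (simp add: K_def)
  have t_k: "t k = k" using k by (simp add: t_def s_def)
  \<comment> \<open>The boundary of \<open>c\<close> is [k], and \<open>transfer\<close> evaluates
    it with a minus sign; hence the exponent \<open>- e\<close>.\<close>
  have "chain_eval M f' (push \<beta> (scale (of_int e) c)) = chain_eval M t' (Poly_Mapping.single [k] (of_int (- e)))"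
    unfolding transfer[OF c'] bar_boundary_linear c(2)[symmetric] by (simp add: single_uminus)
  also have "\<dots> = k [^]\<^bsub>M\<^esub> (- e)"
    using M.chain_eval_single[of t' "[k]" "- e"] t_k kK by (simp add: t'_def)
  finally have lhs: "chain_eval M f' (push \<beta> (scale (of_int e) c)) = k [^]\<^bsub>M\<^esub> (- e)" .

  have iy: "push i (scale (of_int e) y2) \<in> bar_chains \<int> Q 2"
    by (rule Z.push_bar_chains[OF y' hom_in_carrier[OF i]])
  have "bar_boundary Q (push i (scale (of_int e) y2)) = 0"
    using Z.push_bar_boundary[OF y' i] y2(2) by (simp add: bar_boundary_linear)
  then have p: "chain_eval M f' (push \<beta> (push i (scale (of_int e) y2))) = \<one>\<^bsub>M\<^esub>"
    using transfer[OF iy] by (simp add: M.chain_eval_zero del: M_simps(3))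
  have f11: "f' [\<one>\<^bsub>G\<^esub>, \<one>\<^bsub>G\<^esub>] = \<one>\<^bsub>M\<^esub>"
    by (simp add: f'_def f_def s_def)
  have "chain_eval M f' (Poly_Mapping.single [\<one>\<^bsub>G\<^esub>, \<one>\<^bsub>G\<^esub>] (of_int e)) = f' [\<one>\<^bsub>G\<^esub>, \<one>\<^bsub>G\<^esub>] [^]\<^bsub>M\<^esub> e"
    by (rule M.chain_eval_single) (simp only: f11 M.one_closed)
  then have q: "chain_eval M f' (Poly_Mapping.single [\<one>\<^bsub>G\<^esub>, \<one>\<^bsub>G\<^esub>] (of_int e)) = \<one>\<^bsub>M\<^esub>"
    by (simp only: f11 M.int_pow_one)
  have bd: "bar_boundary G (scale (of_int e) d) \<in> bar_chains \<int> G 2"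
    using d' by (intro Z.bar_boundary_chains G.is_monoid) (simp add: eval_nat_numeral)
  have sg: "Poly_Mapping.single [\<one>\<^bsub>G\<^esub>, \<one>\<^bsub>G\<^esub>] (of_int e) \<in> bar_chains \<int> G 2"
    by (rule Z.single_bar_chains) auto
  have pp: "push \<beta> (push i (scale (of_int e) y2)) \<in> bar_chains \<int> G 2"
    by (rule Z.push_bar_chains[OF iy]) simp
  have "chain_eval M f' (push \<beta> (scale (of_int e) c)) = \<one>\<^bsub>M\<^esub>"
    unfolding eq M.chain_eval_add[OF f'_closed Z.add_bar_chains[OF bd sg] pp]
      M.chain_eval_add[OF f'_closed bd sg] boundary p q by (simp del: M_simps)
  with lhs have "k [^]\<^bsub>Q\<^esub> (- e) = \<one>\<^bsub>Q\<^esub>"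
    using pow_M[OF kK] by simp
  then have "k [^]\<^bsub>Q\<^esub> e = \<one>\<^bsub>Q\<^esub>"
    using Q.int_pow_neg[OF k(1), of e] Q.inv_eq_1_iff k(1) by simp
  with e show ?thesis by blast
qed

end

section \<open>Quotients, normal closures and commutators\<close>

lemma group_homI: "group G \<Longrightarrow> group H \<Longrightarrow> f \<in> hom G H \<Longrightarrow> group_hom G H f"
  by (simp add: group_hom_def group_hom_axioms_def)

text \<open>Stated for an arbitrary surjection instead of a factor group, as it is applied to
  quotient maps, to presentations, and to the projection of a subgroup of
  \<open>G \<times>\<times> A\<close>.\<close>

lemma hom_factor:
  assumes "group E" "group Q" "group H" and q: "q \<in> hom E Q" and g: "g \<in> hom E H"
    and surj: "q ` carrier E = carrier Q"
    and ker: "\<And>x. x \<in> carrier E \<Longrightarrow> q x = \<one>\<^bsub>Q\<^esub> \<Longrightarrow> g x = \<one>\<^bsub>H\<^esub>"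
  shows "\<exists>h \<in> hom Q H. \<forall>x \<in> carrier E. h (q x) = g x"
proof -
  interpret E: group E by fact
  interpret Q: group Q by fact
  interpret H: group H by fact
  interpret q: group_hom E Q q using q by unfold_locales
  interpret g: group_hom E H g using g by unfold_locales
  have eq: "g x = g y" if "x \<in> carrier E" "y \<in> carrier E" "q x = q y" for x y
  proof -
    have "q (x \<otimes>\<^bsub>E\<^esub> inv\<^bsub>E\<^esub> y) = \<one>\<^bsub>Q\<^esub>" using that by simp
    then have "g x \<otimes>\<^bsub>H\<^esub> inv\<^bsub>H\<^esub> g y = \<one>\<^bsub>H\<^esub>" using ker[of "x \<otimes>\<^bsub>E\<^esub> inv\<^bsub>E\<^esub> y"] that by simp
    then have "inv\<^bsub>H\<^esub> (inv\<^bsub>H\<^esub> g y) = g x"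
      by (rule H.inv_equality) (use that in simp_all)
    then show ?thesis using that by simp
  qed
  define h where "h = (\<lambda>y. g (inv_into (carrier E) q y))"
  have inv: "inv_into (carrier E) q y \<in> carrier E" "q (inv_into (carrier E) q y) = y" if "y \<in> carrier Q" for y
    using that surj by (metis inv_into_into, metis f_inv_into_f)
  have h: "h (q x) = g x" if "x \<in> carrier E" for x
    unfolding h_def using that inv[OF q.hom_closed[OF that]] by (intro eq)
  have "h \<in> hom Q H"
  proof (rule homI)
    show "h y \<in> carrier H" if "y \<in> carrier Q" for y
      using inv[OF that] by (simp add: h_def)
    show "h (y \<otimes>\<^bsub>Q\<^esub> z) = h y \<otimes>\<^bsub>H\<^esub> h z" if yz: "y \<in> carrier Q" "z \<in> carrier Q" for y z
      using h[of "inv_into (carrier E) q y \<otimes>\<^bsub>E\<^esub> inv_into (carrier E) q z"] inv[OF yz(1)] inv[OF yz(2)]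
      by (simp add: h_def[of] )
  qed
  then show ?thesis using h by blast
qed

lemma normal_closure_normal:
  assumes "group G" "S \<subseteq> carrier G"
  shows "normal_closure G S \<lhd> G"
proof -
  interpret group G by fact
  have S: "carrier G \<in> {N. N \<lhd> G \<and> S \<subseteq> N}"
    using assms(2) normal_self by blast
  have sub: "subgroup N G" if "N \<in> {N. N \<lhd> G \<and> S \<subseteq> N}" for N
    using that normal_imp_subgroup by blast
  have "subgroup (normal_closure G S) G"
    unfolding normal_closure_def using S sub by (intro subgroups_Inter) auto
  moreover have "x \<otimes>\<^bsub>G\<^esub> h \<otimes>\<^bsub>G\<^esub> inv\<^bsub>G\<^esub> x \<in> normal_closure G S" if "x \<in> carrier G" "h \<in> normal_closure G S" for x h
    using that unfolding normal_closure_def by (auto intro: normal.inv_op_closed2)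
  ultimately show ?thesis
    by (simp add: normal_inv_iff)
qed

lemma normal_closure_superset: "S \<subseteq> normal_closure G S"
  unfolding normal_closure_def by blast

lemma normal_closure_minimal: "N \<lhd> G \<Longrightarrow> S \<subseteq> N \<Longrightarrow> normal_closure G S \<subseteq> N"
  unfolding normal_closure_def by blast

lemma hom_normal_closure_trivial:
  assumes "group G" "group H" "f \<in> hom G H" "\<And>s. s \<in> S \<Longrightarrow> s \<in> carrier G \<and> f s = \<one>\<^bsub>H\<^esub>"
    and "x \<in> normal_closure G S"
  shows "f x = \<one>\<^bsub>H\<^esub>"
proof -
  interpret f: group_hom G H f
    using assms by (simp add: group_hom_def group_hom_axioms_def)
  have "normal_closure G S \<subseteq> kernel G H f"
    using assms(4) by (intro normal_closure_minimal f.normal_kernel) (auto simp: kernel_def)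
  then show ?thesis using assms(5) by (auto simp: kernel_def)
qed

definition relative_commutator :: "('a, 'm) monoid_scheme \<Rightarrow> 'a set \<Rightarrow> 'a set" where
  "relative_commutator G K =
    generate G {x \<otimes>\<^bsub>G\<^esub> k \<otimes>\<^bsub>G\<^esub> inv\<^bsub>G\<^esub> x \<otimes>\<^bsub>G\<^esub> inv\<^bsub>G\<^esub> k | x k. x \<in> carrier G \<and> k \<in> K}"

text \<open>The conjugate of [x, k] by g is [g x g^-1, g k g^-1], so the generating set is closed
  under conjugation. A generator is the product of x k x^-1 and k^-1, both in the normal
  subgroup.\<close>

lemma (in normal) relative_commutator_normal:
  "relative_commutator G H \<lhd> G" "relative_commutator G H \<subseteq> H"
proof -
  let ?C = "{x \<otimes> k \<otimes> inv x \<otimes> inv k | x k. x \<in> carrier G \<and> k \<in> H}"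
  have C: "?C \<subseteq> carrier G" using subset by auto
  show "relative_commutator G H \<lhd> G"
    unfolding relative_commutator_def
  proof (rule normal_generateI[OF C])
    fix h g assume "h \<in> ?C" and g: "g \<in> carrier G"
    then obtain x k where x: "x \<in> carrier G" "k \<in> H" "h = x \<otimes> k \<otimes> inv x \<otimes> inv k" by blast
    then have k: "k \<in> carrier G" using subset by blast
    have "g \<otimes> k \<otimes> inv g \<in> H" using x g by (simp add: inv_op_closed2)
    moreover have "g \<otimes> h \<otimes> inv g =
        (g \<otimes> x \<otimes> inv g) \<otimes> (g \<otimes> k \<otimes> inv g) \<otimes> inv (g \<otimes> x \<otimes> inv g) \<otimes> inv (g \<otimes> k \<otimes> inv g)"
    proof -
      have c: "inv g \<otimes> (g \<otimes> y) = y" if "y \<in> carrier G" for y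
        using that g by (simp flip: m_assoc)
      show ?thesis using x k g by (simp add: m_assoc inv_mult_group c)
    qed
    ultimately show "g \<otimes> h \<otimes> inv g \<in> ?C"
      using x g by (intro CollectI exI[of _ "g \<otimes> x \<otimes> inv g"] exI[of _ "g \<otimes> k \<otimes> inv g"]) auto
  qed
  have "?C \<subseteq> H"
    using inv_op_closed2 by auto
  then show "relative_commutator G H \<subseteq> H"
    unfolding relative_commutator_def by (rule generate_subgroup_incl[OF _ is_subgroup])
qed

lemma relative_commutator_commute:
  assumes "k \<in> K" "x \<in> carrier G"
  shows "x \<otimes>\<^bsub>G\<^esub> k \<otimes>\<^bsub>G\<^esub> inv\<^bsub>G\<^esub> x \<otimes>\<^bsub>G\<^esub> inv\<^bsub>G\<^esub> k \<in> relative_commutator G K"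
  unfolding relative_commutator_def using assms by (intro generate.incl) blast

section \<open>First homology and powers\<close>

context rat_subring
begin

lemma additive_int_pow:
  assumes "additive_quotient A V" "x \<in> A"
  shows "x [^]\<^bsub>additive_group A\<^esub> (k::int) = scale (of_int k) x"
proof -
  interpret additive_quotient A V by fact
  have n: "x [^]\<^bsub>additive_group A\<^esub> (n::nat) = scale (of_nat n) x" for n
  proof (induction n)
    case 0
    have "scale (of_nat 0) x = 0" unfolding of_nat_0 by (rule scale_simps)
    then show ?case by (simp only: add.nat_pow_0 additive_group_simps)
  qed (simp add: scale_distrib add.nat_pow_Suc add.commute)
  have neg: "scale (- r) x = - scale r x" for r
    by (rule poly_mapping_eqI) (simp add: lookup_minus)
  show ?thesis
  proof (cases "k < 0")
    case False
    then have "rat_of_nat (nat k) = of_int k" by simp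
    then show ?thesis using False by (simp only: int_pow_def2 if_False n)
  next
    case True
    have "x [^]\<^bsub>additive_group A\<^esub> nat (- k) \<in> A"
      using add.nat_pow_closed[of x "nat (- k)"] assms(2) by simp
    then have "x [^]\<^bsub>additive_group A\<^esub> k = - scale (of_nat (nat (- k))) x"
      using True by (simp only: int_pow_def2 inv_additive n if_True)
    moreover have "rat_of_nat (nat (- k)) = - of_int k" using True by simp
    ultimately show ?thesis by (simp only: neg minus_minus)
  qed
qed

text \<open>Chains modulo boundaries form an abelian group, so the canonical map to H_1(G; R) kills
  commutators.\<close>

lemma basis_derived:
  assumes "group G" "x \<in> derived G (carrier G)"
  shows "basis [x] \<in> bar_boundaries R G 1"
proof -
  interpret G: group G by fact
  interpret C: additive_quotient "bar_chains R G 1" "bar_boundaries R G 1"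
    by (rule additive_quotient_chains[OF G.is_monoid])
  have "C.coset (basis [x]) = C.coset 0"
    using hom_comm_derived[OF assms(1) C.comm_group_quotient abelianization_hom[OF G.is_monoid] assms(2)]
    by (simp only: C.one_quotient)
  then show ?thesis unfolding C.coset_eq_iff by simp
qed

lemma basis_int_pow:
  fixes k :: int
  assumes "group G" "x \<in> carrier G"
  shows "basis [x [^]\<^bsub>G\<^esub> k] - scale (of_int k) (basis [x]) \<in> bar_boundaries R G 1"
proof -
  interpret G: group G by fact
  interpret C: additive_quotient "bar_chains R G 1" "bar_boundaries R G 1"
    by (rule additive_quotient_chains[OF G.is_monoid])
  interpret ab: group_hom G "additive_group (bar_chains R G 1) Mod bar_boundaries R G 1" "\<lambda>x. C.coset (basis [x])"
    by (intro group_homI assms(1) C.V.factorgroup_is_group abelianization_hom G.is_monoid)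
  have b: "basis [x] \<in> bar_chains R G 1"
    using assms(2) by (intro basis_bar_chains) auto
  have "C.coset (basis [x [^]\<^bsub>G\<^esub> k]) = C.coset (basis [x]) [^]\<^bsub>additive_group (bar_chains R G 1) Mod bar_boundaries R G 1\<^esub> k"
    by (rule ab.hom_int_pow[OF assms(2)])
  also have "\<dots> = C.coset (scale (of_int k) (basis [x]))"
    by (simp only: C.coset_int_pow[OF b] additive_int_pow[OF C.additive_quotient_axioms b])
  finally show ?thesis unfolding C.coset_eq_iff .
qed

text \<open>An \<open>R\<close>-submodule of the 1-chains that contains the boundaries. The quotient
  by it is the cokernel of the map on H_1.\<close>

definition H1_image ::
    "('p, 'm) monoid_scheme \<Rightarrow> ('g, 'n) monoid_scheme \<Rightarrow> ('p \<Rightarrow> 'g) \<Rightarrow> ('g list \<Rightarrow>\<^sub>0 rat) set" where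
  "H1_image P G \<alpha> =
    {z \<in> bar_chains R G 1. \<exists>y \<in> bar_chains R P 1. z - push \<alpha> y \<in> bar_boundaries R G 1}"

lemma boundary_H1_image: "monoid G \<Longrightarrow> z \<in> bar_boundaries R G 1 \<Longrightarrow> z \<in> H1_image P G \<alpha>"
  using bar_boundaries_subset[of G 1] zero_bar_chains unfolding H1_image_def
  by (intro CollectI conjI bexI[of _ 0]) auto

lemma add_H1_image:
  assumes "z \<in> H1_image P G \<alpha>" "w \<in> H1_image P G \<alpha>"
  shows "z + w \<in> H1_image P G \<alpha>"
proof -
  obtain y u where "y \<in> bar_chains R P 1" "u \<in> bar_chains R P 1"
    "z - push \<alpha> y \<in> bar_boundaries R G 1" "w - push \<alpha> u \<in> bar_boundaries R G 1"
    using assms unfolding H1_image_def by blast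
  then show ?thesis
    using add_bar_boundaries[of "z - push \<alpha> y" G 1 "w - push \<alpha> u"] assms unfolding H1_image_def
    by (intro CollectI conjI bexI[of _ "y + u"] add_bar_chains) (simp_all add: linear_extend_add algebra_simps)
qed

lemma scale_H1_image:
  assumes r: "r \<in> R" and z: "z \<in> H1_image P G \<alpha>"
  shows "scale r z \<in> H1_image P G \<alpha>"
proof -
  obtain y where "y \<in> bar_chains R P 1" "z - push \<alpha> y \<in> bar_boundaries R G 1"
    using z unfolding H1_image_def by blast
  then show ?thesis
    using scale_bar_boundaries[OF r, of "z - push \<alpha> y" G 1] r z unfolding H1_image_def
    by (intro CollectI conjI bexI[of _ "scale r y"] scale_bar_chains) (simp_all add: linear_extend_scale scale_distrib)
qed

lemma uminus_H1_image: "z \<in> H1_image P G \<alpha> \<Longrightarrow> - z \<in> H1_image P G \<alpha>"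
  using scale_H1_image[OF uminus_mem[OF one_mem], of z] by (simp add: scale_uminus_one)

text \<open>The x with [x] in \<open>H1_image\<close> are closed under products and inverses, since
  [xy] and [x] + [y] differ by a boundary; linearity does the rest.\<close>

lemma H1_surj_generate:
  assumes "group G" "\<alpha> \<in> hom P G" "S \<subseteq> carrier G" "generate G S = carrier G"
    and S: "\<And>x. x \<in> S \<Longrightarrow> \<exists>y \<in> bar_chains R P 1. basis [x] - push \<alpha> y \<in> bar_boundaries R G 1"
  shows "H1_surj P G \<alpha>"
proof -
  interpret G: group G by fact
  define V where "V = H1_image P G \<alpha>"
  note boundary = boundary_H1_image[OF G.is_monoid, where P = P and \<alpha> = \<alpha>, folded V_def]
    and add = add_H1_image[where P = P and G = G and \<alpha> = \<alpha>, folded V_def]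
    and scale = scale_H1_image[where P = P and G = G and \<alpha> = \<alpha>, folded V_def]
    and neg = uminus_H1_image[where P = P and G = G and \<alpha> = \<alpha>, folded V_def]
  have SV: "basis [x] \<in> V" if "x \<in> S" for x
    using S[OF that] assms(3) that unfolding V_def H1_image_def by (intro CollectI conjI basis_bar_chains) auto
  have "basis [x] \<in> V" if "x \<in> generate G S" for x
    using that
  proof (induction rule: generate.induct)
    case one
    show ?case
      using basis_mult_boundary[of "\<one>\<^bsub>G\<^esub>" G "\<one>\<^bsub>G\<^esub>"] by (intro boundary) simp
  next
    case (incl h)
    then show ?case by (rule SV)
  next
    case (inv h)
    then have h: "h \<in> carrier G" "basis [h] \<in> V" using assms(3) SV by blast+
    have "basis [h [^]\<^bsub>G\<^esub> (- 1 :: int)] - scale (of_int (- 1)) (basis [h]) \<in> V"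
      by (intro boundary basis_int_pow assms(1) h)
    from add[OF this neg[OF h(2)]] show ?case
      using h(1) by (simp add: G.int_pow_neg G.int_pow_1 single_uminus)
  next
    case (eng a b)
    then have ab: "a \<in> carrier G" "b \<in> carrier G" using G.generate_in_carrier[OF assms(3)] by auto
    from add[OF add[OF eng.IH] neg[OF boundary[OF basis_mult_boundary[OF ab]]]]
    show ?case by simp
  qed
  then have V: "basis [x] \<in> V" if "x \<in> carrier G" for x
    using that assms(4) by simp
  show ?thesis
    unfolding H1_surj_def
  proof
    fix z assume z: "z \<in> bar_chains R G 1"
    have "linear_extend basis z \<in> V"
      using z
    proof (rule linear_extend_mem_submodule)
      fix s assume "s \<in> lists (carrier G)" "length s = 1"
      then obtain x where "s = [x]" "x \<in> carrier G" by (auto simp: length_Suc_conv)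
      then show "basis s \<in> V" using V by simp
    qed (auto intro: boundary zero_bar_boundaries add scale)
    then show "\<exists>y\<in>bar_chains R P 1. z - push \<alpha> y \<in> bar_boundaries R G 1"
      by (simp add: V_def H1_image_def)
  qed
qed

text \<open>Surjectivity on H_1 writes [h] as the image of a chain \<open>y\<close> of
  \<open>P\<close> plus a boundary. A multiple of this relation is integral and can be evaluated in
  G/[G, G], where boundaries have value 1 and the image of \<open>y\<close> becomes a product of
  powers of elements \<alpha>(p).\<close>

lemma H1_surj_power:
  assumes "group P" "group G" and \<alpha>: "\<alpha> \<in> hom P G" and H: "H1_surj P G \<alpha>" and h: "h \<in> carrier G"
  shows "\<exists>e \<in> denominators R. \<exists>p \<in> carrier P. h [^]\<^bsub>G\<^esub> e \<otimes>\<^bsub>G\<^esub> inv\<^bsub>G\<^esub> \<alpha> p \<in> derived G (carrier G)"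
proof -
  interpret P: group P by fact
  interpret G: group G by fact
  interpret \<alpha>: group_hom P G \<alpha> using \<alpha> by unfold_locales
  interpret Z: rat_subring \<int> by (rule rat_subring_Ints)
  have "basis [h] \<in> bar_chains R G 1" using h by (intro basis_bar_chains) auto
  then obtain y where y: "y \<in> bar_chains R P 1" "basis [h] - push \<alpha> y \<in> bar_boundaries R G 1"
    using H unfolding H1_surj_def by blast
  then obtain c where c: "c \<in> bar_chains R G (Suc 1)" "basis [h] - push \<alpha> y = bar_boundary G c"
    by (elim bar_boundariesE)
  then have c2: "c \<in> bar_chains R G 2" by (simp add: numeral_2_eq_2)
  obtain e1 where e1: "e1 \<in> denominators R" "scale (of_int e1) y \<in> bar_chains \<int> P 1"
    by (rule clear_denominators[OF y(1)])
  obtain e2 where e2: "e2 \<in> denominators R" "scale (of_int e2) c \<in> bar_chains \<int> G 2"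
    by (rule clear_denominators[OF c2])
  define e where "e = e1 * e2"
  have e: "e \<in> denominators R" unfolding e_def by (intro mult_denominators e1 e2)
  have y': "scale (of_int e) y \<in> bar_chains \<int> P 1"
    using Z.scale_bar_chains[OF Ints_of_int e1(2), of "e2"] by (simp add: e_def ac_simps)
  have c': "scale (of_int e) c \<in> bar_chains \<int> G 2"
    using Z.scale_bar_chains[OF Ints_of_int e2(2), of "e1"] by (simp add: e_def ac_simps)
  have "scale (of_int e) (basis [h] - push \<alpha> y) = scale (of_int e) (bar_boundary G c)"
    using c(2) by simp
  then have eq: "Poly_Mapping.single [h] (of_int e) =
      bar_boundary G (scale (of_int e) c) + push \<alpha> (scale (of_int e) y)"
    by (simp add: scale_distrib bar_boundary_linear linear_extend_scale algebra_simps)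

  interpret D: normal "derived G (carrier G)" G by (rule G.derived_self_is_normal)
  define M where "M = G Mod derived G (carrier G)"
  define f where "f = (\<lambda>x. derived G (carrier G) #>\<^bsub>G\<^esub> x)"
  have "comm_group M" unfolding M_def by (rule G.derived_quot_is_comm_group)
  then interpret M: comm_group M .
  interpret f: group_hom G M f
    unfolding f_def M_def by (intro group_homI assms(2) D.r_coset_hom_Mod D.factorgroup_is_group)
  define f' where "f' = (\<lambda>w. f (w ! 0))"
  have f': "f' \<in> simplices G 1 \<rightarrow> carrier M" by (auto simp: f'_def)
  have bb: "bar_boundary_basis G w \<in> bar_chains \<int> G 1" if "w \<in> simplices G 2" for w
    using that by (intro Z.bar_boundary_basis_chains G.is_monoid) auto
  have "chain_eval M f' (bar_boundary G (scale (of_int e) c)) =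
      chain_eval M (\<lambda>w. chain_eval M f' (bar_boundary_basis G w)) (scale (of_int e) c)"
    unfolding bar_boundary_def by (rule M.chain_eval_linear_extend[OF f' c' bb])
  also have "\<dots> = chain_eval M (\<lambda>_. \<one>\<^bsub>M\<^esub>) (scale (of_int e) c)"
  proof (rule M.chain_eval_cong[OF _ c'])
    show "(\<lambda>w. chain_eval M f' (bar_boundary_basis G w)) \<in> simplices G 2 \<rightarrow> carrier M"
      by (rule funcsetI) (rule M.chain_eval_closed[OF f' bb])
    fix w assume "w \<in> simplices G 2"
    then obtain x y where w: "w = [x, y]" and xy: "x \<in> carrier G" "y \<in> carrier G"
      by (auto simp: length_Suc_conv eval_nat_numeral)
    have b: "basis [x] \<in> bar_chains \<int> G 1" "[x] \<in> simplices G 1" if "x \<in> carrier G" for x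
      using that by (auto intro!: Z.basis_bar_chains)
    have "chain_eval M f' (bar_boundary_basis G w) = f y \<otimes>\<^bsub>M\<^esub> inv\<^bsub>M\<^esub> f (x \<otimes>\<^bsub>G\<^esub> y) \<otimes>\<^bsub>M\<^esub> f x"
      unfolding w bar_boundary_basis_simps using xy
      by (simp only: M.chain_eval_diff[OF f'] M.chain_eval_add[OF f'] Z.diff_bar_chains
          b G.m_closed M.chain_eval_basis[OF f']) (simp add: f'_def)
    also have "\<dots> = \<one>\<^bsub>M\<^esub>"
      using xy M.m_comm[of "f y \<otimes>\<^bsub>M\<^esub> inv\<^bsub>M\<^esub> f (x \<otimes>\<^bsub>G\<^esub> y)" "f x"]
        M.m_assoc[of "f x" "f y" "inv\<^bsub>M\<^esub> f (x \<otimes>\<^bsub>G\<^esub> y)", symmetric] M.r_inv[of "f x \<otimes>\<^bsub>M\<^esub> f y"]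
      by simp
    finally show "chain_eval M f' (bar_boundary_basis G w) = \<one>\<^bsub>M\<^esub>" .
  qed
  finally have boundary: "chain_eval M f' (bar_boundary G (scale (of_int e) c)) = \<one>\<^bsub>M\<^esub>"
    by (simp only: M.chain_eval_one)

  \<comment> \<open>A product of powers of values of the homomorphism
    \<open>f \<circ> \<alpha>\<close> is again such a value, so the whole chain of \<open>P\<close>
    is absorbed into a single element \<open>p\<close>.\<close>
  have "\<exists>p \<in> carrier P. finprod M (\<lambda>s. f (\<alpha> (s ! 0)) [^]\<^bsub>M\<^esub> n s) I = f (\<alpha> p)"
    if "finite I" "I \<subseteq> simplices P 1" for I and n :: "_ \<Rightarrow> int"
    using that
  proof (induction I rule: finite_induct)
    case empty
    show ?case by (intro bexI[of _ "\<one>\<^bsub>P\<^esub>"]) simp_all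
  next
    case (insert s I)
    then obtain p where p: "p \<in> carrier P" "finprod M (\<lambda>s. f (\<alpha> (s ! 0)) [^]\<^bsub>M\<^esub> n s) I = f (\<alpha> p)" by auto
    have c: "t ! 0 \<in> carrier P" if "t \<in> insert s I" for t
      using insert.prems that by (auto simp: length_Suc_conv)
    have "finprod M (\<lambda>s. f (\<alpha> (s ! 0)) [^]\<^bsub>M\<^esub> n s) (insert s I) = f (\<alpha> (s ! 0)) [^]\<^bsub>M\<^esub> n s \<otimes>\<^bsub>M\<^esub> f (\<alpha> p)"
      using insert.hyps c p by (subst M.finprod_insert) (auto intro!: M.int_pow_closed)
    also have "\<dots> = f (\<alpha> ((s ! 0) [^]\<^bsub>P\<^esub> n s \<otimes>\<^bsub>P\<^esub> p))"
      using c[of s] p(1) by (simp add: f.hom_int_pow \<alpha>.hom_int_pow)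
    finally show ?case using c[of s] p(1) by (intro bexI[of _ "(s ! 0) [^]\<^bsub>P\<^esub> n s \<otimes>\<^bsub>P\<^esub> p"]) simp_all
  qed
  note power_product = this
  have "Poly_Mapping.keys (scale (of_int e) y) \<subseteq> simplices P 1"
    using y' unfolding bar_chains_def by blast
  from power_product[OF finite_keys this, of "\<lambda>s. \<lfloor>Poly_Mapping.lookup (scale (of_int e) y) s\<rfloor>"] obtain p where p: "p \<in> carrier P"
    "chain_eval M (\<lambda>s. f (\<alpha> (s ! 0))) (scale (of_int e) y) = f (\<alpha> p)"
    unfolding chain_eval_def by (elim bexE)
  have "chain_eval M f' (push \<alpha> (scale (of_int e) y)) = chain_eval M (\<lambda>s. f' (map \<alpha> s)) (scale (of_int e) y)"
    by (rule M.chain_eval_push[OF f' y']) simp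
  also have "\<dots> = f (\<alpha> p)"
    unfolding p(2)[symmetric] by (rule M.chain_eval_cong[OF _ y']) (auto simp: f'_def)
  finally have push: "chain_eval M f' (push \<alpha> (scale (of_int e) y)) = f (\<alpha> p)" .
  have bd: "bar_boundary G (scale (of_int e) c) \<in> bar_chains \<int> G 1"
    using c' by (intro Z.bar_boundary_chains G.is_monoid) (simp add: numeral_2_eq_2)
  have "f h [^]\<^bsub>M\<^esub> e = chain_eval M f' (Poly_Mapping.single [h] (of_int e))"
    using h by (subst M.chain_eval_single) (simp_all add: f'_def)
  also have "\<dots> = chain_eval M f' (bar_boundary G (scale (of_int e) c)) \<otimes>\<^bsub>M\<^esub>
      chain_eval M f' (push \<alpha> (scale (of_int e) y))"
    unfolding eq by (rule M.chain_eval_add[OF f' bd]) (rule Z.push_bar_chains[OF y' \<alpha>.hom_closed])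
  also have "\<dots> = f (\<alpha> p)"
    using p(1) by (simp only: boundary push) simp
  finally have "f (h [^]\<^bsub>G\<^esub> e) = f (\<alpha> p)"
    using f.hom_int_pow[OF h] by simp
  then have "h [^]\<^bsub>G\<^esub> e \<in> f (\<alpha> p)"
    using G.rcos_self[OF G.int_pow_closed[OF h] D.is_subgroup] unfolding f_def by blast
  then have "h [^]\<^bsub>G\<^esub> e \<otimes>\<^bsub>G\<^esub> inv\<^bsub>G\<^esub> \<alpha> p \<in> derived G (carrier G)"
    unfolding f_def using p(1) D.rcos_module_imp[OF G.is_group] by simp
  with e p(1) show ?thesis by blast
qed

text \<open>A homomorphism and its factorisation through a quotient agree on the carrier, but not
  necessarily as functions; this and the next lemma bridge the gap.\<close>

lemma H1_inj_cong:
  assumes "H1_inj P G \<alpha>" "\<And>x. x \<in> carrier P \<Longrightarrow> \<alpha> x = \<alpha>' x"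
  shows "H1_inj P G \<alpha>'"
  unfolding H1_inj_def
proof (intro ballI impI)
  fix z assume z: "z \<in> bar_chains R P 1" "push \<alpha>' z \<in> bar_boundaries R G 1"
  have "push \<alpha> z = push \<alpha>' z" by (rule push_cong[OF z(1) assms(2)])
  then show "z \<in> bar_boundaries R P 1"
    using assms(1) z unfolding H1_inj_def by simp
qed

lemma H2_surj_cong:
  assumes "H2_surj P G \<alpha>" "\<And>x. x \<in> carrier P \<Longrightarrow> \<alpha> x = \<alpha>' x"
  shows "H2_surj P G \<alpha>'"
  unfolding H2_surj_def
proof (intro ballI impI)
  fix z assume "z \<in> bar_chains R G 2" "bar_boundary G z = 0"
  with assms(1) obtain y where y: "y \<in> bar_chains R P 2" "bar_boundary P y = 0"
    "z - push \<alpha> y \<in> bar_boundaries R G 2"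
    unfolding H2_surj_def by blast
  moreover have "push \<alpha> y = push \<alpha>' y" by (rule push_cong[OF y(1) assms(2)])
  ultimately show "\<exists>y\<in>bar_chains R P 2. bar_boundary P y = 0 \<and> z - push \<alpha>' y \<in> bar_boundaries R G 2"
    by (intro bexI[of _ y]) simp_all
qed

text \<open>In E/[E, K], where K is the kernel of \<open>\<beta>\<close>, the image of K is central,
  so \<open>central_kernel_torsion\<close> applies to that quotient. The result is the elementwise
  form of the vanishing of K/[E, K] after tensoring with \<open>R\<close>.\<close>

lemma kernel_torsion_mod_commutators:
  fixes P :: "('p, 'm) monoid_scheme" and G :: "('g, 'n) monoid_scheme" and E :: "('q, 'l) monoid_scheme"
  assumes "group P" "group G" "group E"
    and i: "i \<in> hom P E" and \<beta>: "\<beta> \<in> hom E G" and surj: "\<beta> ` carrier E = carrier G"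
    and H: "H1_surj P E i" "H1_inj P G (\<beta> \<circ> i)" "H2_surj P G (\<beta> \<circ> i)"
    and k: "k \<in> kernel E G \<beta>"
  shows "\<exists>e \<in> denominators R. k [^]\<^bsub>E\<^esub> e \<in> relative_commutator E (kernel E G \<beta>)"
proof -
  interpret P: group P by fact
  interpret G: group G by fact
  interpret E: group E by fact
  interpret \<beta>: group_hom E G \<beta> using \<beta> by unfold_locales
  interpret K: normal "kernel E G \<beta>" E by (rule \<beta>.normal_kernel)
  define D where "D = relative_commutator E (kernel E G \<beta>)"
  interpret D: normal D E unfolding D_def by (rule K.relative_commutator_normal)
  define Q where "Q = E Mod D"
  define q where "q = (\<lambda>x. D #>\<^bsub>E\<^esub> x)"
  have Q: "group Q" unfolding Q_def by (rule D.factorgroup_is_group)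
  interpret Q: group Q by (rule Q)
  have q: "q \<in> hom E Q" unfolding q_def Q_def by (rule D.r_coset_hom_Mod)
  interpret q: group_hom E Q q by (intro group_homI assms(3) Q q)
  have q_surj: "q ` carrier E = carrier Q"
    unfolding q_def Q_def carrier_FactGroup ..
  have q_one: "q x = \<one>\<^bsub>Q\<^esub> \<longleftrightarrow> x \<in> D" if "x \<in> carrier E" for x
    unfolding q_def Q_def one_FactGroup
    using E.coset_join1[OF _ that D.is_subgroup] E.coset_join2[OF that D.is_subgroup] by (rule iffI)
  have \<beta>_one: "\<beta> x = \<one>\<^bsub>G\<^esub>" if "x \<in> carrier E" "q x = \<one>\<^bsub>Q\<^esub>" for x
    using that q_one K.relative_commutator_normal(2) unfolding D_def kernel_def by blast
  have "\<exists>\<gamma> \<in> hom Q G. \<forall>x \<in> carrier E. \<gamma> (q x) = \<beta> x"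
    by (rule hom_factor[OF assms(3) Q assms(2) q \<beta> q_surj \<beta>_one])
  then obtain \<gamma> where \<gamma>: "\<gamma> \<in> hom Q G" "\<And>x. x \<in> carrier E \<Longrightarrow> \<gamma> (q x) = \<beta> x"
    by blast
  \<comment> \<open>The commutator of \<open>x\<close> and \<open>l\<close> lifts to one of the
    generators of [E, K].\<close>
  have central: "l \<otimes>\<^bsub>Q\<^esub> x = x \<otimes>\<^bsub>Q\<^esub> l" if l: "l \<in> carrier Q" "\<gamma> l = \<one>\<^bsub>G\<^esub>" and x: "x \<in> carrier Q" for l x
  proof -
    obtain l0 x0 where 0: "l0 \<in> carrier E" "x0 \<in> carrier E" "l = q l0" "x = q x0"
      using l(1) x q_surj by (metis imageE)
    have "\<beta> l0 = \<one>\<^bsub>G\<^esub>" using \<gamma>(2)[OF 0(1)] l(2) 0(3) by simp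
    then have "l0 \<in> kernel E G \<beta>" using 0(1) unfolding kernel_def by blast
    from relative_commutator_commute[OF this 0(2)]
    have "x0 \<otimes>\<^bsub>E\<^esub> l0 \<otimes>\<^bsub>E\<^esub> inv\<^bsub>E\<^esub> x0 \<otimes>\<^bsub>E\<^esub> inv\<^bsub>E\<^esub> l0 \<in> D"
      by (simp only: D_def)
    then have "q (x0 \<otimes>\<^bsub>E\<^esub> l0 \<otimes>\<^bsub>E\<^esub> inv\<^bsub>E\<^esub> x0 \<otimes>\<^bsub>E\<^esub> inv\<^bsub>E\<^esub> l0) = \<one>\<^bsub>Q\<^esub>"
      using q_one[OF subsetD[OF D.subset]] by blast
    then have "x \<otimes>\<^bsub>Q\<^esub> l \<otimes>\<^bsub>Q\<^esub> inv\<^bsub>Q\<^esub> x \<otimes>\<^bsub>Q\<^esub> inv\<^bsub>Q\<^esub> l = \<one>\<^bsub>Q\<^esub>"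
      unfolding 0(3,4) using 0(1,2) by simp
    then have "x \<otimes>\<^bsub>Q\<^esub> l \<otimes>\<^bsub>Q\<^esub> inv\<^bsub>Q\<^esub> x = l"
      using Q.inv_solve_right'[of "\<one>\<^bsub>Q\<^esub>" "x \<otimes>\<^bsub>Q\<^esub> l \<otimes>\<^bsub>Q\<^esub> inv\<^bsub>Q\<^esub> x" l] l(1) x
      by (simp only: Q.one_closed Q.m_closed Q.inv_closed Q.l_one)
    then have "x \<otimes>\<^bsub>Q\<^esub> l = l \<otimes>\<^bsub>Q\<^esub> x"
      using Q.inv_solve_right'[of l "x \<otimes>\<^bsub>Q\<^esub> l" x] l(1) x
      by (simp only: Q.m_closed)
    then show ?thesis ..
  qed
  have qi: "q \<circ> i \<in> hom P Q" using hom_compose[OF i q] .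
  \<comment> \<open>Surjectivity on H_1 passes to the quotient: lift a generator to \<open>E\<close>
    and push the boundary found there forward.\<close>
  have surj1: "H1_surj P Q (q \<circ> i)"
  proof (rule H1_surj_generate[OF Q qi subset_refl])
    show "generate Q (carrier Q) = carrier Q"
      using Q.generate_incl[OF subset_refl] generate.incl[of _ "carrier Q" Q] by (intro equalityI subsetI) auto
    fix x assume "x \<in> carrier Q"
    then obtain x0 where x0: "x0 \<in> carrier E" "x = q x0" using q_surj by (metis imageE)
    then have "basis [x0] \<in> bar_chains R E 1" by (intro basis_bar_chains) auto
    then obtain y where y: "y \<in> bar_chains R P 1" "basis [x0] - push i y \<in> bar_boundaries R E 1"
      using H(1) unfolding H1_surj_def by blast
    have "push q (basis [x0] - push i y) = basis [x] - push (q \<circ> i) y"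
      using x0(2) by (simp only: linear_extend_diff push_push linear_extend_single scale_simps list.map)
    then show "\<exists>y\<in>bar_chains R P 1. basis [x] - push (q \<circ> i) y \<in> bar_boundaries R Q 1"
      using push_bar_boundaries[OF y(2) q] y(1) by (intro bexI[of _ y]) simp_all
  qed
  have eq: "(\<beta> \<circ> i) x = (\<gamma> \<circ> (q \<circ> i)) x" if "x \<in> carrier P" for x
    using \<gamma>(2)[OF hom_in_carrier[OF i that]] by simp
  have kE: "k \<in> carrier E" "\<beta> k = \<one>\<^bsub>G\<^esub>" using k unfolding kernel_def by blast+
  have \<gamma>_surj: "\<gamma> ` carrier Q = carrier G"
    unfolding q_surj[symmetric] surj[symmetric] image_image using \<gamma>(2) by (intro image_cong refl)
  have "\<exists>e \<in> denominators R. q k [^]\<^bsub>Q\<^esub> e = \<one>\<^bsub>Q\<^esub>"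
  proof (rule central_kernel_torsion[OF assms(1,2) Q qi \<gamma>(1) \<gamma>_surj central surj1])
    show "H1_inj P G (\<gamma> \<circ> (q \<circ> i))" by (rule H1_inj_cong[OF H(2) eq])
    show "H2_surj P G (\<gamma> \<circ> (q \<circ> i))" by (rule H2_surj_cong[OF H(3) eq])
    show "q k \<in> carrier Q" by (rule q.hom_closed[OF kE(1)])
    show "\<gamma> (q k) = \<one>\<^bsub>G\<^esub>" by (simp only: \<gamma>(2)[OF kE(1)] kE(2))
  qed
  then obtain e where e: "e \<in> denominators R" "q k [^]\<^bsub>Q\<^esub> e = \<one>\<^bsub>Q\<^esub>" ..
  then have "k [^]\<^bsub>E\<^esub> e \<in> D"
    using q_one[OF E.int_pow_closed[OF kE(1)]] q.hom_int_pow[OF kE(1)] by simp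
  with e(1) show ?thesis unfolding D_def ..
qed

end

section \<open>Closed groups are local\<close>

lemma subgroup_preimage:
  assumes "group E" "group H" "f \<in> hom E H" "subgroup N H"
  shows "subgroup {x \<in> carrier E. f x \<in> N} E"
proof -
  interpret E: group E by fact
  interpret f: group_hom E H f by (rule group_homI[OF assms(1,2,3)])
  interpret N: subgroup N H by fact
  show ?thesis
    by (rule E.subgroupI) (auto intro!: exI[of _ "\<one>\<^bsub>E\<^esub>"])
qed

lemma generate_preimage:
  assumes "group E" "group H" "f \<in> hom E H" "subgroup N H" "T \<subseteq> carrier E"
    and "\<And>x. x \<in> T \<Longrightarrow> f x \<in> N" "x \<in> generate E T"
  shows "f x \<in> N"
proof -
  have "T \<subseteq> {x \<in> carrier E. f x \<in> N}" using assms(5,6) by blast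
  then show ?thesis
    using group.generate_subgroup_incl[OF assms(1) _ subgroup_preimage[OF assms(1-4)], of T] assms(7) by blast
qed

text \<open>The reason is the one for which finite presentability does not depend on the generators
  chosen. Beside the images of the relators \<open>S\<close>, each generator x of \<open>E\<close>
  needs one relation that identifies it with a word \<open>u x\<close> having the same image in
  \<open>G\<close>. Modulo these the words from \<open>F\<close> exhaust \<open>E\<close>, and an
  element of the kernel is represented by a word in the normal closure of \<open>S\<close>.\<close>

lemma kernel_normally_finite:
  fixes F :: "('f, 'k) monoid_scheme" and E :: "('e, 'm) monoid_scheme" and G :: "('g, 'n) monoid_scheme"
  assumes "group F" "group E" "group G"
    and \<theta>: "\<theta> \<in> hom F E" and \<beta>: "\<beta> \<in> hom E G"
    and S: "finite S" "S \<subseteq> carrier F" "kernel F G (\<beta> \<circ> \<theta>) = normal_closure F S"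
    and surj: "(\<beta> \<circ> \<theta>) ` carrier F = carrier G"
    and T: "finite T" "T \<subseteq> carrier E" "generate E T = carrier E"
  shows "\<exists>U. finite U \<and> U \<subseteq> carrier E \<and> kernel E G \<beta> = normal_closure E U"
proof -
  interpret F: group F by fact
  interpret E: group E by fact
  interpret G: group G by fact
  interpret \<theta>: group_hom F E \<theta> by (rule group_homI[OF assms(1,2) \<theta>])
  interpret \<beta>: group_hom E G \<beta> by (rule group_homI[OF assms(2,3) \<beta>])
  have "\<exists>u \<in> carrier F. \<beta> (\<theta> u) = \<beta> x" if "x \<in> T" for x
  proof -
    have "\<beta> x \<in> (\<beta> \<circ> \<theta>) ` carrier F" using that T(2) surj by auto
    then show ?thesis by auto
  qed
  then obtain u where u: "\<And>x. x \<in> T \<Longrightarrow> u x \<in> carrier F" "\<And>x. x \<in> T \<Longrightarrow> \<beta> (\<theta> (u x)) = \<beta> x"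
    by metis
  define U where "U = \<theta> ` S \<union> (\<lambda>x. inv\<^bsub>E\<^esub> x \<otimes>\<^bsub>E\<^esub> \<theta> (u x)) ` T"
  define N where "N = normal_closure E U"
  have U: "finite U" "U \<subseteq> carrier E"
    unfolding U_def using S(1,2) T(1,2) u(1) by auto
  interpret N: normal N E unfolding N_def by (rule normal_closure_normal[OF assms(2) U(2)])
  have UN: "U \<subseteq> N" unfolding N_def by (rule normal_closure_superset)
  have UK: "\<beta> x = \<one>\<^bsub>G\<^esub>" if "x \<in> U" for x
  proof -
    have "\<beta> (\<theta> s) = \<one>\<^bsub>G\<^esub>" if "s \<in> S" for s
      using that S(3) normal_closure_superset[of S F] unfolding kernel_def by auto
    moreover have "\<beta> (inv\<^bsub>E\<^esub> y \<otimes>\<^bsub>E\<^esub> \<theta> (u y)) = \<one>\<^bsub>G\<^esub>" if "y \<in> T" for y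
      using that u[OF that] T(2) by (subst \<beta>.hom_mult) auto
    ultimately show ?thesis using that unfolding U_def by blast
  qed
  have "U \<subseteq> kernel E G \<beta>" using U(2) UK unfolding kernel_def by blast
  then have NK: "N \<subseteq> kernel E G \<beta>"
    unfolding N_def by (rule normal_closure_minimal[OF \<beta>.normal_kernel])
  define Q where "Q = E Mod N"
  define q where "q = (\<lambda>x. N #>\<^bsub>E\<^esub> x)"
  have Q: "group Q" unfolding Q_def by (rule N.factorgroup_is_group)
  have q: "q \<in> hom E Q" unfolding q_def Q_def by (rule N.r_coset_hom_Mod)
  interpret q: group_hom E Q q by (rule group_homI[OF assms(2) Q q])
  have q_one: "q x = \<one>\<^bsub>Q\<^esub> \<longleftrightarrow> x \<in> N" if "x \<in> carrier E" for x
    unfolding q_def Q_def one_FactGroup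
    using E.coset_join1[OF _ that N.is_subgroup] E.coset_join2[OF that N.is_subgroup] by (rule iffI)
  have q\<theta>: "q \<circ> \<theta> \<in> hom F Q" using hom_compose[OF \<theta> q] .
  interpret q\<theta>: group_hom F Q "q \<circ> \<theta>" by (rule group_homI[OF assms(1) Q q\<theta>])
  have "q x \<in> (q \<circ> \<theta>) ` carrier F" if "x \<in> generate E T" for x
  proof (rule generate_preimage[OF assms(2) Q q q\<theta>.img_is_subgroup T(2) _ that])
    fix x assume x: "x \<in> T"
    then have xE: "x \<in> carrier E" using T(2) by blast
    have "q (inv\<^bsub>E\<^esub> x \<otimes>\<^bsub>E\<^esub> \<theta> (u x)) = \<one>\<^bsub>Q\<^esub>"
      using x xE u(1)[OF x] UN unfolding U_def by (intro iffD2[OF q_one]) auto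
    then have "inv\<^bsub>Q\<^esub> q x \<otimes>\<^bsub>Q\<^esub> q (\<theta> (u x)) = \<one>\<^bsub>Q\<^esub>"
      using xE u(1)[OF x] by simp
    then have "q (\<theta> (u x)) = q x"
      using q.H.inv_solve_left'[of "\<one>\<^bsub>Q\<^esub>" "q x" "q (\<theta> (u x))"] xE u(1)[OF x] by simp
    then show "q x \<in> (q \<circ> \<theta>) ` carrier F" using u(1)[OF x] by (intro image_eqI[of _ _ "u x"]) simp_all
  qed
  then have image: "\<exists>v \<in> carrier F. q x = q (\<theta> v)" if "x \<in> carrier E" for x
    using that unfolding T(3) image_iff o_apply by blast
  have "kernel E G \<beta> \<subseteq> N"
  proof
    fix x assume "x \<in> kernel E G \<beta>"
    then have x: "x \<in> carrier E" "\<beta> x = \<one>\<^bsub>G\<^esub>" unfolding kernel_def by blast+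
    obtain v where v: "v \<in> carrier F" "q x = q (\<theta> v)" using image[OF x(1)] by blast
    have "q (x \<otimes>\<^bsub>E\<^esub> inv\<^bsub>E\<^esub> \<theta> v) = \<one>\<^bsub>Q\<^esub>" using x v by simp
    then have xv: "x \<otimes>\<^bsub>E\<^esub> inv\<^bsub>E\<^esub> \<theta> v \<in> N" by (rule iffD1[OF q_one, rotated]) (use x v in simp)
    then have "\<beta> (x \<otimes>\<^bsub>E\<^esub> inv\<^bsub>E\<^esub> \<theta> v) = \<one>\<^bsub>G\<^esub>" using NK unfolding kernel_def by blast
    then have "\<beta> (\<theta> v) = \<one>\<^bsub>G\<^esub>" using x v by simp
    then have "v \<in> normal_closure F S" using v(1) unfolding S(3)[symmetric] kernel_def by simp
    then have "(q \<circ> \<theta>) v = \<one>\<^bsub>Q\<^esub>"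
    proof (rule hom_normal_closure_trivial[OF assms(1) Q q\<theta>, rotated])
      fix s assume "s \<in> S"
      then show "s \<in> carrier F \<and> (q \<circ> \<theta>) s = \<one>\<^bsub>Q\<^esub>"
        using S(2) UN q_one[of "\<theta> s"] unfolding U_def by auto
    qed
    then show "x \<in> N" using v(2) q_one[OF x(1)] by simp
  qed
  with NK U show ?thesis unfolding N_def by blast
qed

section \<open>Evaluation of the words of a system\<close>

abbreviation system_eval ::
    "('a, 'm) monoid_scheme \<Rightarrow> (nat \<Rightarrow> 'a) \<Rightarrow> ('a + (nat \<times> bool) list set) list set \<Rightarrow> 'a" where
  "system_eval A g \<equiv> free_product_lift A (\<lambda>a. a) (free_group_lift A g)"

abbreviation free_projection :: "('b, 'm) monoid_scheme \<Rightarrow> ('a + 'b) list set \<Rightarrow> 'b" where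
  "free_projection F \<equiv> free_product_lift F (\<lambda>_. \<one>\<^bsub>F\<^esub>) (\<lambda>x. x)"

context
  fixes A :: "('a, 'm) monoid_scheme" and n :: nat
  assumes A: "group A"
begin

interpretation A: group A by (rule A)
interpretation F: group "free_group {..<n}" by (rule group_free_group)
interpretation AF: group_pair A "free_group {..<n}" by unfold_locales

lemma system_eval_hom:
  assumes "g \<in> {..<n} \<rightarrow> carrier A"
  shows "system_eval A g \<in> hom (free_product A (free_group {..<n})) A"
    and "a \<in> carrier A \<Longrightarrow>
      system_eval A g (free_inl A (free_group {..<n}) a) = a"
    and "u \<in> carrier (free_group {..<n}) \<Longrightarrow>
      system_eval A g (free_inr A (free_group {..<n}) u) = free_group_lift A g u"
proof -
  have id: "(\<lambda>a. a) \<in> hom A A" by (simp add: hom_def)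
  note * = A id free_group_lift_hom[OF A assms]
  show "system_eval A g \<in> hom (free_product A (free_group {..<n})) A"
    by (rule AF.free_product_lift_hom[OF *])
  show "system_eval A g (free_inl A (free_group {..<n}) a) = a"
    if "a \<in> carrier A"
    by (rule AF.free_product_lift_inl[OF * that])
  show "system_eval A g (free_inr A (free_group {..<n}) u) = free_group_lift A g u"
    if "u \<in> carrier (free_group {..<n})"
    by (rule AF.free_product_lift_inr[OF * that])
qed

lemma proj_free_group_hom:
  shows "free_projection (free_group {..<n})
      \<in> hom (free_product A (free_group {..<n})) (free_group {..<n})"
    and "a \<in> carrier A \<Longrightarrow> free_projection (free_group {..<n})
      (free_inl A (free_group {..<n}) a) = \<one>\<^bsub>free_group {..<n}\<^esub>"
    and "u \<in> carrier (free_group {..<n}) \<Longrightarrow>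
      free_projection (free_group {..<n})
      (free_inr A (free_group {..<n}) u) = u"
proof -
  have 1: "(\<lambda>_. \<one>\<^bsub>free_group {..<n}\<^esub>) \<in> hom A (free_group {..<n})" by (simp add: hom_def)
  have 2: "(\<lambda>x. x) \<in> hom (free_group {..<n}) (free_group {..<n})" by (simp add: hom_def)
  note * = group_free_group 1 2
  show "free_projection (free_group {..<n})
      \<in> hom (free_product A (free_group {..<n})) (free_group {..<n})"
    by (rule AF.free_product_lift_hom[OF *])
  show "free_projection (free_group {..<n})
      (free_inl A (free_group {..<n}) a) = \<one>\<^bsub>free_group {..<n}\<^esub>" if "a \<in> carrier A"
    by (rule AF.free_product_lift_inl[OF * that])
  show "free_projection (free_group {..<n})
      (free_inr A (free_group {..<n}) u) = u" if "u \<in> carrier (free_group {..<n})"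
    by (rule AF.free_product_lift_inr[OF * that])
qed

lemma proj_H1_one_iff:
  assumes "w \<in> carrier (free_product A (free_group {..<n}))"
  shows "proj_H1 A (free_group {..<n}) w =
      \<one>\<^bsub>free_group {..<n} Mod derived (free_group {..<n}) (carrier (free_group {..<n}))\<^esub> \<longleftrightarrow>
    free_projection (free_group {..<n}) w
      \<in> derived (free_group {..<n}) (carrier (free_group {..<n}))"
proof -
  have c: "free_projection (free_group {..<n}) w \<in> carrier (free_group {..<n})"
    by (rule hom_in_carrier[OF proj_free_group_hom(1) assms])
  have D: "subgroup (derived (free_group {..<n}) (carrier (free_group {..<n}))) (free_group {..<n})"
    by (rule F.derived_is_subgroup[OF subset_refl])
  show ?thesis
    unfolding proj_H1_def one_FactGroup
    using F.coset_join1[OF _ c D] F.coset_join2[OF c D] by (rule iffI)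
qed

end

text \<open>
  An element of \<open>K\<close> is the value at \<open>\<gamma>(U)\<close> of some \<open>w \<in> A * F\<close> that is trivial at \<open>(1, \<dots>, 1)\<close>, and for
  elements of \<open>[E, K]\<close> one can choose \<open>w\<close> nullhomologous. The powers of \<open>U\<close> in \<open>[E, K]\<close> therefore
  give a system that is solved both by \<open>\<gamma>(U)\<close> and by \<open>(1, \<dots>, 1)\<close>.
\<close>

lemma (in rat_subring) R_closed_kills:
  fixes A :: "('a, 'm) monoid_scheme" and E :: "('e, 'l) monoid_scheme"
  assumes "group A" "R_closed R A" "group E" and \<gamma>: "\<gamma> \<in> hom E A"
    and U: "finite U" "U \<subseteq> carrier E" "K = normal_closure E U"
    and power: "\<And>k. k \<in> U \<Longrightarrow> \<exists>e \<in> denominators R. k [^]\<^bsub>E\<^esub> e \<in> relative_commutator E K"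
    and k: "k \<in> K"
  shows "\<gamma> k = \<one>\<^bsub>A\<^esub>"
proof -
  interpret A: group A by fact
  interpret E: group E by fact
  interpret \<gamma>: group_hom E A \<gamma> by (rule group_homI[OF assms(3,1) \<gamma>])
  interpret K: normal K E unfolding U(3) by (rule normal_closure_normal[OF assms(3) U(2)])
  define C where "C = relative_commutator E K"
  interpret C: normal C E unfolding C_def by (rule K.relative_commutator_normal)
  have UK: "U \<subseteq> K" unfolding U(3) by (rule normal_closure_superset)
  obtain e where e: "e \<in> denominators R" "\<And>x. x \<in> U \<Longrightarrow> x [^]\<^bsub>E\<^esub> e \<in> C"
  proof (rule common_denominator[of U "\<lambda>e x. x [^]\<^bsub>E\<^esub> e \<in> C"])
    show "x [^]\<^bsub>E\<^esub> (e * d) \<in> C" if "x \<in> U" "x [^]\<^bsub>E\<^esub> e \<in> C" for d e :: int and x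
      using that U(2) E.int_pow_pow[of x e d] E.subgroup_int_pow_closed[OF C.is_subgroup that(2), of d] by auto
  qed (use U(1) power C_def in auto)
  obtain f and n :: nat where f: "U = f ` {i. i < n}"
    using finite_imp_nat_seg_image_inj_on[OF U(1)] by blast
  have fU: "f i \<in> U" if "i < n" for i using f that by blast
  have fE: "f i \<in> carrier E" if "i < n" for i using fU[OF that] U(2) by blast
  define F where "F = free_group {..<n}"
  define W where "W = free_product A F"
  interpret F: group F unfolding F_def by (rule group_free_group)
  interpret AF: group_pair A F by unfold_locales
  interpret W: group W unfolding W_def by (rule AF.group_free_product)
  \<comment> \<open>The two tuples that will solve the same system. They are cut off outside the
    indices because solutions are extensional functions.\<close>
  define g1 where "g1 = (\<lambda>i\<in>{..<n}. \<gamma> (f i))"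
  define g0 where "g0 = (\<lambda>i\<in>{..<n}. \<one>\<^bsub>A\<^esub>)"
  have g1: "g1 \<in> {..<n} \<rightarrow>\<^sub>E carrier A" and g0: "g0 \<in> {..<n} \<rightarrow>\<^sub>E carrier A"
    using fE by (auto simp: g1_def g0_def)
  then have g1': "g1 \<in> {..<n} \<rightarrow> carrier A" and g0': "g0 \<in> {..<n} \<rightarrow> carrier A" by auto
  define ev1 where "ev1 = system_eval A g1"
  define ev0 where "ev0 = system_eval A g0"
  define pr :: "('a + (nat \<times> bool) list set) list set \<Rightarrow> (nat \<times> bool) list set" where "pr = free_projection F"
  define inl where "inl = free_inl A F"
  define inr where "inr = free_inr A F"
  have inl: "inl \<in> hom A W" unfolding inl_def W_def by (rule AF.free_inl_hom)
  have inr: "inr \<in> hom F W" unfolding inr_def W_def by (rule AF.free_inr_hom)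
  interpret inl: group_hom A W inl by (rule group_homI[OF A.is_group W.is_group inl])
  interpret ev1: group_hom W A ev1
    unfolding ev1_def W_def F_def
    by (intro group_homI system_eval_hom(1) group_pair.group_free_product group_pair.intro group_free_group assms(1) g1')
  interpret ev0: group_hom W A ev0
    unfolding ev0_def W_def F_def
    by (intro group_homI system_eval_hom(1) group_pair.group_free_product group_pair.intro group_free_group assms(1) g0')
  interpret pr: group_hom W F pr
    unfolding pr_def W_def F_def
    by (intro group_homI proj_free_group_hom(1) group_pair.group_free_product group_pair.intro group_free_group assms(1))
  have ev_inl: "ev1 (inl a) = a" "ev0 (inl a) = a" "pr (inl a) = \<one>\<^bsub>F\<^esub>" if "a \<in> carrier A" for a
    using that unfolding ev1_def ev0_def pr_def inl_def F_def
    by (simp_all only: system_eval_hom(2)[OF assms(1) g1'] system_eval_hom(2)[OF assms(1) g0']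
        proj_free_group_hom(2)[OF assms(1)])
  have gen: "free_gen {..<n} i \<in> carrier F" if "i < n" for i
    unfolding F_def by (rule free_gen_closed) (use that in simp)
  have ev_gen: "ev1 (inr (free_gen {..<n} i)) = \<gamma> (f i)" "ev0 (inr (free_gen {..<n} i)) = \<one>\<^bsub>A\<^esub>" if "i < n" for i
    using that gen[OF that] unfolding ev1_def ev0_def inr_def F_def
    by (simp_all only: system_eval_hom(3)[OF assms(1) g1'] system_eval_hom(3)[OF assms(1) g0']
        free_group_lift_gen[OF assms(1) g1'] free_group_lift_gen[OF assms(1) g0'] lessThan_iff)
      (simp_all add: g1_def g0_def)

  define N0 where "N0 = {w \<in> carrier W. ev0 w = \<one>\<^bsub>A\<^esub>}"
  have N0: "subgroup N0 W"
    using ev0.subgroup_kernel unfolding N0_def kernel_def .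
  have img_N0: "subgroup (ev1 ` N0) A"
    by (rule ev1.subgroup_img_is_subgroup[OF N0])
  \<comment> \<open>The elements whose image is the value at \<open>g1\<close> of a word that is
    trivial at \<open>g0\<close>. This subgroup is normal, because conjugation by x is imitated by
    conjugation with the constant \<open>inl (\<gamma> x)\<close>, and it contains \<open>U\<close>,
    because the i-th unknown is such a word for \<open>f i\<close>.\<close>
  define L where "L = {x \<in> carrier E. \<gamma> x \<in> ev1 ` N0}"
  have L: "subgroup L E"
    unfolding L_def by (rule subgroup_preimage[OF assms(3,1) \<gamma> img_N0])
  have "L \<lhd> E"
    unfolding E.normal_inv_iff
  proof (intro conjI ballI L)
    fix x h assume x: "x \<in> carrier E" and "h \<in> L"
    then obtain w where w: "h \<in> carrier E" "w \<in> carrier W" "ev0 w = \<one>\<^bsub>A\<^esub>" "\<gamma> h = ev1 w"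
      unfolding L_def N0_def by auto
    let ?v = "inl (\<gamma> x) \<otimes>\<^bsub>W\<^esub> w \<otimes>\<^bsub>W\<^esub> inv\<^bsub>W\<^esub> inl (\<gamma> x)"
    have "?v \<in> N0" "ev1 ?v = \<gamma> (x \<otimes>\<^bsub>E\<^esub> h \<otimes>\<^bsub>E\<^esub> inv\<^bsub>E\<^esub> x)"
      unfolding N0_def using x w by (simp_all add: ev_inl)
    then show "x \<otimes>\<^bsub>E\<^esub> h \<otimes>\<^bsub>E\<^esub> inv\<^bsub>E\<^esub> x \<in> L"
      unfolding L_def using x w(1) by (auto intro: image_eqI[of _ _ ?v])
  qed
  moreover have "U \<subseteq> L"
  proof
    fix x assume "x \<in> U"
    then obtain i where i: "i < n" "x = f i" using f by blast
    have "inr (free_gen {..<n} i) \<in> N0"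
      unfolding N0_def using ev_gen(2)[OF i(1)] hom_in_carrier[OF inr gen[OF i(1)]] by simp
    then show "x \<in> L"
      unfolding L_def i(2) using fE[OF i(1)] ev_gen(1)[OF i(1), symmetric] by blast
  qed
  ultimately have KL: "K \<subseteq> L"
    unfolding U(3) by (rule normal_closure_minimal)

  define DF where "DF = derived F (carrier F)"
  have DF: "subgroup DF F" unfolding DF_def by (rule F.derived_is_subgroup[OF subset_refl])
  define N1 where "N1 = {w \<in> carrier W. pr w \<in> DF} \<inter> N0"
  have N1: "subgroup N1 W"
    unfolding N1_def
    by (intro W.subgroups_Inter_pair N0 subgroup_preimage[OF W.is_group F.is_group pr.homh DF])
  have img_N1: "subgroup (ev1 ` N1) A"
    by (rule ev1.subgroup_img_is_subgroup[OF N1])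
  have CN: "\<gamma> x \<in> ev1 ` N1" if "x \<in> C" for x
  proof (rule generate_preimage[OF assms(3,1) \<gamma> img_N1 _ _ that[unfolded C_def relative_commutator_def]])
    show "{x \<otimes>\<^bsub>E\<^esub> k \<otimes>\<^bsub>E\<^esub> inv\<^bsub>E\<^esub> x \<otimes>\<^bsub>E\<^esub> inv\<^bsub>E\<^esub> k |x k. x \<in> carrier E \<and> k \<in> K} \<subseteq> carrier E"
      using K.subset by auto
    fix y assume "y \<in> {x \<otimes>\<^bsub>E\<^esub> k \<otimes>\<^bsub>E\<^esub> inv\<^bsub>E\<^esub> x \<otimes>\<^bsub>E\<^esub> inv\<^bsub>E\<^esub> k |x k. x \<in> carrier E \<and> k \<in> K}"
    then obtain x k where x: "x \<in> carrier E" "k \<in> K" "y = x \<otimes>\<^bsub>E\<^esub> k \<otimes>\<^bsub>E\<^esub> inv\<^bsub>E\<^esub> x \<otimes>\<^bsub>E\<^esub> inv\<^bsub>E\<^esub> k" by blast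
    from x(2) KL have "k \<in> L" by blast
    then obtain w where w: "k \<in> carrier E" "w \<in> carrier W" "ev0 w = \<one>\<^bsub>A\<^esub>" "\<gamma> k = ev1 w"
      unfolding L_def N0_def by auto
    \<comment> \<open>Constants project to 1, so the commutator of a constant with \<open>w\<close>
      projects to 1 in the free group: it is nullhomologous whatever \<open>w\<close> is.\<close>
    let ?v = "inl (\<gamma> x) \<otimes>\<^bsub>W\<^esub> w \<otimes>\<^bsub>W\<^esub> inv\<^bsub>W\<^esub> inl (\<gamma> x) \<otimes>\<^bsub>W\<^esub> inv\<^bsub>W\<^esub> w"
    have "?v \<in> carrier W" "pr ?v = \<one>\<^bsub>F\<^esub>" "ev0 ?v = \<one>\<^bsub>A\<^esub>" "ev1 ?v = \<gamma> y"
      using x w by (simp_all add: ev_inl)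
    then show "\<gamma> y \<in> ev1 ` N1"
      unfolding N1_def N0_def using subgroup.one_closed[OF DF] by (intro image_eqI[of _ _ ?v]) auto
  qed
  \<comment> \<open>The \<open>e\<close>-th power of each normal generator lies in [E, K], so its
    image is the value at \<open>g1\<close> of a nullhomologous word that is trivial at
    \<open>g0\<close>.\<close>
  have "\<exists>w \<in> N1. ev1 w = \<gamma> (f i) [^]\<^bsub>A\<^esub> e" if "i < n" for i
    using CN[OF e(2)[OF fU[OF that]]] fE[OF that] by (auto simp: \<gamma>.hom_int_pow)
  then obtain w where w: "\<And>i. i < n \<Longrightarrow> w i \<in> N1" "\<And>i. i < n \<Longrightarrow> ev1 (w i) = \<gamma> (f i) [^]\<^bsub>A\<^esub> e"
    by metis
  have "nullhomologous_system R A n e w"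
    unfolding nullhomologous_system_def
  proof (intro conjI allI impI e(1))
    fix i assume i: "i < n"
    show c: "w i \<in> carrier (free_product A (free_group {..<n}))"
      using w(1)[OF i] unfolding N1_def W_def F_def by blast
    show "proj_H1 A (free_group {..<n}) (w i) =
        \<one>\<^bsub>free_group {..<n} Mod derived (free_group {..<n}) (carrier (free_group {..<n}))\<^esub>"
      unfolding proj_H1_one_iff[OF assms(1) c]
      using w(1)[OF i] unfolding N1_def DF_def F_def pr_def by blast
  qed
  then have unique: "\<exists>!g. system_solution A n e w g"
    using assms(2) unfolding R_closed_def by blast
  have "system_solution A n e w g1"
    unfolding system_solution_def using g1 w(2) unfolding ev1_def by (simp add: g1_def)
  moreover have "system_solution A n e w g0"
    unfolding system_solution_def
  proof (intro conjI allI impI g0)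
    fix i assume i: "i < n"
    have "ev0 (w i) = \<one>\<^bsub>A\<^esub>" using w(1)[OF i] unfolding N1_def N0_def by blast
    then show "g0 i [^]\<^bsub>A\<^esub> e = system_eval A g0 (w i)"
      using i unfolding ev0_def[symmetric] by (simp add: g0_def)
  qed
  ultimately have "g1 = g0" using unique by blast
  then have "g1 i = g0 i" for i by simp
  then have "\<gamma> (f i) = \<one>\<^bsub>A\<^esub>" if "i < n" for i
    using that unfolding g1_def g0_def by (metis lessThan_iff restrict_apply')
  then have "\<gamma> x = \<one>\<^bsub>A\<^esub>" if "x \<in> U" for x
    using that f by blast
  then show ?thesis
    using hom_normal_closure_trivial[OF assms(3,1) \<gamma>, of U k] k U(2) unfolding U(3) by blast
qed

lemma quotient_projection:
  assumes "group F" "N \<lhd> F" "group G" and j: "j \<in> iso (F Mod N) G"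
  defines "q \<equiv> \<lambda>x. j (N #>\<^bsub>F\<^esub> x)"
  shows "q \<in> hom F G" "q ` carrier F = carrier G" "kernel F G q = N"
proof -
  interpret F: group F by fact
  interpret N: normal N F by fact
  have jh: "j \<in> hom (F Mod N) G" and jb: "bij_betw j (carrier (F Mod N)) (carrier G)"
    using j unfolding iso_def by blast+
  interpret j: group_hom "F Mod N" G j by (rule group_homI[OF N.factorgroup_is_group assms(3) jh])
  have q_eq: "q = j \<circ> (\<lambda>x. N #>\<^bsub>F\<^esub> x)" unfolding q_def by (simp add: o_def)
  show "q \<in> hom F G" unfolding q_eq by (rule hom_compose[OF N.r_coset_hom_Mod jh])
  show "q ` carrier F = carrier G"
    unfolding q_eq image_comp[symmetric] carrier_FactGroup[symmetric] using jb by (rule bij_betw_imp_surj_on)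
  have "q x = \<one>\<^bsub>G\<^esub> \<longleftrightarrow> x \<in> N" if x: "x \<in> carrier F" for x
  proof -
    have "q x = \<one>\<^bsub>G\<^esub> \<longleftrightarrow> N #>\<^bsub>F\<^esub> x = \<one>\<^bsub>F Mod N\<^esub>"
      unfolding q_def using bij_betw_imp_inj_on[OF jb] hom_in_carrier[OF N.r_coset_hom_Mod x] j.hom_one
      by (metis inj_onD j.G.one_closed)
    also have "\<dots> \<longleftrightarrow> x \<in> N"
      unfolding one_FactGroup
      using F.coset_join1[OF _ x N.is_subgroup] F.coset_join2[OF x N.is_subgroup] by (rule iffI)
    finally show ?thesis .
  qed
  then show "kernel F G q = N" unfolding kernel_def using N.subset by blast
qed

lemma finitely_presented_groupE:
  assumes "finitely_presented_group G"
  obtains n :: nat and S \<epsilon> where "finite S" "S \<subseteq> carrier (free_group {..<n})"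
    "\<epsilon> \<in> hom (free_group {..<n}) G" "\<epsilon> ` carrier (free_group {..<n}) = carrier G"
    "kernel (free_group {..<n}) G \<epsilon> = normal_closure (free_group {..<n}) S"
proof -
  have G: "group G" using assms by (simp add: finitely_presented_group_def)
  from assms obtain n :: nat and S where S: "finite S" "S \<subseteq> carrier (free_group {..<n})"
    and iso: "G \<cong> free_group {..<n} Mod normal_closure (free_group {..<n}) S"
    unfolding finitely_presented_group_def by blast
  have "free_group {..<n} Mod normal_closure (free_group {..<n}) S \<cong> G"
    using group.iso_sym[OF G iso] .
  then obtain j where "j \<in> iso (free_group {..<n} Mod normal_closure (free_group {..<n}) S) G"
    unfolding is_iso_def by blast
  from quotient_projection[OF group_free_group normal_closure_normal[OF group_free_group S(2)] G this]
  show ?thesis by (rule that[OF S])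
qed

text \<open>
  Modulo \<open>[G, G]\<close>, powers of the generators of \<open>G\<close> come from \<open>P\<close>, so the generators solve a
  nullhomologous system with coefficients in \<open>P\<close>. An extension must map them to the solution \<open>a\<close>
  of the induced system over \<open>A\<close>. Conversely the graph of the extension is the subgroup \<open>E\<close> of
  \<open>G \<times> A\<close> generated by the pairs \<open>(\<alpha> p, \<phi> p)\<close> and \<open>(generator, a)\<close>: the kernel of \<open>E \<rightarrow> G\<close> is killed in \<open>A\<close>.
\<close>

lemma (in rat_subring) R_closed_imp_extension:
  fixes A :: "('a, 'm) monoid_scheme" and P :: "('p, 'k) monoid_scheme" and G :: "('g, 'l) monoid_scheme"
  assumes "group A" "R_closed R A" and Omega: "in_Omega R P G \<alpha>" and \<phi>: "\<phi> \<in> hom P A"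
  shows "\<exists>!\<psi>. \<psi> \<in> hom G A \<inter> extensional (carrier G) \<and> (\<forall>x\<in>carrier P. \<psi> (\<alpha> x) = \<phi> x)"
proof -
  have fin: "finitely_generated_group P" "finitely_presented_group G" and \<alpha>: "\<alpha> \<in> hom P G"
    and H: "H1_surj P G \<alpha>" "H1_inj P G \<alpha>" "H2_surj P G \<alpha>"
    using Omega unfolding in_Omega_iff by blast+
  have P: "group P" and G: "group G"
    using fin by (simp_all add: finitely_generated_group_def finitely_presented_group_def)
  interpret A: group A by fact
  interpret P: group P by (rule P)
  interpret G: group G by (rule G)
  interpret \<alpha>: group_hom P G \<alpha> by (rule group_homI[OF P G \<alpha>])
  interpret \<phi>: group_hom P A \<phi> by (rule group_homI[OF P assms(1) \<phi>])
  obtain n :: nat and S \<epsilon> where S: "finite S" "S \<subseteq> carrier (free_group {..<n})"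
    and \<epsilon>: "\<epsilon> \<in> hom (free_group {..<n}) G" "\<epsilon> ` carrier (free_group {..<n}) = carrier G"
    and ker: "kernel (free_group {..<n}) G \<epsilon> = normal_closure (free_group {..<n}) S"
    by (rule finitely_presented_groupE[OF fin(2)])
  define F where "F = free_group {..<n}"
  note S = S[folded F_def] and \<epsilon> = \<epsilon>[folded F_def] and ker = ker[folded F_def]
  have F: "group F" unfolding F_def by (rule group_free_group)
  interpret F: group F by (rule F)
  interpret \<epsilon>: group_hom F G \<epsilon> by (rule group_homI[OF F G \<epsilon>(1)])
  define x where "x = free_gen {..<n}"
  have x: "x i \<in> carrier F" if "i < n" for i
    unfolding x_def F_def by (rule free_gen_closed) (use that in simp)
  let ?D = "derived G (carrier G)"
  interpret D: normal ?D G by (rule G.derived_self_is_normal)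

  \<comment> \<open>A system has one exponent for all its equations, so the exponents of the single
    generators are replaced by a common multiple. Raising to the power \<open>d\<close> takes place
    in G/[G, G], where it preserves equality of cosets.\<close>
  obtain e where e: "e \<in> denominators R"
    "\<And>i. i \<in> {..<n} \<Longrightarrow> \<exists>p \<in> carrier P. \<epsilon> (x i) [^]\<^bsub>G\<^esub> e \<otimes>\<^bsub>G\<^esub> inv\<^bsub>G\<^esub> \<alpha> p \<in> ?D"
  proof (rule common_denominator[of "{..<n}" "\<lambda>e i. \<exists>p \<in> carrier P. \<epsilon> (x i) [^]\<^bsub>G\<^esub> e \<otimes>\<^bsub>G\<^esub> inv\<^bsub>G\<^esub> \<alpha> p \<in> ?D"])
    show "\<exists>e \<in> denominators R. \<exists>p \<in> carrier P. \<epsilon> (x i) [^]\<^bsub>G\<^esub> e \<otimes>\<^bsub>G\<^esub> inv\<^bsub>G\<^esub> \<alpha> p \<in> ?D" if "i \<in> {..<n}" for i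
      by (rule H1_surj_power[OF P G \<alpha> H(1)]) (use x that in simp)
    show "\<exists>p \<in> carrier P. \<epsilon> (x i) [^]\<^bsub>G\<^esub> (e * d) \<otimes>\<^bsub>G\<^esub> inv\<^bsub>G\<^esub> \<alpha> p \<in> ?D"
      if i: "i \<in> {..<n}" and ex: "\<exists>p \<in> carrier P. \<epsilon> (x i) [^]\<^bsub>G\<^esub> e \<otimes>\<^bsub>G\<^esub> inv\<^bsub>G\<^esub> \<alpha> p \<in> ?D" for d e :: int and i
    proof -
      obtain p where p: "p \<in> carrier P" "\<epsilon> (x i) [^]\<^bsub>G\<^esub> e \<otimes>\<^bsub>G\<^esub> inv\<^bsub>G\<^esub> \<alpha> p \<in> ?D" using ex by blast
      have h: "\<epsilon> (x i) \<in> carrier G" using x i by simp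
      have c: "u \<otimes>\<^bsub>G\<^esub> inv\<^bsub>G\<^esub> v \<in> ?D \<longleftrightarrow> ?D #>\<^bsub>G\<^esub> u = ?D #>\<^bsub>G\<^esub> v" if "u \<in> carrier G" "v \<in> carrier G" for u v
      proof
        assume "u \<otimes>\<^bsub>G\<^esub> inv\<^bsub>G\<^esub> v \<in> ?D"
        then have "u \<in> ?D #>\<^bsub>G\<^esub> v" using that by (intro D.rcos_module_rev G)
        then show "?D #>\<^bsub>G\<^esub> u = ?D #>\<^bsub>G\<^esub> v" using G.repr_independence[OF _ that(2) D.is_subgroup] by simp
      next
        assume "?D #>\<^bsub>G\<^esub> u = ?D #>\<^bsub>G\<^esub> v"
        then have "u \<in> ?D #>\<^bsub>G\<^esub> v" using G.rcos_self[OF that(1) D.is_subgroup] by simp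
        then show "u \<otimes>\<^bsub>G\<^esub> inv\<^bsub>G\<^esub> v \<in> ?D" using that by (intro D.rcos_module_imp G)
      qed
      have "?D #>\<^bsub>G\<^esub> (\<epsilon> (x i) [^]\<^bsub>G\<^esub> e) = ?D #>\<^bsub>G\<^esub> \<alpha> p"
        using p c[of "\<epsilon> (x i) [^]\<^bsub>G\<^esub> e" "\<alpha> p"] h by simp
      then have "?D #>\<^bsub>G\<^esub> (\<epsilon> (x i) [^]\<^bsub>G\<^esub> e) [^]\<^bsub>G\<^esub> d = ?D #>\<^bsub>G\<^esub> \<alpha> p [^]\<^bsub>G\<^esub> d"
        using D.FactGroup_int_pow[of "\<epsilon> (x i) [^]\<^bsub>G\<^esub> e" d] D.FactGroup_int_pow[of "\<alpha> p" d] h p(1) by simp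
      then show ?thesis
        using p(1) h c[of "\<epsilon> (x i) [^]\<^bsub>G\<^esub> (e * d)" "\<alpha> (p [^]\<^bsub>P\<^esub> d)"]
        by (intro bexI[of _ "p [^]\<^bsub>P\<^esub> d"]) (simp_all add: G.int_pow_pow \<alpha>.hom_int_pow)
    qed
  qed auto
  then obtain p where p: "\<And>i. i < n \<Longrightarrow> p i \<in> carrier P"
    "\<And>i. i < n \<Longrightarrow> \<epsilon> (x i) [^]\<^bsub>G\<^esub> e \<otimes>\<^bsub>G\<^esub> inv\<^bsub>G\<^esub> \<alpha> (p i) \<in> ?D"
    by (metis lessThan_iff)
  \<comment> \<open>The element of [G, G] by which the \<open>e\<close>-th power of a generator
    differs from \<alpha>(p_i) is lifted to [F, F]. This gives equations x_i^e = c_i(x) p_i with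
    nullhomologous right-hand sides.\<close>
  have "\<exists>c. c \<in> derived F (carrier F) \<and> \<epsilon> c = \<epsilon> (x i) [^]\<^bsub>G\<^esub> e \<otimes>\<^bsub>G\<^esub> inv\<^bsub>G\<^esub> \<alpha> (p i)" if "i < n" for i
    by (rule surj_hom_derived[OF F G \<epsilon> p(2)[OF that]]) (intro exI conjI)
  then obtain c where c: "\<And>i. i < n \<Longrightarrow> c i \<in> derived F (carrier F)"
    "\<And>i. i < n \<Longrightarrow> \<epsilon> (c i) = \<epsilon> (x i) [^]\<^bsub>G\<^esub> e \<otimes>\<^bsub>G\<^esub> inv\<^bsub>G\<^esub> \<alpha> (p i)"
    by metis
  have cF: "c i \<in> carrier F" if "i < n" for i
    using c(1)[OF that] F.derived_in_carrier[OF subset_refl] by blast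
  have power: "\<epsilon> (x i) [^]\<^bsub>G\<^esub> e = \<epsilon> (c i) \<otimes>\<^bsub>G\<^esub> \<alpha> (p i)" if "i < n" for i
    using that x p(1) by (simp add: c(2) G.m_assoc)

  define W where "W = free_product A F"
  define w where "w = (\<lambda>i. free_inr A F (c i) \<otimes>\<^bsub>W\<^esub> free_inl A F (\<phi> (p i)))"
  interpret AF: group_pair A F by unfold_locales
  have inr: "free_inr A F (c i) \<in> carrier W" and inl: "free_inl A F (\<phi> (p i)) \<in> carrier W" if "i < n" for i
    unfolding W_def using cF[OF that] p(1)[OF that]
    by (auto intro: hom_in_carrier[OF AF.free_inr_hom] hom_in_carrier[OF AF.free_inl_hom])
  have wW: "w i \<in> carrier W" if "i < n" for i
    using inr[OF that] inl[OF that] AF.group_free_product unfolding w_def W_def by (simp add: group.is_monoid monoid.m_closed)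
  have null: "nullhomologous_system R A n e w"
    unfolding nullhomologous_system_def
  proof (intro conjI allI impI e(1))
    fix i assume i: "i < n"
    show cw: "w i \<in> carrier (free_product A (free_group {..<n}))"
      using wW[OF i] unfolding W_def F_def .
    show "proj_H1 A (free_group {..<n}) (w i) =
        \<one>\<^bsub>free_group {..<n} Mod derived (free_group {..<n}) (carrier (free_group {..<n}))\<^esub>"
      unfolding proj_H1_one_iff[OF assms(1) cw]
      using hom_mult[OF proj_free_group_hom(1)[OF assms(1)] inr[OF i, unfolded W_def F_def] inl[OF i, unfolded W_def F_def]]
        proj_free_group_hom(2)[OF assms(1) \<phi>.hom_closed[OF p(1)[OF i]], where n = n]
        proj_free_group_hom(3)[OF assms(1) cF[OF i, unfolded F_def]] c(1)[OF i] cF[OF i]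
      unfolding w_def W_def F_def[symmetric] by simp
  qed
  have lift: "free_group_lift A g \<in> hom F A" and lift_gen: "i < n \<Longrightarrow> free_group_lift A g (x i) = g i"
    if "g \<in> {..<n} \<rightarrow> carrier A" for g i
    unfolding F_def x_def using free_group_lift_hom[OF assms(1) that] free_group_lift_gen[OF assms(1) that] by auto
  have eval: "system_eval A g (w i) =
      free_group_lift A g (c i) \<otimes>\<^bsub>A\<^esub> \<phi> (p i)" if g: "g \<in> {..<n} \<rightarrow> carrier A" and i: "i < n" for g i
    using hom_mult[OF system_eval_hom(1)[OF assms(1) g] inr[OF i, unfolded W_def F_def] inl[OF i, unfolded W_def F_def]]
      system_eval_hom(2)[OF assms(1) g \<phi>.hom_closed[OF p(1)[OF i]]]
      system_eval_hom(3)[OF assms(1) g cF[OF i, unfolded F_def]]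
    unfolding w_def W_def F_def[symmetric] by simp
  obtain a where a: "system_solution A n e w a" and a_unique: "\<And>g. system_solution A n e w g \<Longrightarrow> g = a"
    using assms(2) null unfolding R_closed_def by blast
  have aA: "a \<in> {..<n} \<rightarrow> carrier A" using a unfolding system_solution_def by auto
  have a_power: "a i [^]\<^bsub>A\<^esub> e = free_group_lift A a (c i) \<otimes>\<^bsub>A\<^esub> \<phi> (p i)" if "i < n" for i
    using a eval[OF aA that] that unfolding system_solution_def by simp

  \<comment> \<open>An extension carries the equations between the generators of \<open>G\<close> to
    \<open>A\<close>, so the images of the generators solve the system and must be
    \<open>a\<close>.\<close>
  have unique: "\<psi> (\<epsilon> u) = free_group_lift A a u"
    if \<psi>: "\<psi> \<in> hom G A" "\<forall>x\<in>carrier P. \<psi> (\<alpha> x) = \<phi> x" and u: "u \<in> carrier F" for \<psi> u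
  proof -
    interpret \<psi>: group_hom G A \<psi> by (rule group_homI[OF G assms(1) \<psi>(1)])
    define g where "g = (\<lambda>i\<in>{..<n}. \<psi> (\<epsilon> (x i)))"
    have gE: "g \<in> {..<n} \<rightarrow>\<^sub>E carrier A" using x by (auto simp: g_def)
    then have gA: "g \<in> {..<n} \<rightarrow> carrier A" by auto
    have comp: "(\<psi> \<circ> \<epsilon>) v = free_group_lift A g v" if "v \<in> carrier F" for v
    proof (rule free_group_hom_unique[OF assms(1) hom_compose[OF \<epsilon>(1) \<psi>(1), unfolded F_def] lift[OF gA, unfolded F_def] _ that[unfolded F_def]])
      fix i assume "i \<in> {..<n}"
      then have "i < n" by simp
      then show "(\<psi> \<circ> \<epsilon>) (free_gen {..<n} i) = free_group_lift A g (free_gen {..<n} i)"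
        unfolding x_def[symmetric] lift_gen[OF gA \<open>i < n\<close>] by (simp add: g_def)
    qed
    have "system_solution A n e w g"
      unfolding system_solution_def
    proof (intro conjI allI impI gE)
      fix i assume i: "i < n"
      have "g i [^]\<^bsub>A\<^esub> e = \<psi> (\<epsilon> (x i) [^]\<^bsub>G\<^esub> e)"
        using i x by (simp add: g_def \<psi>.hom_int_pow)
      also have "\<dots> = free_group_lift A g (c i) \<otimes>\<^bsub>A\<^esub> \<phi> (p i)"
        unfolding power[OF i] using comp[OF cF[OF i]] cF[OF i] p(1)[OF i] \<psi>(2) by simp
      finally show "g i [^]\<^bsub>A\<^esub> e = system_eval A g (w i)"
        unfolding eval[OF gA i] .
    qed
    then have "g = a" by (rule a_unique)
    then show ?thesis using comp[OF u] by simp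
  qed
  have ex1: "\<psi> = \<psi>'" if
      "\<psi> \<in> hom G A \<inter> extensional (carrier G) \<and> (\<forall>x\<in>carrier P. \<psi> (\<alpha> x) = \<phi> x)"
      "\<psi>' \<in> hom G A \<inter> extensional (carrier G) \<and> (\<forall>x\<in>carrier P. \<psi>' (\<alpha> x) = \<phi> x)" for \<psi> \<psi>'
  proof (rule extensionalityI[of _ "carrier G"])
    fix g assume "g \<in> carrier G"
    then obtain u where "u \<in> carrier F" "g = \<epsilon> u" unfolding \<epsilon>(2)[symmetric] by (elim imageE)
    then show "\<psi> g = \<psi>' g" using unique[of \<psi> u] unique[of \<psi>' u] that by simp
  qed (use that in auto)

  obtain SP where SP: "finite SP" "SP \<subseteq> carrier P" "generate P SP = carrier P"
    using fin(1) unfolding finitely_generated_group_def by blast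
  define i where "i = (\<lambda>p. (\<alpha> p, \<phi> p))"
  define T where "T = i ` SP \<union> (\<lambda>j. (\<epsilon> (x j), a j)) ` {..<n}"
  have GA: "group (G \<times>\<times> A)" by (rule DirProd_group[OF G assms(1)])
  interpret GA: group "G \<times>\<times> A" by (rule GA)
  have TGA: "T \<subseteq> carrier (G \<times>\<times> A)"
    unfolding T_def i_def using SP(2) x aA by auto
  define E where "E = (G \<times>\<times> A)\<lparr>carrier := generate (G \<times>\<times> A) T\<rparr>"
  have sub: "subgroup (generate (G \<times>\<times> A) T) (G \<times>\<times> A)" by (rule GA.generate_is_subgroup[OF TGA])
  have E: "group E" unfolding E_def by (rule GA.subgroup_imp_group[OF sub])
  interpret E: group E by (rule E)
  have E_mult: "y \<otimes>\<^bsub>E\<^esub> z = (fst y \<otimes>\<^bsub>G\<^esub> fst z, snd y \<otimes>\<^bsub>A\<^esub> snd z)" for y z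
    by (simp add: E_def DirProd_def case_prod_beta)
  have E_sub: "y \<in> carrier E \<Longrightarrow> fst y \<in> carrier G \<and> snd y \<in> carrier A" for y
    using subgroup.subset[OF sub] unfolding E_def by (auto simp: DirProd_def)
  have TE: "T \<subseteq> carrier E" unfolding E_def by (simp add: generate.incl subsetI)
  have T_gen: "generate E T = carrier E"
    using GA.generate_consistent[OF _ sub, of T] TE unfolding E_def by simp
  have \<beta>: "fst \<in> hom E G" and \<gamma>: "snd \<in> hom E A"
    using E_sub by (auto intro!: homI simp: E_mult)
  interpret \<beta>: group_hom E G fst by (rule group_homI[OF E G \<beta>])
  interpret \<gamma>: group_hom E A snd by (rule group_homI[OF E assms(1) \<gamma>])
  have i_hom: "i \<in> hom P (G \<times>\<times> A)"
    by (rule homI) (auto simp: i_def)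
  have iE: "i y \<in> carrier E" if "y \<in> carrier P" for y
  proof -
    have "i y \<in> generate (G \<times>\<times> A) T"
    proof (rule generate_preimage[OF P GA i_hom sub SP(2)])
      show "y \<in> generate P SP" using that SP(3) by simp
      show "i z \<in> generate (G \<times>\<times> A) T" if "z \<in> SP" for z
        using that by (intro generate.incl) (simp add: T_def)
    qed
    then show ?thesis by (simp add: E_def)
  qed
  have i: "i \<in> hom P E"
    using iE by (rule homI) (simp_all add: E_mult i_def)
  interpret i: group_hom P E i by (rule group_homI[OF P E i])
  have tE: "(\<epsilon> (x j), a j) \<in> carrier E" if "j < n" for j
    using TE that unfolding T_def by auto
  have tE': "(\<lambda>j. (\<epsilon> (x j), a j)) \<in> {..<n} \<rightarrow> carrier E" using tE by auto
  define \<theta> where "\<theta> = free_group_lift E (\<lambda>j. (\<epsilon> (x j), a j))"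
  have \<theta>: "\<theta> \<in> hom F E" unfolding \<theta>_def F_def by (rule free_group_lift_hom[OF E tE'])
  interpret \<theta>: group_hom F E \<theta> by (rule group_homI[OF F E \<theta>])
  have \<theta>_gen: "\<theta> (x j) = (\<epsilon> (x j), a j)" if "j < n" for j
    unfolding \<theta>_def using free_group_lift_gen[OF E tE', of j] that by (simp add: x_def)
  have \<beta>\<theta>: "fst (\<theta> u) = \<epsilon> u" if "u \<in> carrier F" for u
  proof -
    have "(fst \<circ> \<theta>) u = \<epsilon> u"
    proof (rule free_group_hom_unique[OF G hom_compose[OF \<theta> \<beta>, unfolded F_def] \<epsilon>(1)[unfolded F_def] _ that[unfolded F_def]])
      fix j assume "j \<in> {..<n}"
      then show "(fst \<circ> \<theta>) (free_gen {..<n} j) = \<epsilon> (free_gen {..<n} j)"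
        unfolding x_def[symmetric] by (simp add: \<theta>_gen)
    qed
    then show ?thesis by simp
  qed
  have \<gamma>\<theta>: "snd (\<theta> u) = free_group_lift A a u" if "u \<in> carrier F" for u
  proof -
    have "(snd \<circ> \<theta>) u = free_group_lift A a u"
    proof (rule free_group_hom_unique[OF assms(1) hom_compose[OF \<theta> \<gamma>, unfolded F_def] lift[OF aA, unfolded F_def] _ that[unfolded F_def]])
      fix j assume "j \<in> {..<n}"
      then show "(snd \<circ> \<theta>) (free_gen {..<n} j) = free_group_lift A a (free_gen {..<n} j)"
        unfolding x_def[symmetric] by (simp add: \<theta>_gen lift_gen[OF aA])
    qed
    then show ?thesis by simp
  qed
  \<comment> \<open>The equations hold in \<open>E\<close> as well: in the first component by the
    choice of \<open>c\<close> and \<open>p\<close>, in the second because \<open>a\<close> is a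
    solution. This is what makes H_1(P; R) \<rightarrow> H_1(E; R) surjective.\<close>
  have t_power: "(\<epsilon> (x j), a j) [^]\<^bsub>E\<^esub> e = \<theta> (c j) \<otimes>\<^bsub>E\<^esub> i (p j)" if j: "j < n" for j
  proof (rule prod_eqI)
    show "fst ((\<epsilon> (x j), a j) [^]\<^bsub>E\<^esub> e) = fst (\<theta> (c j) \<otimes>\<^bsub>E\<^esub> i (p j))"
      unfolding \<beta>.hom_int_pow[OF tE[OF j]] using power[OF j] by (simp add: E_mult \<beta>\<theta>[OF cF[OF j]] i_def)
    show "snd ((\<epsilon> (x j), a j) [^]\<^bsub>E\<^esub> e) = snd (\<theta> (c j) \<otimes>\<^bsub>E\<^esub> i (p j))"
      unfolding \<gamma>.hom_int_pow[OF tE[OF j]] using a_power[OF j] by (simp add: E_mult \<gamma>\<theta>[OF cF[OF j]] i_def)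
  qed
  have surj_i: "H1_surj P E i"
  proof (rule H1_surj_generate[OF E i TE T_gen])
    fix t assume "t \<in> T"
    then consider y where "y \<in> SP" "t = i y" | j where "j < n" "t = (\<epsilon> (x j), a j)"
      unfolding T_def by blast
    then show "\<exists>y \<in> bar_chains R P 1. basis [t] - push i y \<in> bar_boundaries R E 1"
    proof cases
      case 1
      then show ?thesis
        using SP(2) zero_bar_boundaries by (intro bexI[of _ "basis [y]"] basis_bar_chains) auto
    next
      case 2
      have b1: "basis [t [^]\<^bsub>E\<^esub> e] - scale (of_int e) (basis [t]) \<in> bar_boundaries R E 1"
        unfolding 2(2) by (rule basis_int_pow[OF E tE[OF 2(1)]])
      have b2: "basis [\<theta> (c j)] \<in> bar_boundaries R E 1"
        by (rule basis_derived[OF E hom_derived[OF F E \<theta> c(1)[OF 2(1)]]])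
      have b3: "basis [\<theta> (c j)] + basis [i (p j)] - basis [t [^]\<^bsub>E\<^esub> e] \<in> bar_boundaries R E 1"
        unfolding 2(2) t_power[OF 2(1)]
        by (rule basis_mult_boundary[OF \<theta>.hom_closed[OF cF[OF 2(1)]] i.hom_closed[OF p(1)[OF 2(1)]]])
      \<comment> \<open>The combination telescopes to e [t] - [i(p j)]; the class of \<theta>(c j),
        a product of commutators, is itself a boundary. Division by \<open>e\<close> then exhibits
        [t] as coming from \<open>P\<close>.\<close>
      have "basis [\<theta> (c j)] - (basis [\<theta> (c j)] + basis [i (p j)] - basis [t [^]\<^bsub>E\<^esub> e]) -
          (basis [t [^]\<^bsub>E\<^esub> e] - scale (of_int e) (basis [t])) \<in> bar_boundaries R E 1"
        by (intro diff_bar_boundaries b1 b2 b3)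
      then have b4: "scale (of_int e) (basis [t]) - basis [i (p j)] \<in> bar_boundaries R E 1"
        by (simp add: algebra_simps)
      have e': "1 / of_int e \<in> R" "e \<noteq> 0" using e(1) by (simp_all add: denominators_iff)
      have "scale (1 / of_int e) (scale (of_int e) (basis [t]) - basis [i (p j)]) \<in> bar_boundaries R E 1"
        by (rule scale_bar_boundaries[OF e'(1) b4])
      then have "basis [t] - push i (Poly_Mapping.single [p j] (1 / of_int e)) \<in> bar_boundaries R E 1"
        using e'(2) by (simp add: scale_distrib)
      then show ?thesis
        using p(1)[OF 2(1)] e'(1) by (intro bexI[of _ "Poly_Mapping.single [p j] (1 / of_int e)"] single_bar_chains) auto
    qed
  qed
  have \<beta>i: "fst \<circ> i = \<alpha>" by (auto simp: i_def)
  have \<beta>\<theta>_surj: "(fst \<circ> \<theta>) ` carrier F = carrier G"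
    unfolding \<epsilon>(2)[symmetric] by (rule image_cong) (simp_all add: \<beta>\<theta>)
  have \<beta>_surj: "fst ` carrier E = carrier G"
  proof
    show "fst ` carrier E \<subseteq> carrier G" by (intro image_subsetI \<beta>.hom_closed)
    show "carrier G \<subseteq> fst ` carrier E"
      unfolding \<beta>\<theta>_surj[symmetric] image_comp[symmetric] by (intro image_mono image_subsetI \<theta>.hom_closed)
  qed
  have "kernel F G (fst \<circ> \<theta>) = kernel F G \<epsilon>"
    unfolding kernel_def o_apply using \<beta>\<theta> by (metis (no_types, lifting))
  then have ker': "kernel F G (fst \<circ> \<theta>) = normal_closure F S" using ker by simp
  have "finite T" unfolding T_def using SP(1) by simp
  obtain U where U: "finite U" "U \<subseteq> carrier E" "kernel E G fst = normal_closure E U"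
    using kernel_normally_finite[OF F E G \<theta> \<beta> S ker' \<beta>\<theta>_surj \<open>finite T\<close> TE T_gen] by blast
  have H_i: "H1_inj P G (fst \<circ> i)" "H2_surj P G (fst \<circ> i)" unfolding \<beta>i by (rule H)+
  have torsion: "\<exists>e \<in> denominators R. k [^]\<^bsub>E\<^esub> e \<in> relative_commutator E (kernel E G fst)" if "k \<in> U" for k
    using that normal_closure_superset[of U E]
    by (intro kernel_torsion_mod_commutators[OF P G E i \<beta> \<beta>_surj surj_i H_i]) (auto simp: U(3))
  \<comment> \<open>An element (1, b) of \<open>E\<close> has b = 1, so \<open>E\<close> is the
    graph of a function on \<open>G\<close>; this function is the extension.\<close>
  have kills: "snd k = \<one>\<^bsub>A\<^esub>" if "k \<in> kernel E G fst" for k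
    by (rule R_closed_kills[OF assms(1,2) E \<gamma> U torsion that])
  have "\<exists>\<psi> \<in> hom G A. \<forall>y \<in> carrier E. \<psi> (fst y) = snd y"
    by (rule hom_factor[OF E G assms(1) \<beta> \<gamma> \<beta>_surj]) (rule kills, simp add: kernel_def)
  then obtain \<psi> where \<psi>: "\<psi> \<in> hom G A" "\<And>y. y \<in> carrier E \<Longrightarrow> \<psi> (fst y) = snd y" by blast
  have "restrict \<psi> (carrier G) \<in> hom G A"
    using \<psi>(1) by (auto simp: hom_def)
  moreover have "restrict \<psi> (carrier G) (\<alpha> y) = \<phi> y" if "y \<in> carrier P" for y
    using \<psi>(2)[OF iE[OF that]] that by (simp add: i_def)
  ultimately have "restrict \<psi> (carrier G) \<in> hom G A \<inter> extensional (carrier G) \<and>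
      (\<forall>y\<in>carrier P. restrict \<psi> (carrier G) (\<alpha> y) = \<phi> y)"
    by simp
  then show ?thesis using ex1 by blast
qed

section \<open>Extensions from cocycles\<close>

text \<open>The cocycle to be used, [g|h] modulo boundaries, is not normalised: [1|1] is not even a
  cycle. Hence the correction by f(1, 1) in the unit.\<close>

definition cocycle_extension ::
    "('m, 'k) monoid_scheme \<Rightarrow> ('g, 'l) monoid_scheme \<Rightarrow> ('g \<Rightarrow> 'g \<Rightarrow> 'm) \<Rightarrow> ('m \<times> 'g) monoid" where
  "cocycle_extension M G f =
    \<lparr>carrier = carrier M \<times> carrier G,
     monoid.mult = (\<lambda>x y. (fst x \<otimes>\<^bsub>M\<^esub> fst y \<otimes>\<^bsub>M\<^esub> f (snd x) (snd y), snd x \<otimes>\<^bsub>G\<^esub> snd y)),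
     one = (inv\<^bsub>M\<^esub> f \<one>\<^bsub>G\<^esub> \<one>\<^bsub>G\<^esub>, \<one>\<^bsub>G\<^esub>)\<rparr>"

locale cocycle = M: comm_group M + G: group G
  for M :: "('m, 'k) monoid_scheme" and G :: "('g, 'l) monoid_scheme" +
  fixes f :: "'g \<Rightarrow> 'g \<Rightarrow> 'm"
  assumes f_closed [simp]: "\<And>g h. g \<in> carrier G \<Longrightarrow> h \<in> carrier G \<Longrightarrow> f g h \<in> carrier M"
    and cocycle: "\<And>g h l. g \<in> carrier G \<Longrightarrow> h \<in> carrier G \<Longrightarrow> l \<in> carrier G \<Longrightarrow>
      f g h \<otimes>\<^bsub>M\<^esub> f (g \<otimes>\<^bsub>G\<^esub> h) l = f h l \<otimes>\<^bsub>M\<^esub> f g (h \<otimes>\<^bsub>G\<^esub> l)"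
begin

abbreviation ext :: "('m \<times> 'g) monoid" where
  "ext \<equiv> cocycle_extension M G f"

lemma ext_simps:
  "carrier ext = carrier M \<times> carrier G"
  "x \<otimes>\<^bsub>ext\<^esub> y = (fst x \<otimes>\<^bsub>M\<^esub> fst y \<otimes>\<^bsub>M\<^esub> f (snd x) (snd y), snd x \<otimes>\<^bsub>G\<^esub> snd y)"
  "\<one>\<^bsub>ext\<^esub> = (inv\<^bsub>M\<^esub> f \<one>\<^bsub>G\<^esub> \<one>\<^bsub>G\<^esub>, \<one>\<^bsub>G\<^esub>)"
  by (simp_all add: cocycle_extension_def)

text \<open>The cocycle identity at (1, 1, g), and at (g, 1, 1) for the next lemma; a common factor
  cancels.\<close>

lemma f_one_left: "g \<in> carrier G \<Longrightarrow> f \<one>\<^bsub>G\<^esub> g = f \<one>\<^bsub>G\<^esub> \<one>\<^bsub>G\<^esub>"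
  using cocycle[of "\<one>\<^bsub>G\<^esub>" "\<one>\<^bsub>G\<^esub>" g] M.r_cancel[of "f \<one>\<^bsub>G\<^esub> g" "f \<one>\<^bsub>G\<^esub> \<one>\<^bsub>G\<^esub>" "f \<one>\<^bsub>G\<^esub> g"] by simp

lemma f_one_right: "g \<in> carrier G \<Longrightarrow> f g \<one>\<^bsub>G\<^esub> = f \<one>\<^bsub>G\<^esub> \<one>\<^bsub>G\<^esub>"
  using cocycle[of g "\<one>\<^bsub>G\<^esub>" "\<one>\<^bsub>G\<^esub>"] M.r_cancel[of "f g \<one>\<^bsub>G\<^esub>" "f g \<one>\<^bsub>G\<^esub>" "f \<one>\<^bsub>G\<^esub> \<one>\<^bsub>G\<^esub>"] by simp

lemma group_ext: "group ext"
proof (rule groupI)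
  show "\<one>\<^bsub>ext\<^esub> \<in> carrier ext" by (simp add: ext_simps)
  show "x \<otimes>\<^bsub>ext\<^esub> y \<in> carrier ext" if "x \<in> carrier ext" "y \<in> carrier ext" for x y
    using that by (auto simp: ext_simps)
  show "x \<otimes>\<^bsub>ext\<^esub> y \<otimes>\<^bsub>ext\<^esub> z = x \<otimes>\<^bsub>ext\<^esub> (y \<otimes>\<^bsub>ext\<^esub> z)"
    if xyz: "x \<in> carrier ext" "y \<in> carrier ext" "z \<in> carrier ext" for x y z
  proof -
    obtain a b c g h l where *: "x = (a, g)" "y = (b, h)" "z = (c, l)" by (cases x, cases y, cases z)
    then have c: "a \<in> carrier M" "b \<in> carrier M" "c \<in> carrier M" "g \<in> carrier G" "h \<in> carrier G" "l \<in> carrier G"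
      using xyz by (auto simp: ext_simps)
    have "a \<otimes>\<^bsub>M\<^esub> b \<otimes>\<^bsub>M\<^esub> f g h \<otimes>\<^bsub>M\<^esub> c \<otimes>\<^bsub>M\<^esub> f (g \<otimes>\<^bsub>G\<^esub> h) l =
        (a \<otimes>\<^bsub>M\<^esub> b \<otimes>\<^bsub>M\<^esub> c) \<otimes>\<^bsub>M\<^esub> (f g h \<otimes>\<^bsub>M\<^esub> f (g \<otimes>\<^bsub>G\<^esub> h) l)"
      using c by (simp add: M.m_ac)
    also have "\<dots> = (a \<otimes>\<^bsub>M\<^esub> b \<otimes>\<^bsub>M\<^esub> c) \<otimes>\<^bsub>M\<^esub> (f h l \<otimes>\<^bsub>M\<^esub> f g (h \<otimes>\<^bsub>G\<^esub> l))"
      by (simp only: cocycle[OF c(4-6)])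
    also have "\<dots> = a \<otimes>\<^bsub>M\<^esub> (b \<otimes>\<^bsub>M\<^esub> c \<otimes>\<^bsub>M\<^esub> f h l) \<otimes>\<^bsub>M\<^esub> f g (h \<otimes>\<^bsub>G\<^esub> l)"
      using c by (simp add: M.m_ac)
    finally show ?thesis
      using c by (simp add: * ext_simps G.m_assoc)
  qed
  show "\<one>\<^bsub>ext\<^esub> \<otimes>\<^bsub>ext\<^esub> x = x" if "x \<in> carrier ext" for x
  proof -
    obtain a g where "x = (a, g)" by (cases x)
    with that have c: "a \<in> carrier M" "g \<in> carrier G" "x = (a, g)" by (auto simp: ext_simps)
    have "inv\<^bsub>M\<^esub> f \<one>\<^bsub>G\<^esub> \<one>\<^bsub>G\<^esub> \<otimes>\<^bsub>M\<^esub> a \<otimes>\<^bsub>M\<^esub> f \<one>\<^bsub>G\<^esub> \<one>\<^bsub>G\<^esub> = a \<otimes>\<^bsub>M\<^esub> (inv\<^bsub>M\<^esub> f \<one>\<^bsub>G\<^esub> \<one>\<^bsub>G\<^esub> \<otimes>\<^bsub>M\<^esub> f \<one>\<^bsub>G\<^esub> \<one>\<^bsub>G\<^esub>)"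
      using c M.m_comm[of "inv\<^bsub>M\<^esub> f \<one>\<^bsub>G\<^esub> \<one>\<^bsub>G\<^esub>" a] by (simp only: M.m_assoc f_closed G.one_closed M.inv_closed)
    also have "\<dots> = a" using c(1) by simp
    finally show ?thesis
      by (simp only: ext_simps c(3) fst_conv snd_conv f_one_left[OF c(2)] G.l_one[OF c(2)])
  qed
  show "\<exists>y\<in>carrier ext. y \<otimes>\<^bsub>ext\<^esub> x = \<one>\<^bsub>ext\<^esub>" if "x \<in> carrier ext" for x
  proof -
    obtain a g where "x = (a, g)" by (cases x)
    with that have c: "a \<in> carrier M" "g \<in> carrier G" "x = (a, g)" by (auto simp: ext_simps)
    let ?t = "a \<otimes>\<^bsub>M\<^esub> f (inv\<^bsub>G\<^esub> g) g"
    have t: "?t \<in> carrier M" using c by simp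
    have "inv\<^bsub>M\<^esub> f \<one>\<^bsub>G\<^esub> \<one>\<^bsub>G\<^esub> \<otimes>\<^bsub>M\<^esub> inv\<^bsub>M\<^esub> ?t \<otimes>\<^bsub>M\<^esub> a \<otimes>\<^bsub>M\<^esub> f (inv\<^bsub>G\<^esub> g) g =
        inv\<^bsub>M\<^esub> f \<one>\<^bsub>G\<^esub> \<one>\<^bsub>G\<^esub> \<otimes>\<^bsub>M\<^esub> (inv\<^bsub>M\<^esub> ?t \<otimes>\<^bsub>M\<^esub> ?t)"
      using c M.inv_closed[OF t] by (simp only: M.m_assoc M.m_closed M.inv_closed f_closed G.one_closed G.inv_closed)
    also have "\<dots> = inv\<^bsub>M\<^esub> f \<one>\<^bsub>G\<^esub> \<one>\<^bsub>G\<^esub>"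
      using M.l_inv[OF t] by (simp only: M.r_one M.inv_closed f_closed G.one_closed)
    finally show ?thesis
      using c t by (intro bexI[of _ "(inv\<^bsub>M\<^esub> f \<one>\<^bsub>G\<^esub> \<one>\<^bsub>G\<^esub> \<otimes>\<^bsub>M\<^esub> inv\<^bsub>M\<^esub> ?t, inv\<^bsub>G\<^esub> g)"]) (simp_all add: ext_simps)
  qed
qed

lemma snd_hom: "snd \<in> hom ext G"
  by (rule homI) (auto simp: ext_simps)

text \<open>The shift is needed because the cocycle is not assumed to be normalised.\<close>

definition central_embedding :: "'m \<Rightarrow> 'm \<times> 'g" where
  "central_embedding a = (a \<otimes>\<^bsub>M\<^esub> inv\<^bsub>M\<^esub> f \<one>\<^bsub>G\<^esub> \<one>\<^bsub>G\<^esub>, \<one>\<^bsub>G\<^esub>)"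

lemma central_embedding_hom: "central_embedding \<in> hom M ext"
proof (rule homI)
  show "central_embedding a \<in> carrier ext" if "a \<in> carrier M" for a
    using that by (simp add: central_embedding_def ext_simps)
  show "central_embedding (a \<otimes>\<^bsub>M\<^esub> b) = central_embedding a \<otimes>\<^bsub>ext\<^esub> central_embedding b"
    if ab: "a \<in> carrier M" "b \<in> carrier M" for a b
  proof -
    let ?c = "f \<one>\<^bsub>G\<^esub> \<one>\<^bsub>G\<^esub>"
    have c: "?c \<in> carrier M" by simp
    have "a \<otimes>\<^bsub>M\<^esub> inv\<^bsub>M\<^esub> ?c \<otimes>\<^bsub>M\<^esub> (b \<otimes>\<^bsub>M\<^esub> inv\<^bsub>M\<^esub> ?c) \<otimes>\<^bsub>M\<^esub> ?c = a \<otimes>\<^bsub>M\<^esub> inv\<^bsub>M\<^esub> ?c \<otimes>\<^bsub>M\<^esub> b"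
      using ab c by (simp add: M.m_assoc)
    also have "\<dots> = a \<otimes>\<^bsub>M\<^esub> b \<otimes>\<^bsub>M\<^esub> inv\<^bsub>M\<^esub> ?c"
      using ab c by (simp add: M.m_ac)
    finally show ?thesis
      by (simp add: central_embedding_def ext_simps)
  qed
qed

lemma central_embedding_commute:
  assumes "a \<in> carrier M" "x \<in> carrier ext"
  shows "central_embedding a \<otimes>\<^bsub>ext\<^esub> x = x \<otimes>\<^bsub>ext\<^esub> central_embedding a"
proof -
  obtain b g where "x = (b, g)" by (cases x)
  with assms(2) have c: "b \<in> carrier M" "g \<in> carrier G" "x = (b, g)" by (auto simp: ext_simps)
  have "a \<otimes>\<^bsub>M\<^esub> inv\<^bsub>M\<^esub> f \<one>\<^bsub>G\<^esub> \<one>\<^bsub>G\<^esub> \<in> carrier M"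
    using assms(1) by simp
  from M.m_comm[OF this c(1)] show ?thesis
    by (simp only: central_embedding_def ext_simps f_one_left[OF c(2)] f_one_right[OF c(2)] c(3) fst_conv snd_conv
        G.l_one[OF c(2)] G.r_one[OF c(2)])
qed

lemma central_embedding_image:
  "x \<in> carrier ext \<Longrightarrow> snd x = \<one>\<^bsub>G\<^esub> \<Longrightarrow> x \<in> central_embedding ` carrier M"
  by (rule image_eqI[of _ _ "fst x \<otimes>\<^bsub>M\<^esub> f \<one>\<^bsub>G\<^esub> \<one>\<^bsub>G\<^esub>"])
    (auto simp: central_embedding_def ext_simps M.m_assoc)

lemma snd_central_embedding: "snd (central_embedding a) = \<one>\<^bsub>G\<^esub>"
  by (simp add: central_embedding_def)

end

section \<open>The group presented by a system of equations\<close>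

text \<open>
  The generators \<open>0, \<dots>, m - 1\<close> of the free group stand for coefficients and \<open>m, \<dots>, m + n - 1\<close> for
  the unknowns of the system.
\<close>

locale system_presentation =
  fixes m n :: nat and e :: int and v :: "nat \<Rightarrow> (nat \<times> bool) list set"
  assumes v_closed: "\<And>k. k < n \<Longrightarrow> v k \<in> carrier (free_group {..<m + n})"
    and v_null: "\<And>k. k < n \<Longrightarrow>
      free_group_lift (free_group {..<n})
        (\<lambda>j. if j < m then \<one>\<^bsub>free_group {..<n}\<^esub> else free_gen {..<n} (j - m)) (v k)
      \<in> derived (free_group {..<n}) (carrier (free_group {..<n}))"
begin

definition F :: "(nat \<times> bool) list set monoid" where
  "F = free_group {..<m + n}"

definition gen :: "nat \<Rightarrow> (nat \<times> bool) list set" where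
  "gen = free_gen {..<m + n}"

definition relator :: "nat \<Rightarrow> (nat \<times> bool) list set" where
  "relator k = gen (m + k) [^]\<^bsub>F\<^esub> e \<otimes>\<^bsub>F\<^esub> inv\<^bsub>F\<^esub> v k"

sublocale F: group F
  unfolding F_def by (rule group_free_group)

lemma gen_closed: "j < m + n \<Longrightarrow> gen j \<in> carrier F"
  unfolding gen_def F_def by (rule free_gen_closed) simp

lemma relator_closed: "k < n \<Longrightarrow> relator k \<in> carrier F"
  using gen_closed v_closed by (simp add: relator_def F_def[symmetric])

lemma
  assumes "group M" "\<And>j. j < m + n \<Longrightarrow> t j \<in> carrier M"
  shows lift_hom: "free_group_lift M t \<in> hom F M"
    and lift_gen: "j < m + n \<Longrightarrow> free_group_lift M t (gen j) = t j"
  using free_group_lift_hom[OF assms(1), of t "{..<m + n}"] free_group_lift_gen[OF assms(1), of t "{..<m + n}" j] assms(2)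
  unfolding F_def gen_def by auto

lemma hom_eq:
  assumes "group M" "f \<in> hom F M" "h \<in> hom F M" "\<And>j. j < m + n \<Longrightarrow> f (gen j) = h (gen j)" "u \<in> carrier F"
  shows "f u = h u"
  using free_group_hom_unique[OF assms(1) assms(2)[unfolded F_def] assms(3)[unfolded F_def]] assms(4,5)
  unfolding F_def gen_def by simp

lemma hom_relator:
  assumes "group M" "f \<in> hom F M" "k < n"
  shows "f (relator k) = f (gen (m + k)) [^]\<^bsub>M\<^esub> e \<otimes>\<^bsub>M\<^esub> inv\<^bsub>M\<^esub> f (v k)"
proof -
  interpret f: group_hom F M f by (rule group_homI[OF F.is_group assms(1,2)])
  show ?thesis
    using gen_closed[of "m + k"] v_closed[OF assms(3)] assms(3)
    by (simp add: relator_def F_def[symmetric] f.hom_int_pow)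
qed

lemma hom_relator_one_iff:
  assumes "group M" "f \<in> hom F M" "k < n"
  shows "f (relator k) = \<one>\<^bsub>M\<^esub> \<longleftrightarrow> f (gen (m + k)) [^]\<^bsub>M\<^esub> e = f (v k)"
proof -
  interpret f: group_hom F M f by (rule group_homI[OF F.is_group assms(1,2)])
  have c: "f (gen (m + k)) \<in> carrier M" "f (v k) \<in> carrier M"
    using gen_closed[of "m + k"] v_closed[OF assms(3)] assms(3) by (simp_all add: F_def[symmetric])
  show ?thesis
    unfolding hom_relator[OF assms]
    using f.H.inv_solve_right'[of "\<one>\<^bsub>M\<^esub>" "f (gen (m + k)) [^]\<^bsub>M\<^esub> e" "f (v k)"] c by simp
qed

text \<open>A homomorphism that kills the coefficients factors through the free group on the
  unknowns alone. There \<open>v k\<close> becomes an element of the derived subgroup, which a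
  commutative target kills.\<close>

lemma kill_v:
  assumes "comm_group M" and f: "f \<in> hom F M" and kill: "\<And>j. j < m \<Longrightarrow> f (gen j) = \<one>\<^bsub>M\<^esub>" and k: "k < n"
  shows "f (v k) = \<one>\<^bsub>M\<^esub>"
proof -
  interpret M: comm_group M by fact
  let ?\<pi> = "free_group_lift (free_group {..<n})
    (\<lambda>j. if j < m then \<one>\<^bsub>free_group {..<n}\<^esub> else free_gen {..<n} (j - m))"
  let ?g = "free_group_lift M (\<lambda>k. f (gen (m + k)))"
  have Fn: "group (free_group {..<n})" by (rule group_free_group)
  have c: "(if j < m then \<one>\<^bsub>free_group {..<n}\<^esub> else free_gen {..<n} (j - m)) \<in> carrier (free_group {..<n})"
    if "j < m + n" for j
    using that group.is_monoid[OF Fn] by (auto intro: free_gen_closed monoid.one_closed)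
  have \<pi>: "?\<pi> \<in> hom F (free_group {..<n})" by (rule lift_hom[OF Fn c])
  have gc: "(\<lambda>k. f (gen (m + k))) \<in> {..<n} \<rightarrow> carrier M"
    using hom_in_carrier[OF f gen_closed] by auto
  have g: "?g \<in> hom (free_group {..<n}) M" by (rule free_group_lift_hom[OF M.is_group gc])
  have "f (v k) = (?g \<circ> ?\<pi>) (v k)"
  proof (rule hom_eq[OF M.is_group f hom_compose[OF \<pi> g]])
    show "v k \<in> carrier F" using v_closed[OF k] by (simp add: F_def)
    fix j assume j: "j < m + n"
    have "?g \<one>\<^bsub>free_group {..<n}\<^esub> = \<one>\<^bsub>M\<^esub>"
      by (rule hom_one[OF g Fn M.is_group])
    moreover have "?g (free_gen {..<n} (j - m)) = f (gen j)" if "\<not> j < m"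
      using free_group_lift_gen[OF M.is_group gc, of "j - m"] that j by simp
    ultimately show "f (gen j) = (?g \<circ> ?\<pi>) (gen j)"
      using lift_gen[OF Fn c j] kill[of j] by simp
  qed
  also have "\<dots> = \<one>\<^bsub>M\<^esub>"
    using hom_comm_derived[OF Fn assms(1) g v_null[OF k]] by simp
  finally show ?thesis .
qed

text \<open>
  Multiplying the images of the unknowns by central elements \<open>l\<close> multiplies the images of the
  relators by \<open>l\<^sup>e\<close> only, since the right-hand sides are nullhomologous in the unknowns.
\<close>

lemma solve_relators:
  assumes "group E" and C: "subgroup C E"
    and central: "\<And>c x. c \<in> C \<Longrightarrow> x \<in> carrier E \<Longrightarrow> c \<otimes>\<^bsub>E\<^esub> x = x \<otimes>\<^bsub>E\<^esub> c"
    and root: "\<And>c. c \<in> C \<Longrightarrow> \<exists>d \<in> C. d [^]\<^bsub>E\<^esub> e = c"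
    and \<tau>: "\<tau> \<in> hom F E" and \<tau>C: "\<And>k. k < n \<Longrightarrow> \<tau> (relator k) \<in> C"
  shows "\<exists>\<sigma> \<in> hom F E. (\<forall>k<n. \<sigma> (relator k) = \<one>\<^bsub>E\<^esub>) \<and> (\<forall>j<m. \<sigma> (gen j) = \<tau> (gen j)) \<and>
    (\<forall>u \<in> carrier F. \<exists>c \<in> C. \<sigma> u = \<tau> u \<otimes>\<^bsub>E\<^esub> c)"
proof -
  interpret E: group E by fact
  interpret C: subgroup C E by fact
  interpret \<tau>: group_hom F E \<tau> by (rule group_homI[OF F.is_group assms(1) \<tau>])
  have "\<exists>d. d \<in> C \<and> d [^]\<^bsub>E\<^esub> e = \<tau> (relator k)" if "k < n" for k
    using root[OF \<tau>C[OF that]] by blast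
  then obtain d where d: "\<And>k. k < n \<Longrightarrow> d k \<in> C" "\<And>k. k < n \<Longrightarrow> d k [^]\<^bsub>E\<^esub> e = \<tau> (relator k)"
    by metis
  \<comment> \<open>The central subgroup as a commutative group of its own, so that
    \<open>kill_v\<close> applies to the correction \<open>l\<close>.\<close>
  define M where "M = E\<lparr>carrier := C\<rparr>"
  have "group M" unfolding M_def by (rule E.subgroup_imp_group[OF C])
  then interpret M: comm_group M
    by (rule group.group_comm_groupI) (use central C.mem_carrier in \<open>auto simp: M_def\<close>)
  have inM: "x \<in> carrier M \<longleftrightarrow> x \<in> C" for x by (simp add: M_def)
  \<comment> \<open>The correction is trivial on the coefficients and, on each unknown, the inverse
    of an \<open>e\<close>-th root of the value of the relator. By \<open>l_v\<close> it does not
    affect the right-hand sides, so it cancels that value exactly.\<close>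
  define t where "t = (\<lambda>j. if j < m then \<one>\<^bsub>E\<^esub> else inv\<^bsub>E\<^esub> d (j - m))"
  have t: "t j \<in> carrier M" if "j < m + n" for j
    using that d(1)[of "j - m"] by (auto simp: t_def inM C.m_inv_closed)
  define l where "l = free_group_lift M t"
  have l: "l \<in> hom F M" unfolding l_def by (rule lift_hom[OF M.is_group t])
  have lC: "l u \<in> C" if "u \<in> carrier F" for u
    using hom_in_carrier[OF l that] by (simp add: inM)
  have l_gen: "l (gen j) = t j" if "j < m + n" for j
    unfolding l_def by (rule lift_gen[OF M.is_group t that])
  have lE: "l \<in> hom F E"
    by (rule homI) (use lC C.mem_carrier hom_mult[OF l] in \<open>auto simp: M_def\<close>)
  have l_v: "l (v k) = \<one>\<^bsub>E\<^esub>" if "k < n" for k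
    using kill_v[OF M.comm_group_axioms l _ that] l_gen by (simp add: t_def M_def)
  have l_relator: "l (relator k) = inv\<^bsub>E\<^esub> \<tau> (relator k)" if k: "k < n" for k
    using C.mem_carrier[OF d(1)[OF k]] k \<tau>.hom_closed[OF relator_closed[OF k]]
    by (simp add: hom_relator[OF assms(1) lE k] l_v l_gen t_def E.int_pow_inv d(2))
  define \<sigma> where "\<sigma> = (\<lambda>u. \<tau> u \<otimes>\<^bsub>E\<^esub> l u)"
  have \<sigma>: "\<sigma> \<in> hom F E"
  proof (rule homI)
    show "\<sigma> u \<in> carrier E" if "u \<in> carrier F" for u
      using that C.mem_carrier[OF lC[OF that]] by (simp add: \<sigma>_def)
    show "\<sigma> (u \<otimes>\<^bsub>F\<^esub> w) = \<sigma> u \<otimes>\<^bsub>E\<^esub> \<sigma> w" if u: "u \<in> carrier F" "w \<in> carrier F" for u w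
    proof -
      have c: "\<tau> u \<in> carrier E" "\<tau> w \<in> carrier E" "l u \<in> carrier E" "l w \<in> carrier E"
        using u C.mem_carrier lC by auto
      have "\<sigma> (u \<otimes>\<^bsub>F\<^esub> w) = \<tau> u \<otimes>\<^bsub>E\<^esub> (\<tau> w \<otimes>\<^bsub>E\<^esub> l u) \<otimes>\<^bsub>E\<^esub> l w"
        using u c by (simp add: \<sigma>_def hom_mult[OF lE] E.m_assoc)
      also have "\<tau> w \<otimes>\<^bsub>E\<^esub> l u = l u \<otimes>\<^bsub>E\<^esub> \<tau> w"
        using central[OF lC[OF u(1)] c(2)] by simp
      finally show ?thesis using c by (simp add: \<sigma>_def E.m_assoc)
    qed
  qed
  show ?thesis
  proof (intro bexI[OF _ \<sigma>] conjI allI impI ballI)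
    show "\<sigma> (relator k) = \<one>\<^bsub>E\<^esub>" if "k < n" for k
      using that relator_closed[OF that] by (simp add: \<sigma>_def l_relator)
    show "\<sigma> (gen j) = \<tau> (gen j)" if "j < m" for j
      using that gen_closed[of j] by (simp add: \<sigma>_def l_gen t_def)
    show "\<exists>c \<in> C. \<sigma> u = \<tau> u \<otimes>\<^bsub>E\<^esub> c" if "u \<in> carrier F" for u
      using lC[OF that] unfolding \<sigma>_def by blast
  qed
qed

end

text \<open>\<open>G\<close> is given by a surjection \<open>q\<close> with the right kernel and not
  as a factor group of \<open>F\<close>, since it will live on a prescribed type. The elements
  \<open>y\<close> of \<open>P\<close> correspond to the coefficients.\<close>

locale presented_extension = system_presentation m n e v + rat_subring R + P: group P + G: group G
  for m n e v R and P :: "('p, 'k) monoid_scheme" and G :: "('g, 'l) monoid_scheme" +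
  fixes q :: "(nat \<times> bool) list set \<Rightarrow> 'g" and \<alpha> :: "'p \<Rightarrow> 'g" and y :: "nat \<Rightarrow> 'p"
  assumes e: "e \<in> denominators R"
    and q: "q \<in> hom F G" and q_surj: "q ` carrier F = carrier G"
    and q_kernel: "kernel F G q = normal_closure F (relator ` {..<n})"
    and \<alpha>: "\<alpha> \<in> hom P G"
    and y_closed: "\<And>j. j < m \<Longrightarrow> y j \<in> carrier P"
    and y_generate: "generate P (y ` {..<m}) = carrier P"
    and \<alpha>_y: "\<And>j. j < m \<Longrightarrow> \<alpha> (y j) = q (gen j)"
begin

sublocale q: group_hom F G q
  by (rule group_homI[OF F.is_group G.is_group q])

lemma e_inverse: "e \<noteq> 0" "1 / of_int e \<in> R"
  using e by (simp_all add: denominators_iff)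

lemma q_relator: "k < n \<Longrightarrow> q (relator k) = \<one>\<^bsub>G\<^esub>"
  using normal_closure_superset[of "relator ` {..<n}" F] unfolding q_kernel[symmetric] kernel_def by auto

lemma descend:
  assumes "group M" "\<sigma> \<in> hom F M" "\<And>k. k < n \<Longrightarrow> \<sigma> (relator k) = \<one>\<^bsub>M\<^esub>"
  shows "\<exists>\<kappa> \<in> hom G M. \<forall>u \<in> carrier F. \<kappa> (q u) = \<sigma> u"
proof (rule hom_factor[OF F.is_group G.is_group assms(1) q assms(2) q_surj])
  fix u assume "u \<in> carrier F" "q u = \<one>\<^bsub>G\<^esub>"
  then have "u \<in> normal_closure F (relator ` {..<n})"
    unfolding q_kernel[symmetric] kernel_def by blast
  then show "\<sigma> u = \<one>\<^bsub>M\<^esub>"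
    using relator_closed assms(3) by (intro hom_normal_closure_trivial[OF F.is_group assms(1,2)]) auto
qed

text \<open>In the cokernel of H_1(\<alpha>; R) the coefficients vanish, hence by
  \<open>kill_v\<close> the right-hand sides as well. The equations then say that \<open>e\<close>
  times each unknown vanishes, and \<open>e\<close> is invertible in \<open>R\<close>.\<close>

lemma H1_surj_\<alpha>: "H1_surj P G \<alpha>"
proof -
  define V where "V = H1_image P G \<alpha>"
  note boundary = boundary_H1_image[OF G.is_monoid, where P = P and \<alpha> = \<alpha>, folded V_def]
    and add = add_H1_image[where P = P and G = G and \<alpha> = \<alpha>, folded V_def]
    and scale = scale_H1_image[where P = P and G = G and \<alpha> = \<alpha>, folded V_def]
    and neg = uminus_H1_image[where P = P and G = G and \<alpha> = \<alpha>, folded V_def]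
  have V: "additive_subset V"
    unfolding additive_subset_def using boundary[OF zero_bar_boundaries] add neg by blast
  interpret V: additive_quotient "bar_chains R G 1" V
    by (intro additive_quotient.intro additive_bar_chains V) (auto simp: V_def H1_image_def)
  let ?M = "additive_group (bar_chains R G 1) Mod V"
  have M: "comm_group ?M" by (rule V.comm_group_quotient)
  have b: "basis [g] \<in> bar_chains R G 1" if "g \<in> carrier G" for g
    using that by (intro basis_bar_chains) auto
  have "(\<lambda>g. V.coset (basis [g])) \<in> hom G ?M"
  proof (rule homI)
    fix g h assume gh: "g \<in> carrier G" "h \<in> carrier G"
    have "basis [g \<otimes>\<^bsub>G\<^esub> h] - (basis [g] + basis [h]) \<in> V"
      using neg[OF boundary[OF basis_mult_boundary[OF gh]]] by (simp only: minus_diff_eq)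
    then show "V.coset (basis [g \<otimes>\<^bsub>G\<^esub> h]) = V.coset (basis [g]) \<otimes>\<^bsub>?M\<^esub> V.coset (basis [h])"
      unfolding V.coset_mult[OF b[OF gh(1)] b[OF gh(2)]] V.coset_eq_iff .
  qed (rule V.coset_closed[OF b])
  from hom_compose[OF q this]
  have f: "(\<lambda>g. V.coset (basis [g])) \<circ> q \<in> hom F ?M" .
  have y_V: "basis [q (gen j)] \<in> V" if "j < m" for j
    using that q.hom_closed[OF gen_closed[of j]] y_closed[OF that] \<alpha>_y[OF that] zero_bar_boundaries unfolding V_def H1_image_def
    by (intro CollectI conjI bexI[of _ "basis [y j]"] basis_bar_chains) auto
  have "((\<lambda>g. V.coset (basis [g])) \<circ> q) (v k) = \<one>\<^bsub>?M\<^esub>" if "k < n" for k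
  proof (rule kill_v[OF M f _ that])
    fix j assume "j < m"
    then show "((\<lambda>g. V.coset (basis [g])) \<circ> q) (gen j) = \<one>\<^bsub>?M\<^esub>"
      using y_V unfolding V.one_quotient o_apply V.coset_eq_iff by simp
  qed
  then have v_V: "basis [q (v k)] \<in> V" if "k < n" for k
    using that unfolding V.one_quotient o_apply V.coset_eq_iff by simp
  have x_V: "basis [q (gen (m + k))] \<in> V" if k: "k < n" for k
  proof -
    have g: "q (gen (m + k)) \<in> carrier G" using gen_closed[of "m + k"] k by simp
    have "q (gen (m + k)) [^]\<^bsub>G\<^esub> e = q (v k)"
      using q_relator[OF k] hom_relator_one_iff[OF G.is_group q k] by simp
    then have "basis [q (v k)] - (basis [q (gen (m + k)) [^]\<^bsub>G\<^esub> e] - scale (of_int e) (basis [q (gen (m + k))])) \<in> V"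
      using add[OF v_V[OF k] neg[OF boundary[OF basis_int_pow[OF G.is_group g, of e]]]] by (simp only: diff_conv_add_uminus)
    then have "scale (of_int e) (basis [q (gen (m + k))]) \<in> V"
      using \<open>q (gen (m + k)) [^]\<^bsub>G\<^esub> e = q (v k)\<close> by simp
    from scale[OF e_inverse(2) this] show ?thesis using e_inverse(1) by simp
  qed
  have gen_V: "basis [q (gen j)] \<in> V" if "j < m + n" for j
    using y_V[of j] x_V[of "j - m"] that by (cases "j < m") auto
  have q_gen: "(\<lambda>j. q (gen j)) ` {..<m + n} \<subseteq> carrier G"
    using gen_closed by auto
  show ?thesis
  proof (rule H1_surj_generate[OF G.is_group \<alpha> q_gen])
    show "generate G ((\<lambda>j. q (gen j)) ` {..<m + n}) = carrier G"
    proof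
      show "generate G ((\<lambda>j. q (gen j)) ` {..<m + n}) \<subseteq> carrier G" by (rule G.generate_incl[OF q_gen])
      have "q u \<in> generate G ((\<lambda>j. q (gen j)) ` {..<m + n})" if "u \<in> carrier F" for u
      proof (rule generate_preimage[OF F.is_group G.is_group q G.generate_is_subgroup[OF q_gen]])
        show "u \<in> generate F (gen ` {..<m + n})"
          using that unfolding F_def gen_def free_group_generated[symmetric] .
      qed (use gen_closed in \<open>auto intro: generate.incl\<close>)
      then show "carrier G \<subseteq> generate G ((\<lambda>j. q (gen j)) ` {..<m + n})"
        unfolding q_surj[symmetric] by (rule image_subsetI)
    qed
    fix g assume "g \<in> (\<lambda>j. q (gen j)) ` {..<m + n}"
    then have "basis [g] \<in> V" using gen_V by auto
    then show "\<exists>y \<in> bar_chains R P 1. basis [g] - push \<alpha> y \<in> bar_boundaries R G 1"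
      unfolding V_def H1_image_def by blast
  qed
qed

text \<open>Chains modulo boundaries form an \<open>R\<close>-module, and 1/e lies in
  \<open>R\<close>. This supplies the hypothesis \<open>root\<close> of
  \<open>solve_relators\<close>.\<close>

lemma coset_root:
  assumes "additive_quotient (bar_chains R H k) (bar_boundaries R H k)"
    and "c \<in> carrier (additive_group (bar_chains R H k) Mod bar_boundaries R H k)"
  shows "\<exists>d \<in> carrier (additive_group (bar_chains R H k) Mod bar_boundaries R H k).
    d [^]\<^bsub>additive_group (bar_chains R H k) Mod bar_boundaries R H k\<^esub> e = c"
proof -
  interpret C: additive_quotient "bar_chains R H k" "bar_boundaries R H k" by fact
  obtain z where z: "z \<in> bar_chains R H k" "c = C.coset z"
    using assms(2) unfolding C.carrier_quotient by (elim imageE)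
  have s: "scale (1 / of_int e) z \<in> bar_chains R H k"
    by (rule scale_bar_chains[OF e_inverse(2) z(1)])
  have "C.coset (scale (1 / of_int e) z) [^]\<^bsub>additive_group (bar_chains R H k) Mod bar_boundaries R H k\<^esub> e = c"
    unfolding C.coset_int_pow[OF s] additive_int_pow[OF assms(1) s] z(2) using e_inverse(1) by simp
  with C.coset_closed[OF s] show ?thesis by (rule bexI[rotated])
qed

text \<open>The canonical map of \<open>P\<close> to H_1(P; R) extends along \<open>\<alpha>\<close>
  to \<open>G\<close>: send the unknowns to the unit, correct by \<open>solve_relators\<close> with
  the whole abelian group as central subgroup, and descend. The extension induces a left inverse of
  H_1(\<alpha>; R).\<close>

lemma H1_inj_\<alpha>: "H1_inj P G \<alpha>"
  unfolding H1_inj_def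
proof (intro ballI impI)
  fix z assume z: "z \<in> bar_chains R P 1" and pz: "push \<alpha> z \<in> bar_boundaries R G 1"
  note aq = additive_quotient_chains[OF P.is_monoid, of 1]
  interpret C: additive_quotient "bar_chains R P 1" "bar_boundaries R P 1" by (rule aq)
  let ?M = "additive_group (bar_chains R P 1) Mod bar_boundaries R P 1"
  interpret M: comm_group ?M by (rule C.comm_group_quotient)
  have ab: "(\<lambda>p. C.coset (basis [p])) \<in> hom P ?M"
    by (rule abelianization_hom[OF P.is_monoid])
  define t where "t = (\<lambda>j. if j < m then C.coset (basis [y j]) else \<one>\<^bsub>?M\<^esub>)"
  have t: "t j \<in> carrier ?M" for j
  proof (cases "j < m")
    case True
    then show ?thesis using hom_in_carrier[OF ab y_closed[OF True]] by (simp only: t_def if_True)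
  next
    case False
    then show ?thesis using M.one_closed by (simp only: t_def if_False)
  qed
  have \<tau>: "free_group_lift ?M t \<in> hom F ?M" by (rule lift_hom[OF M.is_group t])
  have "\<exists>\<sigma> \<in> hom F ?M. (\<forall>k<n. \<sigma> (relator k) = \<one>\<^bsub>?M\<^esub>) \<and>
      (\<forall>j<m. \<sigma> (gen j) = free_group_lift ?M t (gen j)) \<and>
      (\<forall>u \<in> carrier F. \<exists>c \<in> carrier ?M. \<sigma> u = free_group_lift ?M t u \<otimes>\<^bsub>?M\<^esub> c)"
    by (rule solve_relators[OF M.is_group M.subgroup_self M.m_comm coset_root[OF aq] \<tau> hom_in_carrier[OF \<tau> relator_closed]])
  then obtain \<sigma> where \<sigma>: "\<sigma> \<in> hom F ?M" "\<And>k. k < n \<Longrightarrow> \<sigma> (relator k) = \<one>\<^bsub>?M\<^esub>"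
    "\<And>j. j < m \<Longrightarrow> \<sigma> (gen j) = free_group_lift ?M t (gen j)" by blast
  obtain \<kappa> where \<kappa>: "\<kappa> \<in> hom G ?M" "\<And>u. u \<in> carrier F \<Longrightarrow> \<kappa> (q u) = \<sigma> u"
    using descend[OF M.is_group \<sigma>(1,2)] by blast
  have \<kappa>\<alpha>: "(\<kappa> \<circ> \<alpha>) p = C.coset (basis [p])" if "p \<in> carrier P" for p
  proof (rule hom_eq_on_generate[OF P.is_group M.is_group hom_compose[OF \<alpha> \<kappa>(1)] ab])
    show "p \<in> generate P (y ` {..<m})" using that y_generate by simp
    show "y ` {..<m} \<subseteq> carrier P" using y_closed by auto
    fix s assume "s \<in> y ` {..<m}"
    then obtain j where j: "j < m" "s = y j" by auto
    then show "(\<kappa> \<circ> \<alpha>) s = C.coset (basis [s])"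
      using \<kappa>(2)[OF gen_closed, of j] \<sigma>(3)[of j] lift_gen[OF M.is_group t, of j] \<alpha>_y[of j] by (simp add: t_def)
  qed
  \<comment> \<open>\<open>K\<close> chooses chains that represent the values of
    \<open>\<kappa>\<close>, and \<open>L\<close> extends it linearly to 1-chains. As
    \<open>\<kappa>\<close> is multiplicative, \<open>L\<close> takes boundaries to boundaries; as
    \<open>\<kappa> \<circ> \<alpha>\<close> is the canonical map, \<open>L\<close> after
    \<open>push \<alpha>\<close> is the identity modulo boundaries.\<close>
  have "\<exists>c. c \<in> bar_chains R P 1 \<and> \<kappa> g = C.coset c" if "g \<in> carrier G" for g
    using hom_in_carrier[OF \<kappa>(1) that] unfolding C.carrier_quotient by blast
  then obtain K where K: "\<And>g. g \<in> carrier G \<Longrightarrow> K g \<in> bar_chains R P 1" "\<And>g. g \<in> carrier G \<Longrightarrow> \<kappa> g = C.coset (K g)"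
    by metis
  define L where "L = linear_extend (\<lambda>s. K (s ! 0))"
  have "L (push \<alpha> z) \<in> bar_boundaries R P 1"
  proof -
    obtain c where c: "c \<in> bar_chains R G (Suc 1)" "push \<alpha> z = bar_boundary G c"
      using pz by (elim bar_boundariesE)
    show ?thesis
      unfolding L_def c(2) bar_boundary_def linear_extend_comp using c(1)
    proof (rule linear_extend_mem_submodule)
      fix s assume "s \<in> lists (carrier G)" "length s = Suc 1"
      then obtain g h where s: "s = [g, h]" and gh: "g \<in> carrier G" "h \<in> carrier G"
        by (auto simp: length_Suc_conv)
      have "C.coset (K (g \<otimes>\<^bsub>G\<^esub> h)) = C.coset (K g + K h)"
        using hom_mult[OF \<kappa>(1) gh] K(2)[OF gh(1)] K(2)[OF gh(2)] K(2)[OF G.m_closed[OF gh]]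
          C.coset_mult[OF K(1)[OF gh(1)] K(1)[OF gh(2)]] by simp
      then have "K (g \<otimes>\<^bsub>G\<^esub> h) - (K g + K h) \<in> bar_boundaries R P 1"
        unfolding C.coset_eq_iff .
      from uminus_bar_boundaries[OF this]
      show "linear_extend (\<lambda>s. K (s ! 0)) (bar_boundary_basis G s) \<in> bar_boundaries R P 1"
        by (simp add: s bar_boundary_basis_simps linear_extend_simps algebra_simps)
    qed (intro zero_bar_boundaries add_bar_boundaries scale_bar_boundaries; assumption)+
  qed
  moreover have "L (push \<alpha> z) - z \<in> bar_boundaries R P 1"
  proof -
    have "linear_extend (\<lambda>s. K (\<alpha> (s ! 0)) + - basis s) z \<in> bar_boundaries R P 1"
      using z
    proof (rule linear_extend_mem_submodule)
      fix s assume "s \<in> lists (carrier P)" "length s = 1"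
      then obtain p where s: "s = [p]" and p: "p \<in> carrier P"
        by (auto simp: length_Suc_conv)
      have "C.coset (K (\<alpha> p)) = C.coset (basis [p])"
        using \<kappa>\<alpha>[OF p] K(2)[OF hom_in_carrier[OF \<alpha> p]] by simp
      then show "K (\<alpha> (s ! 0)) + - basis s \<in> bar_boundaries R P 1"
        unfolding C.coset_eq_iff s by simp
    qed (intro zero_bar_boundaries add_bar_boundaries scale_bar_boundaries; assumption)+
    also have "linear_extend (\<lambda>s. K (\<alpha> (s ! 0)) + - basis s) z = L (push \<alpha> z) - z"
    proof -
      have "L (push \<alpha> z) = linear_extend (\<lambda>s. K (\<alpha> (s ! 0))) z"
        unfolding L_def linear_extend_comp using z
      proof (rule linear_extend_chains_cong)
        fix s assume "s \<in> lists (carrier P)" "length s = 1"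
        then show "linear_extend (\<lambda>s. K (s ! 0)) (basis (map \<alpha> s)) = K (\<alpha> (s ! 0))" by simp
      qed
      then show ?thesis
        by (simp only: linear_extend_add_fun linear_extend_uminus_fun linear_extend_basis diff_conv_add_uminus)
    qed
    finally show ?thesis .
  qed
  ultimately show "z \<in> bar_boundaries R P 1"
    using diff_bar_boundaries[of "L (push \<alpha> z)" P 1 "L (push \<alpha> z) - z"] by simp
qed

text \<open>
  The cocycle \<open>(g, h) \<mapsto> [g|h]\<close> with values in \<open>C\<^sub>2(G; R) / B\<^sub>2(G; R)\<close> defines an extension of \<open>G\<close>, which
  splits because the relators can be solved in it. A splitting amounts to \<open>K g\<close> with
  \<open>[g|h] = K (g h) - K g - K h\<close> modulo boundaries, so every 2-chain is congruent to the negative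
  of the image under \<open>K\<close> of its boundary.
\<close>

lemma cycle_is_boundary:
  assumes z: "z \<in> bar_chains R G 2" and cycle: "bar_boundary G z = 0"
  shows "z \<in> bar_boundaries R G 2"
proof -
  note aq = additive_quotient_chains[OF G.is_monoid, of 2]
  interpret C: additive_quotient "bar_chains R G 2" "bar_boundaries R G 2" by (rule aq)
  let ?M = "additive_group (bar_chains R G 2) Mod bar_boundaries R G 2"
  interpret M: comm_group ?M by (rule C.comm_group_quotient)
  define f where "f = (\<lambda>g h. C.coset (basis [g, h]))"
  have b: "basis [g, h] \<in> bar_chains R G 2" if "g \<in> carrier G" "h \<in> carrier G" for g h
    using that by (intro basis_bar_chains) auto
  \<comment> \<open>The cocycle identity for [g|h] is, up to sign, the boundary of [g|h|l].\<close>
  interpret X: cocycle ?M G f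
  proof unfold_locales
    show "f g h \<in> carrier ?M" if "g \<in> carrier G" "h \<in> carrier G" for g h
      unfolding f_def by (rule C.coset_closed[OF b[OF that]])
    fix g h l assume g: "g \<in> carrier G" "h \<in> carrier G" "l \<in> carrier G"
    have "bar_boundary G (basis [g, h, l]) \<in> bar_boundaries R G 2"
      using g by (intro bar_boundariesI basis_bar_chains) auto
    from uminus_bar_boundaries[OF this]
    have "basis [g, h] + basis [g \<otimes>\<^bsub>G\<^esub> h, l] - (basis [h, l] + basis [g, h \<otimes>\<^bsub>G\<^esub> l]) \<in> bar_boundaries R G 2"
      by (simp add: bar_boundary_single bar_boundary_basis_simps algebra_simps)
    then show "f g h \<otimes>\<^bsub>?M\<^esub> f (g \<otimes>\<^bsub>G\<^esub> h) l = f h l \<otimes>\<^bsub>?M\<^esub> f g (h \<otimes>\<^bsub>G\<^esub> l)"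
      unfolding f_def using g by (simp only: C.coset_mult b G.m_closed C.coset_eq_iff)
  qed
  interpret E: group X.ext by (rule X.group_ext)
  interpret snd: group_hom X.ext G snd by (rule group_homI[OF E.is_group G.is_group X.snd_hom])
  interpret ce: group_hom ?M X.ext X.central_embedding
    by (rule group_homI[OF M.is_group E.is_group X.central_embedding_hom])
  \<comment> \<open>Any lift of the generators of \<open>G\<close> would do. The relators then land
    in the kernel of the projection to \<open>G\<close>, which is the central copy of the
    coefficient module.\<close>
  define t where "t = (\<lambda>j. (\<one>\<^bsub>?M\<^esub>, q (gen j)))"
  have t: "t j \<in> carrier X.ext" if "j < m + n" for j
    using gen_closed[OF that] unfolding t_def X.ext_simps by (intro SigmaI M.one_closed q.hom_closed)
  define \<tau> where "\<tau> = free_group_lift X.ext t"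
  have \<tau>: "\<tau> \<in> hom F X.ext" unfolding \<tau>_def by (rule lift_hom[OF E.is_group t])
  have snd_\<tau>: "snd (\<tau> u) = q u" if "u \<in> carrier F" for u
  proof -
    have "(snd \<circ> \<tau>) u = q u"
    proof (rule hom_eq[OF G.is_group hom_compose[OF \<tau> X.snd_hom] q _ that])
      show "(snd \<circ> \<tau>) (gen j) = q (gen j)" if "j < m + n" for j
        using lift_gen[OF E.is_group t that] unfolding \<tau>_def by (simp add: t_def)
    qed
    then show ?thesis by simp
  qed
  let ?C = "X.central_embedding ` carrier ?M"
  have C: "subgroup ?C X.ext" by (rule ce.img_is_subgroup)
  have "\<exists>\<sigma> \<in> hom F X.ext. (\<forall>k<n. \<sigma> (relator k) = \<one>\<^bsub>X.ext\<^esub>) \<and> (\<forall>j<m. \<sigma> (gen j) = \<tau> (gen j)) \<and>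
      (\<forall>u \<in> carrier F. \<exists>c \<in> ?C. \<sigma> u = \<tau> u \<otimes>\<^bsub>X.ext\<^esub> c)"
  proof (rule solve_relators[OF E.is_group C _ _ \<tau>])
    show "c \<otimes>\<^bsub>X.ext\<^esub> x = x \<otimes>\<^bsub>X.ext\<^esub> c" if "c \<in> ?C" "x \<in> carrier X.ext" for c x
      using that(1) X.central_embedding_commute[OF _ that(2)] by (elim imageE) (simp only:)
    fix c assume "c \<in> ?C"
    then obtain a where a: "a \<in> carrier ?M" "c = X.central_embedding a" by (elim imageE)
    obtain d where "d \<in> carrier ?M" "d [^]\<^bsub>?M\<^esub> e = a" using coset_root[OF aq a(1)] by (elim bexE)
    then show "\<exists>d \<in> ?C. d [^]\<^bsub>X.ext\<^esub> e = c"
      using ce.hom_int_pow[of d e] a(2) by (intro bexI[of _ "X.central_embedding d"] imageI) simp_all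
  next
    show "\<tau> (relator k) \<in> ?C" if "k < n" for k
      using that relator_closed[OF that] snd_\<tau> q_relator[OF that] hom_in_carrier[OF \<tau>]
      by (intro X.central_embedding_image) simp_all
  qed
  then obtain \<sigma> where \<sigma>: "\<sigma> \<in> hom F X.ext" "\<And>k. k < n \<Longrightarrow> \<sigma> (relator k) = \<one>\<^bsub>X.ext\<^esub>"
    "\<And>u. u \<in> carrier F \<Longrightarrow> \<exists>c \<in> ?C. \<sigma> u = \<tau> u \<otimes>\<^bsub>X.ext\<^esub> c" by blast
  obtain \<kappa> where \<kappa>: "\<kappa> \<in> hom G X.ext" "\<And>u. u \<in> carrier F \<Longrightarrow> \<kappa> (q u) = \<sigma> u"
    using descend[OF E.is_group \<sigma>(1,2)] by blast
  \<comment> \<open>The correction changed \<open>\<tau>\<close> only by central elements that lie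
    over 1, so \<open>\<kappa>\<close> is a section of the projection.\<close>
  have snd_\<kappa>: "snd (\<kappa> g) = g" if "g \<in> carrier G" for g
  proof -
    from that obtain u where u: "u \<in> carrier F" "g = q u" unfolding q_surj[symmetric] by (elim imageE)
    obtain a where "\<sigma> u = \<tau> u \<otimes>\<^bsub>X.ext\<^esub> X.central_embedding a"
      using \<sigma>(3)[OF u(1)] by (elim bexE imageE) simp
    then show ?thesis
      using u \<kappa>(2) snd_\<tau> by (simp add: X.ext_simps(2) X.snd_central_embedding)
  qed
  have "\<exists>c. c \<in> bar_chains R G 2 \<and> fst (\<kappa> g) = C.coset c" if "g \<in> carrier G" for g
  proof -
    have "fst (\<kappa> g) \<in> carrier ?M" using hom_in_carrier[OF \<kappa>(1) that] unfolding X.ext_simps mem_Times_iff by (rule conjunct1)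
    then show ?thesis unfolding C.carrier_quotient by blast
  qed
  then obtain K where K: "\<And>g. g \<in> carrier G \<Longrightarrow> K g \<in> bar_chains R G 2"
    "\<And>g. g \<in> carrier G \<Longrightarrow> fst (\<kappa> g) = C.coset (K g)"
    by metis
  \<comment> \<open>This is the first component of \<kappa>(gh) = \<kappa>(g) \<kappa>(h), read in
    chains modulo boundaries; the cocycle contributes [g|h].\<close>
  have split: "basis [g, h] + (K h - K (g \<otimes>\<^bsub>G\<^esub> h) + K g) \<in> bar_boundaries R G 2"
    if gh: "g \<in> carrier G" "h \<in> carrier G" for g h
  proof -
    have "fst (\<kappa> (g \<otimes>\<^bsub>G\<^esub> h)) = fst (\<kappa> g) \<otimes>\<^bsub>?M\<^esub> fst (\<kappa> h) \<otimes>\<^bsub>?M\<^esub> f (snd (\<kappa> g)) (snd (\<kappa> h))"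
      using hom_mult[OF \<kappa>(1) gh] by (simp add: X.ext_simps(2))
    then have "C.coset (K (g \<otimes>\<^bsub>G\<^esub> h)) = C.coset (K g + K h + basis [g, h])"
      unfolding snd_\<kappa>[OF gh(1)] snd_\<kappa>[OF gh(2)] f_def
      by (simp only: K gh G.m_closed C.coset_mult add_bar_chains b)
    then have "K (g \<otimes>\<^bsub>G\<^esub> h) - (K g + K h + basis [g, h]) \<in> bar_boundaries R G 2"
      unfolding C.coset_eq_iff .
    from uminus_bar_boundaries[OF this] show ?thesis by (simp add: algebra_simps)
  qed
  define L where "L = linear_extend (\<lambda>s. K (s ! 0))"
  have "linear_extend (\<lambda>s. basis s + L (bar_boundary_basis G s)) z \<in> bar_boundaries R G 2"
    using z
  proof (rule linear_extend_mem_submodule)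
    fix s assume "s \<in> lists (carrier G)" "length s = 2"
    then obtain g h where s: "s = [g, h]" and gh: "g \<in> carrier G" "h \<in> carrier G"
      by (auto simp: length_Suc_conv numeral_2_eq_2)
    have "L (bar_boundary_basis G s) = K h - K (g \<otimes>\<^bsub>G\<^esub> h) + K g"
      by (simp add: L_def s bar_boundary_basis_simps linear_extend_simps)
    then show "basis s + L (bar_boundary_basis G s) \<in> bar_boundaries R G 2"
      using split[OF gh] by (simp only: s)
  qed (intro zero_bar_boundaries add_bar_boundaries scale_bar_boundaries; assumption)+
  also have "linear_extend (\<lambda>s. basis s + L (bar_boundary_basis G s)) z = z + L (bar_boundary G z)"
    by (simp add: linear_extend_add_fun L_def bar_boundary_def linear_extend_comp)
  also have "\<dots> = z" by (simp add: cycle L_def)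
  finally show ?thesis .
qed

text \<open>The target vanishes by \<open>cycle_is_boundary\<close>, so the zero cycle of
  \<open>P\<close> serves for every class.\<close>

lemma H2_surj_\<alpha>: "H2_surj P G \<alpha>"
  unfolding H2_surj_def
  using cycle_is_boundary by (intro ballI impI bexI[of _ 0] conjI) (simp_all add: bar_boundary_linear zero_bar_chains)

lemma in_Omega_\<alpha>:
  assumes "finitely_presented_group G"
  shows "in_Omega R P G \<alpha>"
proof -
  have "finitely_generated_group P"
    unfolding finitely_generated_group_def
    using P.is_group y_closed y_generate by (intro conjI exI[of _ "y ` {..<m}"]) auto
  then show ?thesis
    unfolding in_Omega_iff using assms \<alpha> H1_surj_\<alpha> H1_inj_\<alpha> H2_surj_\<alpha> by blast
qed

end

section \<open>Local groups are closed\<close>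

text \<open>The groups constructed here consist of classes of words or of cosets of such, whereas
  \<open>Omega_local\<close> quantifies over groups on two given types. Numbering the carrier and
  injecting the natural numbers into the type transports the structure.\<close>

lemma countable_group_copy:
  assumes "group H" "countable (carrier H)"
  shows "\<exists>(G :: 'g::infinite monoid) j. group G \<and> j \<in> iso H G"
proof -
  interpret H: group H by fact
  obtain f :: "nat \<Rightarrow> 'g" where f: "inj f"
    using infinite_countable_subset[OF infinite_UNIV] by blast
  define j where "j = f \<circ> to_nat_on (carrier H)"
  have j: "inj_on j (carrier H)"
    unfolding j_def using inj_on_to_nat_on[OF assms(2)] f by (intro comp_inj_on) (auto intro: inj_on_subset)
  define G :: "'g monoid" where "G = \<lparr>carrier = j ` carrier H,
    monoid.mult = (\<lambda>x y. j (inv_into (carrier H) j x \<otimes>\<^bsub>H\<^esub> inv_into (carrier H) j y)), one = j \<one>\<^bsub>H\<^esub>\<rparr>"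
  have "j \<in> iso H G"
    unfolding iso_def hom_def bij_betw_def using j by (auto simp: G_def inv_into_f_f)
  \<comment> \<open>\<open>iso_imp_img_group\<close> yields a group only after the unit has been
    replaced by the image of the unit, which here changes nothing.\<close>
  moreover have "G\<lparr>one := j \<one>\<^bsub>H\<^esub>\<rparr> = G" by (simp add: G_def)
  ultimately show ?thesis using H.iso_imp_img_group[of j G] by metis
qed

lemma generate_finite_support:
  assumes "group G" "S \<subseteq> carrier G" "x \<in> generate G S"
  shows "\<exists>T. finite T \<and> T \<subseteq> S \<and> x \<in> generate G T"
  using assms(3)
proof (induction rule: generate.induct)
  case one
  show ?case using generate.one by blast
next
  case (incl h)
  then show ?case by (intro exI[of _ "{h}"]) (auto intro: generate.incl)
next
  case (inv h)
  then show ?case by (intro exI[of _ "{h}"]) (auto intro: generate.inv)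
next
  case (eng a b)
  then obtain T1 T2 where T: "finite T1" "T1 \<subseteq> S" "a \<in> generate G T1" "finite T2" "T2 \<subseteq> S" "b \<in> generate G T2"
    by blast
  have "generate G T1 \<subseteq> generate G (T1 \<union> T2)" "generate G T2 \<subseteq> generate G (T1 \<union> T2)"
    by (rule group.mono_generate[OF assms(1)]; blast)+
  then have "a \<otimes>\<^bsub>G\<^esub> b \<in> generate G (T1 \<union> T2)"
    using T by (intro generate.eng) blast+
  with T show ?case by (intro exI[of _ "T1 \<union> T2"]) blast
qed

text \<open>Finitely many words involve finitely many elements of \<open>A\<close>. These will
  correspond to the generators of the source \<open>P\<close>, which must be finitely
  generated.\<close>

lemma free_product_finite_coefficients:
  fixes A :: "('a, 'k) monoid_scheme" and n :: nat
  assumes "group A" and w: "\<And>i. i < n \<Longrightarrow> w i \<in> carrier (free_product A (free_group I))"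
  shows "\<exists>(m::nat) a. a \<in> {..<m} \<rightarrow> carrier A \<and>
    (\<forall>i<n. w i \<in> generate (free_product A (free_group I))
      (free_inl A (free_group I) ` a ` {..<m} \<union> free_inr A (free_group I) ` free_gen I ` I))"
proof -
  let ?F = "free_group I" and ?W = "free_product A (free_group I)"
  let ?inl = "free_inl A (free_group I)" and ?inr = "free_inr A (free_group I)"
  interpret A: group A by fact
  interpret F: group ?F by (rule group_free_group)
  interpret AF: group_pair A ?F by unfold_locales
  have W: "group ?W" by (rule AF.group_free_product)
  interpret W: group ?W by (rule W)
  let ?S = "?inl ` carrier A \<union> ?inr ` free_gen I ` I"
  have S: "?S \<subseteq> carrier ?W"
    using hom_in_carrier[OF AF.free_inr_hom free_gen_closed]
    by (intro Un_least image_subsetI hom_in_carrier[OF AF.free_inl_hom]) auto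
  have sub: "subgroup (generate ?W ?S) ?W" by (rule W.generate_is_subgroup[OF S])
  have "?inr u \<in> generate ?W ?S" if "u \<in> carrier ?F" for u
  proof (rule generate_preimage[OF group_free_group W AF.free_inr_hom sub free_gen_subset])
    show "u \<in> generate ?F (free_gen I ` I)" using that unfolding free_group_generated .
  qed (auto intro: generate.incl)
  then have "?inl ` carrier A \<union> ?inr ` carrier ?F \<subseteq> generate ?W ?S"
    by (auto intro: generate.incl)
  from W.generate_subgroup_incl[OF this sub]
  have gen: "carrier ?W \<subseteq> generate ?W ?S" unfolding AF.free_product_generated .
  have "\<exists>T. finite T \<and> T \<subseteq> ?S \<and> w i \<in> generate ?W T" if "i < n" for i
    using generate_finite_support[OF W S] w[OF that] gen by blast
  then obtain T where T: "\<And>i. i < n \<Longrightarrow> finite (T i)" "\<And>i. i < n \<Longrightarrow> T i \<subseteq> ?S"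
    "\<And>i. i < n \<Longrightarrow> w i \<in> generate ?W (T i)" by metis
  \<comment> \<open>Of the finite supports only the part coming from \<open>A\<close> has to be
    collected; what remains consists of free generators.\<close>
  have "finite (\<Union>i<n. T i \<inter> ?inl ` carrier A)" "(\<Union>i<n. T i \<inter> ?inl ` carrier A) \<subseteq> ?inl ` carrier A"
    using T(1) by auto
  from finite_subset_image[OF this]
  obtain B where B: "B \<subseteq> carrier A" "finite B" "(\<Union>i<n. T i \<inter> ?inl ` carrier A) = ?inl ` B"
    by (elim exE conjE)
  obtain m :: nat and a where a: "B = a ` {..<m}"
    using finite_imp_nat_seg_image_inj_on[OF B(2)] unfolding lessThan_def by blast
  show ?thesis
  proof (intro exI conjI allI impI)
    show "a \<in> {..<m} \<rightarrow> carrier A" using a B(1) by auto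
    fix i assume i: "i < n"
    have "T i \<subseteq> ?inl ` a ` {..<m} \<union> ?inr ` free_gen I ` I"
    proof
      fix x assume x: "x \<in> T i"
      show "x \<in> ?inl ` a ` {..<m} \<union> ?inr ` free_gen I ` I"
      proof (cases "x \<in> ?inl ` carrier A")
        case True
        with x have "x \<in> T i \<inter> ?inl ` carrier A" by (rule IntI)
        with i have "x \<in> (\<Union>i<n. T i \<inter> ?inl ` carrier A)" by (intro UN_I[of i]) simp_all
        then show ?thesis unfolding B(3) a by (rule UnI1)
      next
        case False
        then have "x \<in> ?inr ` free_gen I ` I" using subsetD[OF T(2)[OF i] x] by simp
        then show ?thesis by (rule UnI2)
      qed
    qed
    then show "w i \<in> generate ?W (?inl ` a ` {..<m} \<union> ?inr ` free_gen I ` I)"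
      using subsetD[OF W.mono_generate T(3)[OF i]] by simp
  qed
qed

text \<open>Locality is used for a single map: the existence of an extension yields a solution, and
  its uniqueness shows that two solutions agree. The two sides are linked by
  \<open>\<tau> g\<close>, the homomorphism on the free group on coefficients and unknowns that a
  tuple \<open>g\<close> determines.\<close>

lemma (in rat_subring) Omega_local_imp_R_closed:
  fixes A :: "'a monoid"
  assumes A: "group A" and local: "Omega_local TYPE('p::infinite) TYPE('g::infinite) R A"
  shows "R_closed R A"
  unfolding R_closed_def
proof (intro allI impI)
  fix n e w
  assume null: "nullhomologous_system R A n e w"
  interpret A: group A by (rule A)
  define Fn where "Fn = free_group {..<n}"
  define W where "W = free_product A Fn"
  have Fn: "group Fn" unfolding Fn_def by (rule group_free_group)
  interpret Fn: group Fn by (rule Fn)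
  interpret AF: group_pair A Fn by unfold_locales
  have W: "group W" unfolding W_def by (rule AF.group_free_product)
  interpret W: group W by (rule W)
  have e: "e \<in> denominators R" and wW: "\<And>i. i < n \<Longrightarrow> w i \<in> carrier W"
    using null unfolding nullhomologous_system_def W_def Fn_def by blast+
  define pr :: "('a + (nat \<times> bool) list set) list set \<Rightarrow> (nat \<times> bool) list set"
    where "pr = free_projection Fn"
  have pr_w: "pr (w i) \<in> derived Fn (carrier Fn)" if "i < n" for i
    using null that proj_H1_one_iff[OF A, of "w i" n] unfolding nullhomologous_system_def pr_def Fn_def by blast
  have "\<exists>(m::nat) a. a \<in> {..<m} \<rightarrow> carrier A \<and>
      (\<forall>i<n. w i \<in> generate W (free_inl A Fn ` a ` {..<m} \<union> free_inr A Fn ` free_gen {..<n} ` {..<n}))"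
    using free_product_finite_coefficients[OF A, where n = n and w = w and I = "{..<n}", folded Fn_def W_def] wW by blast
  then obtain m :: nat and a where a: "a \<in> {..<m} \<rightarrow> carrier A"
    and w_gen: "\<And>i. i < n \<Longrightarrow> w i \<in> generate W (free_inl A Fn ` a ` {..<m} \<union> free_inr A Fn ` free_gen {..<n} ` {..<n})"
    by blast

  \<comment> \<open>The words of the system lie in A * F, the relators in a free group on m + n
    generators. \<open>\<Theta>\<close> compares the two: it sends the first m generators to the
    coefficients and the others to the unknowns, and each \<open>w k\<close> has a preimage
    \<open>v k\<close>.\<close>
  define t where "t = (\<lambda>j. if j < m then free_inl A Fn (a j) else free_inr A Fn (free_gen {..<n} (j - m)))"
  have fg: "free_gen {..<n} i \<in> carrier Fn" if "i < n" for i
    unfolding Fn_def by (rule free_gen_closed) (use that in simp)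
  have inl: "free_inl A Fn \<in> hom A W" and inr: "free_inr A Fn \<in> hom Fn W"
    unfolding W_def by (rule AF.free_inl_hom AF.free_inr_hom)+
  have t: "t \<in> {..<m + n} \<rightarrow> carrier W"
    using hom_in_carrier[OF inl funcset_mem[OF a]] hom_in_carrier[OF inr fg] by (auto simp: t_def)
  define \<Theta> where "\<Theta> = free_group_lift W t"
  have \<Theta>: "\<Theta> \<in> hom (free_group {..<m + n}) W" unfolding \<Theta>_def by (rule free_group_lift_hom[OF W t])
  have \<Theta>_gen: "\<Theta> (free_gen {..<m + n} j) = t j" if "j < m + n" for j
    unfolding \<Theta>_def using that by (intro free_group_lift_gen[OF W t]) simp
  interpret \<Theta>: group_hom "free_group {..<m + n}" W \<Theta> by (rule group_homI[OF group_free_group W \<Theta>])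
  have "t j \<in> \<Theta> ` carrier (free_group {..<m + n})" if "j < m + n" for j
    using \<Theta>_gen[OF that] free_gen_closed[of j "{..<m + n}"] that by (metis image_eqI lessThan_iff)
  moreover have "free_inl A Fn (a j) = t j" if "j < m" for j using that by (simp add: t_def)
  moreover have "free_inr A Fn (free_gen {..<n} i) = t (m + i)" for i by (simp add: t_def)
  ultimately have "free_inl A Fn ` a ` {..<m} \<union> free_inr A Fn ` free_gen {..<n} ` {..<n}
      \<subseteq> \<Theta> ` carrier (free_group {..<m + n})"
    unfolding image_image by (intro Un_least image_subsetI) simp_all
  from W.generate_subgroup_incl[OF this \<Theta>.img_is_subgroup]
  have "\<exists>v. v \<in> carrier (free_group {..<m + n}) \<and> \<Theta> v = w k" if "k < n" for k
    using w_gen[OF that] by blast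
  then obtain v where v: "\<And>k. k < n \<Longrightarrow> v k \<in> carrier (free_group {..<m + n})" "\<And>k. k < n \<Longrightarrow> \<Theta> (v k) = w k"
    by metis

  have pr: "pr \<in> hom W Fn" unfolding pr_def W_def Fn_def by (rule proj_free_group_hom(1)[OF A])
  have pr_t: "pr (t j) = (if j < m then \<one>\<^bsub>Fn\<^esub> else free_gen {..<n} (j - m))" if "j < m + n" for j
    using that a proj_free_group_hom(2)[OF A, of "a j" n] proj_free_group_hom(3)[OF A fg[of "j - m", unfolded Fn_def]]
    unfolding pr_def t_def Fn_def by auto
  interpret S: system_presentation m n e v
  proof
    show "v k \<in> carrier (free_group {..<m + n})" if "k < n" for k by (rule v(1)[OF that])
    fix k assume k: "k < n"
    let ?s = "\<lambda>j. if j < m then \<one>\<^bsub>free_group {..<n}\<^esub> else free_gen {..<n} (j - m)"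
    have s: "?s \<in> {..<m + n} \<rightarrow> carrier Fn"
      using fg Fn.one_closed by (auto simp: Fn_def)
    \<comment> \<open>Killing the coefficient generators is the same as projecting after
      \<open>\<Theta>\<close>, so \<open>v k\<close> is nullhomologous because \<open>w k\<close>
      is.\<close>
    have "free_group_lift Fn ?s (v k) = (pr \<circ> \<Theta>) (v k)"
    proof (rule free_group_hom_unique[OF Fn free_group_lift_hom[OF Fn s] hom_compose[OF \<Theta> pr] _ v(1)[OF k]])
      fix j assume j: "j \<in> {..<m + n}"
      then show "free_group_lift Fn ?s (free_gen {..<m + n} j) = (pr \<circ> \<Theta>) (free_gen {..<m + n} j)"
        using free_group_lift_gen[OF Fn s j] \<Theta>_gen[of j] pr_t[of j] by (simp add: Fn_def)
    qed
    then show "free_group_lift (free_group {..<n}) ?s (v k) \<in> derived (free_group {..<n}) (carrier (free_group {..<n}))"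
      using pr_w[OF k] v(2)[OF k] by (simp add: Fn_def)
  qed

  define N where "N = normal_closure S.F (S.relator ` {..<n})"
  have rel: "S.relator ` {..<n} \<subseteq> carrier S.F" using S.relator_closed by auto
  have N: "N \<lhd> S.F" unfolding N_def by (rule normal_closure_normal[OF S.F.is_group rel])
  have "countable (carrier (S.F Mod N))"
    unfolding carrier_FactGroup S.F_def by (rule countable_image[OF countable_carrier_free_group])
  from countable_group_copy[OF normal.factorgroup_is_group[OF N] this]
  obtain G :: "'g monoid" and jG where G: "group G" and jG: "jG \<in> iso (S.F Mod N) G" by blast
  interpret G: group G by (rule G)
  define q where "q = (\<lambda>x. jG (N #>\<^bsub>S.F\<^esub> x))"
  note q = quotient_projection[OF S.F.is_group N G jG, folded q_def]
  interpret q: group_hom S.F G q by (rule group_homI[OF S.F.is_group G q(1)])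
  have fp: "finitely_presented_group G"
    unfolding finitely_presented_group_def
  proof (intro conjI exI)
    show "group G" "finite (S.relator ` {..<n})" by (rule G) simp
    show "S.relator ` {..<n} \<subseteq> carrier (free_group {..<m + n})" using rel by (simp only: S.F_def)
    have "S.F Mod N \<cong> G" using jG unfolding is_iso_def by blast
    from group.iso_sym[OF normal.factorgroup_is_group[OF N] this]
    show "G \<cong> free_group {..<m + n} Mod normal_closure (free_group {..<m + n}) (S.relator ` {..<n})"
      unfolding N_def by (simp only: S.F_def)
  qed
  from countable_group_copy[OF group_free_group countable_carrier_free_group, of "{..<m}"]
  obtain P :: "'p monoid" and j where P: "group P" and j: "j \<in> iso (free_group {..<m}) P" by blast
  interpret P: group P by (rule P)
  \<comment> \<open>Maps out of \<open>P\<close> are defined on the free group and pulled back along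
    the inverse of the copying isomorphism.\<close>
  define j' where "j' = inv_into (carrier (free_group {..<m})) j"
  have jh: "j \<in> hom (free_group {..<m}) P" and jb: "bij_betw j (carrier (free_group {..<m})) (carrier P)"
    using j unfolding iso_def by blast+
  have j'h: "j' \<in> hom P (free_group {..<m})"
    using group.iso_set_sym[OF group_free_group j] unfolding j'_def iso_def by blast
  have j'j: "j' (j u) = u" if "u \<in> carrier (free_group {..<m})" for u
    unfolding j'_def by (rule inv_into_f_f[OF bij_betw_imp_inj_on[OF jb] that])
  define y where "y = (\<lambda>i. j (free_gen {..<m} i))"
  have gm: "free_gen {..<m} i \<in> carrier (free_group {..<m})" if "i < m" for i
    by (rule free_gen_closed) (use that in simp)
  have yP: "y i \<in> carrier P" if "i < m" for i
    unfolding y_def by (rule hom_in_carrier[OF jh gm[OF that]])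
  have y_gen: "generate P (y ` {..<m}) = carrier P"
  proof
    have yP': "y ` {..<m} \<subseteq> carrier P" using yP by auto
    show "generate P (y ` {..<m}) \<subseteq> carrier P" by (rule P.generate_incl[OF yP'])
    have "j u \<in> generate P (y ` {..<m})" if "u \<in> carrier (free_group {..<m})" for u
    proof (rule generate_preimage[OF group_free_group P jh P.generate_is_subgroup[OF yP'] free_gen_subset])
      show "u \<in> generate (free_group {..<m}) (free_gen {..<m} ` {..<m})"
        using that unfolding free_group_generated .
    qed (auto simp: y_def intro: generate.incl)
    then show "carrier P \<subseteq> generate P (y ` {..<m})"
      unfolding bij_betw_imp_surj_on[OF jb, symmetric] by (rule image_subsetI)
  qed
  have q_gen: "(\<lambda>i. q (S.gen i)) \<in> {..<m} \<rightarrow> carrier G"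
    using S.gen_closed by auto
  define \<alpha> where "\<alpha> = free_group_lift G (\<lambda>i. q (S.gen i)) \<circ> j'"
  define \<phi> where "\<phi> = free_group_lift A a \<circ> j'"
  have \<alpha>: "\<alpha> \<in> hom P G" unfolding \<alpha>_def by (rule hom_compose[OF j'h free_group_lift_hom[OF G q_gen]])
  have \<phi>: "\<phi> \<in> hom P A" unfolding \<phi>_def by (rule hom_compose[OF j'h free_group_lift_hom[OF A a]])
  have \<alpha>_y: "\<alpha> (y i) = q (S.gen i)" and \<phi>_y: "\<phi> (y i) = a i" if "i < m" for i
    unfolding \<alpha>_def \<phi>_def y_def o_apply j'j[OF gm[OF that]] using that
    by (simp_all add: free_group_lift_gen[OF G q_gen] free_group_lift_gen[OF A a])
  interpret X: presented_extension m n e v R P G q \<alpha> y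
    by unfold_locales (use e q N_def \<alpha> yP y_gen \<alpha>_y in simp_all)
  have "\<exists>!\<psi>. \<psi> \<in> hom G A \<inter> extensional (carrier G) \<and> (\<forall>x\<in>carrier P. \<psi> (\<alpha> x) = \<phi> x)"
    using local X.in_Omega_\<alpha>[OF fp] \<phi> unfolding Omega_local_def by blast
  then obtain \<psi> where \<psi>: "\<psi> \<in> hom G A" "\<And>x. x \<in> carrier P \<Longrightarrow> \<psi> (\<alpha> x) = \<phi> x"
    and \<psi>_unique: "\<And>\<psi>' \<psi>''. \<psi>' \<in> hom G A \<inter> extensional (carrier G) \<and> (\<forall>x\<in>carrier P. \<psi>' (\<alpha> x) = \<phi> x) \<Longrightarrow>
      \<psi>'' \<in> hom G A \<inter> extensional (carrier G) \<and> (\<forall>x\<in>carrier P. \<psi>'' (\<alpha> x) = \<phi> x) \<Longrightarrow> \<psi>' = \<psi>''"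
    by blast

  define \<tau> where "\<tau> = (\<lambda>g. free_group_lift A (\<lambda>i. if i < m then a i else g (i - m)))"
  have \<tau>_closed: "(if i < m then a i else g (i - m)) \<in> carrier A" if "g \<in> {..<n} \<rightarrow> carrier A" "i < m + n" for g i
    using that a by (auto simp: Pi_iff)
  have \<tau>: "\<tau> g \<in> hom S.F A" if "g \<in> {..<n} \<rightarrow> carrier A" for g
    unfolding \<tau>_def by (rule S.lift_hom[OF A \<tau>_closed[OF that]])
  have \<tau>_gen: "\<tau> g (S.gen i) = (if i < m then a i else g (i - m))" if "g \<in> {..<n} \<rightarrow> carrier A" "i < m + n" for g i
    unfolding \<tau>_def by (rule S.lift_gen[OF A \<tau>_closed[OF that(1)] that(2)])
  \<comment> \<open>Evaluating at \<open>g\<close> after \<open>\<Theta>\<close> agrees with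
    \<open>\<tau> g\<close> on the generators, hence on \<open>v k\<close>.\<close>
  have \<tau>_v: "\<tau> g (v k) = system_eval A g (w k)"
    if g: "g \<in> {..<n} \<rightarrow> carrier A" and k: "k < n" for g k
  proof -
    let ?ev = "system_eval A g"
    have ev: "?ev \<in> hom W A" unfolding W_def Fn_def by (rule system_eval_hom(1)[OF A g])
    have "\<tau> g (v k) = (?ev \<circ> \<Theta>) (v k)"
    proof (rule S.hom_eq[OF A \<tau>[OF g] hom_compose[OF \<Theta>[folded S.F_def] ev]])
      show "v k \<in> carrier S.F" unfolding S.F_def by (rule v(1)[OF k])
      fix i assume i: "i < m + n"
      have "?ev (free_inl A Fn (a i)) = a i" if "i < m"
        using that a unfolding Fn_def by (intro system_eval_hom(2)[OF A g]) auto
      moreover have "?ev (free_inr A Fn (free_gen {..<n} (i - m))) = g (i - m)" if "\<not> i < m"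
        using that i system_eval_hom(3)[OF A g fg[of "i - m", unfolded Fn_def]] free_group_lift_gen[OF A g, of "i - m"]
        unfolding Fn_def by simp
      ultimately have "?ev (t i) = (if i < m then a i else g (i - m))" by (simp add: t_def)
      then show "\<tau> g (S.gen i) = (?ev \<circ> \<Theta>) (S.gen i)"
        using \<tau>_gen[OF g i] \<Theta>_gen[OF i] by (simp add: S.gen_def)
    qed
    then show ?thesis using v(2)[OF k] by simp
  qed
  have solution_iff: "system_solution A n e w g \<longleftrightarrow> (\<forall>k<n. \<tau> g (S.relator k) = \<one>\<^bsub>A\<^esub>)"
    if gE: "g \<in> {..<n} \<rightarrow>\<^sub>E carrier A" for g
  proof -
    have g: "g \<in> {..<n} \<rightarrow> carrier A" using gE by auto
    have "\<tau> g (S.relator k) = \<one>\<^bsub>A\<^esub> \<longleftrightarrow> g k [^]\<^bsub>A\<^esub> e = system_eval A g (w k)"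
      if k: "k < n" for k
      unfolding S.hom_relator_one_iff[OF A \<tau>[OF g] k] \<tau>_v[OF g k] using \<tau>_gen[OF g, of "m + k"] k by simp
    then show ?thesis unfolding system_solution_def using gE by simp
  qed
  \<comment> \<open>A solution makes \<open>\<tau> g\<close> kill the relators, hence descend to
    \<open>G\<close>. The descended map is restricted to the carrier because locality asserts
    uniqueness among extensional maps.\<close>
  have extension: "\<exists>\<kappa>. \<kappa> \<in> hom G A \<inter> extensional (carrier G) \<and> (\<forall>x\<in>carrier P. \<kappa> (\<alpha> x) = \<phi> x) \<and>
      (\<forall>i<n. \<kappa> (q (S.gen (m + i))) = g i)" if sol: "system_solution A n e w g" for g
  proof -
    have gE: "g \<in> {..<n} \<rightarrow>\<^sub>E carrier A" using sol unfolding system_solution_def by blast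
    then have g: "g \<in> {..<n} \<rightarrow> carrier A" by auto
    have "\<tau> g (S.relator k) = \<one>\<^bsub>A\<^esub>" if "k < n" for k
      using sol that unfolding solution_iff[OF gE] by blast
    from X.descend[OF A \<tau>[OF g] this]
    obtain \<kappa>0 where \<kappa>0: "\<kappa>0 \<in> hom G A" "\<And>u. u \<in> carrier S.F \<Longrightarrow> \<kappa>0 (q u) = \<tau> g u" by blast
    define \<kappa> where "\<kappa> = restrict \<kappa>0 (carrier G)"
    have \<kappa>: "\<kappa> \<in> hom G A \<inter> extensional (carrier G)"
      using \<kappa>0(1) unfolding \<kappa>_def by (auto simp: hom_def)
    have \<kappa>q: "\<kappa> (q u) = \<tau> g u" if "u \<in> carrier S.F" for u
      using \<kappa>0(2)[OF that] q.hom_closed[OF that] by (simp add: \<kappa>_def)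
    have "(\<kappa> \<circ> \<alpha>) x = \<phi> x" if "x \<in> carrier P" for x
    proof (rule hom_eq_on_generate[OF P A hom_compose[OF \<alpha>] \<phi>])
      show "\<kappa> \<in> hom G A" using \<kappa> by blast
      show "y ` {..<m} \<subseteq> carrier P" using yP by auto
      show "x \<in> generate P (y ` {..<m})" using that y_gen by simp
      fix s assume "s \<in> y ` {..<m}"
      then obtain i where i: "i < m" "s = y i" by auto
      then show "(\<kappa> \<circ> \<alpha>) s = \<phi> s"
        using \<alpha>_y[OF i(1)] \<phi>_y[OF i(1)] \<kappa>q[OF S.gen_closed, of i] \<tau>_gen[OF g, of i] by simp
    qed
    moreover have "\<kappa> (q (S.gen (m + i))) = g i" if "i < n" for i
      using that \<kappa>q[OF S.gen_closed, of "m + i"] \<tau>_gen[OF g, of "m + i"] by simp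
    ultimately show ?thesis using \<kappa> by (intro exI[of _ \<kappa>]) simp
  qed

  show "\<exists>!g. system_solution A n e w g"
  proof (rule ex_ex1I)
    interpret \<psi>: group_hom G A \<psi> by (rule group_homI[OF G A \<psi>(1)])
    \<comment> \<open>The solution is read off at the images of the unknowns, which are the
      generators m, ..., m + n - 1.\<close>
    define g where "g = (\<lambda>i\<in>{..<n}. \<psi> (q (S.gen (m + i))))"
    have gE: "g \<in> {..<n} \<rightarrow>\<^sub>E carrier A"
      unfolding g_def using S.gen_closed by auto
    then have g: "g \<in> {..<n} \<rightarrow> carrier A" by auto
    have \<tau>\<psi>: "\<tau> g u = (\<psi> \<circ> q) u" if "u \<in> carrier S.F" for u
    proof (rule S.hom_eq[OF A \<tau>[OF g] hom_compose[OF q(1) \<psi>(1)] _ that])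
      fix i assume i: "i < m + n"
      have "\<psi> (q (S.gen i)) = a i" if "i < m"
        using \<psi>(2)[OF yP[OF that]] \<alpha>_y[OF that] \<phi>_y[OF that] by simp
      then show "\<tau> g (S.gen i) = (\<psi> \<circ> q) (S.gen i)"
        using \<tau>_gen[OF g i] i by (cases "i < m") (simp_all add: g_def less_diff_conv2)
    qed
    have "\<tau> g (S.relator k) = \<one>\<^bsub>A\<^esub>" if "k < n" for k
      using \<tau>\<psi>[OF S.relator_closed[OF that]] X.q_relator[OF that] by simp
    then show "\<exists>g. system_solution A n e w g"
      using solution_iff[OF gE] by blast
  next
    fix g h assume gh: "system_solution A n e w g" "system_solution A n e w h"
    obtain \<kappa> where \<kappa>: "\<kappa> \<in> hom G A \<inter> extensional (carrier G)" "\<forall>x\<in>carrier P. \<kappa> (\<alpha> x) = \<phi> x"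
      "\<forall>i<n. \<kappa> (q (S.gen (m + i))) = g i" using extension[OF gh(1)] by blast
    obtain \<mu> where \<mu>: "\<mu> \<in> hom G A \<inter> extensional (carrier G)" "\<forall>x\<in>carrier P. \<mu> (\<alpha> x) = \<phi> x"
      "\<forall>i<n. \<mu> (q (S.gen (m + i))) = h i" using extension[OF gh(2)] by blast
    have "\<kappa> = \<mu>" by (rule \<psi>_unique[OF conjI[OF \<kappa>(1,2)] conjI[OF \<mu>(1,2)]])
    then have eq: "g i = h i" if "i < n" for i
      using \<kappa>(3) \<mu>(3) that by metis
    have "g \<in> {..<n} \<rightarrow>\<^sub>E carrier A" "h \<in> {..<n} \<rightarrow>\<^sub>E carrier A"
      using gh unfolding system_solution_def by blast+
    then show "g = h" by (rule PiE_ext) (use eq in simp)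
  qed
qed

theorem theorem5p2:
  fixes R :: "rat set" and A :: "'a monoid"
  assumes "subring R (ring_of_type_algebra :: rat ring)"
    and "group A"
  shows "R_closed R A \<longleftrightarrow> Omega_local TYPE('p::infinite) TYPE('g::infinite) R A"
proof -
  interpret rat_subring R by (rule rat_subringI[OF assms(1)])
  show ?thesis
  proof
    assume "R_closed R A"
    then show "Omega_local TYPE('p) TYPE('g) R A"
      unfolding Omega_local_def using R_closed_imp_extension[OF assms(2)] by blast
  next
    assume "Omega_local TYPE('p) TYPE('g) R A"
    then show "R_closed R A"
      by (rule Omega_local_imp_R_closed[OF assms(2)])
  qed
qed

end
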